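(* Let $\Gamma=\langle\tau,\mu\rangle$ be the Brunner–Sidki–Vieira group acting on the rooted binary tree, let $c=[\tau,\mu]$, and let $\mathcal L(\Gamma)=\bigoplus_{n\ge1}\Gamma_n/\Gamma_{n+1}$ be its restricted graded Lie algebra over $\mathbb F_2$ associated with the $2$-dimension series $(\Gamma_n)$. Let $\mathsf 0,\mathsf 1$ be the endomorphisms $\mathsf 0(g)=(g,1)$, $\mathsf 1(g)=(g,g)$ of $\Gamma'$. Then the (images of the) following elements form a basis of $\mathcal L(\Gamma)$: (1) $\tau^{2^n}$ for all $n\ge0$, of degree $2^n$; (2) $\mu^{2^n}$ for all $n\ge0$, of degree $2^n$; (3) $W(c)^{2^n}$ for all $m\ge0$, all words $W=W_1\dots W_m\in\{\mathsf 0,\mathsf 1\}^m$ and all $n\ge0$, of degree $2^n\left(\sum_{i=1}^m W_i2^{i-1}+2^m+1\right)$, where in this formula $W_i$ is read as the integer $0$ or $1$. The arrows in the Lie graph of $\mathcal L(\Gamma)$ with respect to this basis are as follows (equalities in $\mathcal L(\Gamma)$, for all $n\ge0$): (a) an arrow labelled $\mu$ from $\tau^{2^n}$ to $\mathsf 0^n(c)$, i.e. $[\tau^{2^n},\mu]=\mathsf 0^n(c)$; (b) an arrow labelled $\tau$ from $\mu^{2^n}$ to $\mathsf 0^n(c)$, i.e. $[\mu^{2^n},\tau]=\mathsf 0^n(c)$; (c) arrows labelled $\tau$ and $\mu$ from $\mathsf 1^n(c)$ to $\mathsf 0^{n+1}(c)$, i.e. $[\mathsf 1^n(c),\tau]=[\mathsf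 1^n(c),\mu]=\mathsf 0^{n+1}(c)$; (d) arrows labelled $\tau$ and $\mu$ from $\mathsf 1^n\mathsf 0W(c)$ to $\mathsf 0^n\mathsf 1W(c)$ for all $W\in\{\mathsf 0,\mathsf 1\}^*$, i.e. $[\mathsf 1^n\mathsf 0W(c),\tau]=[\mathsf 1^n\mathsf 0W(c),\mu]=\mathsf 0^n\mathsf 1W(c)$; (e) an arrow labelled $2$ from $v^{2^n}$ to $v^{2^{n+1}}$ for all basis vectors $v$, i.e. the Frobenius map of $\mathcal L(\Gamma)$ sends $v^{2^n}$ to $v^{2^{n+1}}$. For every basis vector $v$ and $s\in\{\tau,\mu\}$ such that no arrow labelled $s$ leaving $v$ is listed above, $[v,s]=0$ in $\mathcal L(\Gamma)$.
   Context: The group: let $\Sigma=\{0,1\}$ and let $\Sigma^*$ be the free monoid on $\Sigma$, regarded as the rooted binary tree. Define permutations $\tau,\mu$ of $\Sigma^*$ (tree automorphisms, acting on the right, written as exponents) recursively by: both fix the empty word; $(0\sigma_2\dots\sigma_n)^\tau=1\sigma_2\dots\sigma_n$ and $(1\sigma_2\dots\sigma_n)^\tau=0(\sigma_2\dots\sigma_n)^\tau$; $(0\sigma_2\dots\sigma_n)^\mu=1\sigma_2\dots\sigma_n$ and $(1\sigma_2\dots\sigma_n)^\mu=0(\sigma_2\dots\sigma_n)^{\mu^{-1}}$. The Brunner–Sidki–Vieira group $\Gamma$ is the group generated by $\tau$ and $\mu$; $\Gamma'$ is its derived subgroup, and $[g,h]=g^{-1}h^{-1}gh$ in the group. For tree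 automorphisms $g_0,g_1$, the pair $(g_0,g_1)$ denotes the tree automorphism fixing the first letter of every nonempty word and acting by $(0w)^{(g_0,g_1)}=0\,w^{g_0}$, $(1w)^{(g_0,g_1)}=1\,w^{g_1}$. It is known that $\Gamma'$ contains $\Gamma'\times\Gamma'=\{(g_0,g_1):g_0,g_1\in\Gamma'\}$, so that $\mathsf 0(g)=(g,1)$ and $\mathsf 1(g)=(g,g)$ are well-defined endomorphisms of $\Gamma'$. A word $W=W_1W_2\dots W_m$ in $\{\mathsf 0,\mathsf 1\}$ acts by composition, $W(c)=W_1(W_2(\cdots W_m(c)\cdots))$; the empty word gives $c$; $\mathsf 0^n,\mathsf 1^n$ denote repeated letters. The $2$-dimension series of $\Gamma$ is $\Gamma_1=\Gamma$ and, for $n\ge2$, $\Gamma_n=[\Gamma,\Gamma_{n-1}]\,\Gamma_{\lceil n/2\rceil}^2$, where $H^2$ is the subgroup generated by squares of elements of $H$. Each $\Gamma_n/\Gamma_{n+1}$ is an $\mathbb F_2$-vector space. On $\mathcal L(\Gamma)=\bigoplus_{n\ge1}\Gamma_n/\Gamma_{n+1}$ the Lie bracket is induced by commutation in $\Gamma$ and the Frobenius map (restricted $2$-structure) by squaring in $\Gamma$. The degree of $g\in\Gamma$, $g\neq1$, is the maximal $n$ with $g\in\Gamma_n$ ($\Gamma$ is residually-$2$, so it is finite); an element $g$ of degree $n$ is identified with its image in $\Gamma_n/\Gamma_{n+1}\subset\mathcal L(\Gamma)$. The Lie graph of $\mathcal L(\Gamma)$ has as vertex set a basis $V$ of $\mathcal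 L(\Gamma)$ and, for $v\in V$, an arrow labelled $\tau$ from $v$ to $[v,\tau]$, an arrow labelled $\mu$ from $v$ to $[v,\mu]$, and an arrow labelled $2$ from $v$ to its image $v^2$ under the Frobenius map, whenever these are basis elements; arrows whose target would be $0$ are omitted. *)

theory Defs
  imports
    "HOL-Algebra.Product_Groups"
    "HOL-Algebra.SndIsomorphismGrp"
    "HOL-Number_Theory.Residues"
    "Jordan_Normal_Form.Missing_VectorSpace"
begin

section \<open>The 2-dimension series and its restricted Lie algebra\<close>

definition commutator :: "('a, 'b) monoid_scheme \<Rightarrow> 'a \<Rightarrow> 'a \<Rightarrow> 'a"
  where "commutator G g h = inv\<^bsub>G\<^esub> g \<otimes>\<^bsub>G\<^esub> inv\<^bsub>G\<^esub> h \<otimes>\<^bsub>G\<^esub> g \<otimes>\<^bsub>G\<^esub> h"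

text \<open>The series is indexed from 1; \<open>dim_series G 0 = carrier G\<close> is a junk value.
  For natural numbers, \<open>(n + 1) div 2\<close> is the ceiling of \<open>n / 2\<close>.\<close>

fun dim_series :: "('a, 'b) monoid_scheme \<Rightarrow> nat \<Rightarrow> 'a set" where
  "dim_series G n =
     (if n \<le> 1 then carrier G
      else generate G {commutator G g h | g h. g \<in> carrier G \<and> h \<in> dim_series G (n - 1)}
           <#>\<^bsub>G\<^esub> generate G {h \<otimes>\<^bsub>G\<^esub> h | h. h \<in> dim_series G ((n + 1) div 2)})"

declare dim_series.simps [simp del]

definition dim_degree :: "('a, 'b) monoid_scheme \<Rightarrow> 'a \<Rightarrow> nat"
  where "dim_degree G g = (GREATEST n. 1 \<le> n \<and> g \<in> dim_series G n)"

definition dim_quotient :: "('a, 'b) monoid_scheme \<Rightarrow> nat \<Rightarrow> 'a set monoid"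
  where "dim_quotient G n = G\<lparr>carrier := dim_series G n\<rparr> Mod dim_series G (Suc n)"

text \<open>The direct sum of the \<open>dim_quotient G n\<close>, \<open>n \<ge> 1\<close>, as a vector space over
  \<open>residue_ring 2\<close>.  Its elements are finitely supported families of cosets.  The record fields
  \<open>mult\<close> and \<open>one\<close> play no role in a module; the Lie bracket is \<open>lie_bracket\<close> below.\<close>

definition lie_space :: "('a, 'b) monoid_scheme \<Rightarrow> (int, nat \<Rightarrow> 'a set) module" where
  "lie_space G =
     (let S = sum_group {1..} (dim_quotient G) in
      \<lparr>carrier = carrier S, monoid.mult = undefined, one = undefined,
       zero = \<one>\<^bsub>S\<^esub>, add = monoid.mult S, smult = (\<lambda>a x. x [^]\<^bsub>S\<^esub> a)\<rparr>)"

definition lie_incl :: "('a, 'b) monoid_scheme \<Rightarrow> nat \<Rightarrow> 'a set \<Rightarrow> (nat \<Rightarrow> 'a set)"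
  where "lie_incl G n A = (\<lambda>i\<in>{1..}. if i = n then A else \<one>\<^bsub>dim_quotient G i\<^esub>)"

text \<open>The image of a group element in the Lie algebra.  For \<open>g = \<one>\<close>, which has no degree,
  the value is \<open>\<zero>\<close> whatever \<open>dim_degree\<close> returns.\<close>

definition lie_class :: "('a, 'b) monoid_scheme \<Rightarrow> 'a \<Rightarrow> (nat \<Rightarrow> 'a set)" where
  "lie_class G g =
     lie_incl G (dim_degree G g) (dim_series G (Suc (dim_degree G g)) #>\<^bsub>G\<^esub> g)"

definition lie_supp :: "('a, 'b) monoid_scheme \<Rightarrow> (nat \<Rightarrow> 'a set) \<Rightarrow> nat set"
  where "lie_supp G x = {i \<in> {1..}. x i \<noteq> \<one>\<^bsub>dim_quotient G i\<^esub>}"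

text \<open>On homogeneous elements the bracket and the Frobenius map are induced by commutation and
  squaring of representatives.  All cosets in the unions below coincide, since
  \<open>[G\<^sub>i, G\<^sub>j] \<subseteq> G\<^bsub>i+j\<^esub>\<close> for \<open>G\<^sub>i = dim_series G i\<close>.\<close>

definition coset_bracket ::
  "('a, 'b) monoid_scheme \<Rightarrow> nat \<Rightarrow> nat \<Rightarrow> 'a set \<Rightarrow> 'a set \<Rightarrow> 'a set" where
  "coset_bracket G i j A B =
     (\<Union>g\<in>A. \<Union>h\<in>B. dim_series G (Suc (i + j)) #>\<^bsub>G\<^esub> commutator G g h)"

definition coset_square :: "('a, 'b) monoid_scheme \<Rightarrow> nat \<Rightarrow> 'a set \<Rightarrow> 'a set"
  where "coset_square G i A = (\<Union>g\<in>A. dim_series G (Suc (2 * i)) #>\<^bsub>G\<^esub> (g \<otimes>\<^bsub>G\<^esub> g))"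

text \<open>The bracket is extended bilinearly to sums of homogeneous elements, and the Frobenius map
  by \<open>(x + y)\<^sup>2 = x\<^sup>2 + y\<^sup>2 + [x, y]\<close>, the identity required of a restricted structure in
  characteristic 2.\<close>

definition lie_bracket ::
  "('a, 'b) monoid_scheme \<Rightarrow> (nat \<Rightarrow> 'a set) \<Rightarrow> (nat \<Rightarrow> 'a set) \<Rightarrow> (nat \<Rightarrow> 'a set)" where
  "lie_bracket G x y =
     (\<Oplus>\<^bsub>lie_space G\<^esub> p \<in> lie_supp G x \<times> lie_supp G y.
        lie_incl G (fst p + snd p) (coset_bracket G (fst p) (snd p) (x (fst p)) (y (snd p))))"

definition lie_frobenius ::
  "('a, 'b) monoid_scheme \<Rightarrow> (nat \<Rightarrow> 'a set) \<Rightarrow> (nat \<Rightarrow> 'a set)" where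
  "lie_frobenius G x =
     (\<Oplus>\<^bsub>lie_space G\<^esub> i \<in> lie_supp G x. lie_incl G (2 * i) (coset_square G i (x i)))
     \<oplus>\<^bsub>lie_space G\<^esub>
     (\<Oplus>\<^bsub>lie_space G\<^esub> p \<in> {p \<in> lie_supp G x \<times> lie_supp G x. fst p < snd p}.
        lie_incl G (fst p + snd p) (coset_bracket G (fst p) (snd p) (x (fst p)) (x (snd p))))"


subsection \<open>\<open>lie_space G\<close> is a vector space\<close>

lemma (in group) commutator_closed: "g \<in> carrier G \<Longrightarrow> h \<in> carrier G \<Longrightarrow> commutator G g h \<in> carrier G"
  by (simp add: commutator_def)

lemma (in group) conj_commutator:
  assumes "x \<in> carrier G" "g \<in> carrier G" "h \<in> carrier G"
  shows "x \<otimes> commutator G g h \<otimes> inv x = commutator G (x \<otimes> g \<otimes> inv x) (x \<otimes> h \<otimes> inv x)"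
  using assms by (simp add: commutator_def inv_mult_group m_assoc inv_solve_left)
     (simp flip: m_assoc)

lemma (in group) conj_square:
  assumes "x \<in> carrier G" "h \<in> carrier G"
  shows "x \<otimes> (h \<otimes> h) \<otimes> inv x = (x \<otimes> h \<otimes> inv x) \<otimes> (x \<otimes> h \<otimes> inv x)"
  using assms by (simp add: m_assoc) (simp flip: m_assoc)

lemma (in group) dim_series_1 [simp]: "dim_series G (Suc 0) = carrier G"
  by (simp add: dim_series.simps)

lemma (in group) dim_series_normal: "dim_series G n \<lhd> G"
proof (induction n rule: less_induct)
  case (less n)
  show ?case
  proof (cases "n \<le> 1")
    case True
    then show ?thesis
      using normal_inv_iff subgroup_self by (simp add: dim_series.simps)
  next
    case False
    let ?m = "(n + 1) div 2"
    have N: "dim_series G (n - 1) \<lhd> G" "dim_series G ?m \<lhd> G"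
      using False by (auto intro!: less)
    have sub: "dim_series G (n - 1) \<subseteq> carrier G" "dim_series G ?m \<subseteq> carrier G"
      using N by (simp_all add: normal_imp_subgroup subgroup.subset)
    have "generate G {commutator G g h | g h. g \<in> carrier G \<and> h \<in> dim_series G (n - 1)} \<lhd> G"
    proof (rule normal_generateI)
      fix y x assume "y \<in> {commutator G g h | g h. g \<in> carrier G \<and> h \<in> dim_series G (n - 1)}"
        and x: "x \<in> carrier G"
      then obtain g h where gh: "y = commutator G g h" "g \<in> carrier G" "h \<in> dim_series G (n - 1)"
        by blast
      show "x \<otimes> y \<otimes> inv x \<in>
          {commutator G g h | g h. g \<in> carrier G \<and> h \<in> dim_series G (n - 1)}"
        using conj_commutator[of x g h] gh x sub normal_invE(2)[OF N(1)] by blast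
    qed (use sub in \<open>auto intro!: commutator_closed\<close>)
    moreover have "generate G {h \<otimes> h | h. h \<in> dim_series G ?m} \<lhd> G"
    proof (rule normal_generateI)
      fix y x assume "y \<in> {h \<otimes> h | h. h \<in> dim_series G ?m}" and x: "x \<in> carrier G"
      then obtain h where h: "y = h \<otimes> h" "h \<in> dim_series G ?m" by blast
      show "x \<otimes> y \<otimes> inv x \<in> {h \<otimes> h | h. h \<in> dim_series G ?m}"
        using conj_square[of x h] h x sub normal_invE(2)[OF N(2)] by blast
    qed (use sub in auto)
    ultimately show ?thesis
      using False normal_subgroup_set_mult_closed by (subst dim_series.simps) simp
  qed
qed

lemma (in group) dim_series_subgroup: "subgroup (dim_series G n) G"
  by (rule normal_imp_subgroup[OF dim_series_normal])

lemma (in group) dim_series_carrier: "dim_series G n \<subseteq> carrier G"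
  by (rule subgroup.subset[OF dim_series_subgroup])

lemma (in group) dim_series_commutator:
  assumes "1 \<le> n" "g \<in> carrier G" "h \<in> dim_series G n"
  shows "commutator G g h \<in> dim_series G (Suc n)"
proof -
  have "commutator G g h \<in> generate G {commutator G g h | g h. g \<in> carrier G \<and> h \<in> dim_series G n}"
    using assms by (intro generate.incl) blast
  then have "commutator G g h \<otimes> \<one> \<in> dim_series G (Suc n)"
    using assms unfolding dim_series.simps[of G "Suc n"] set_mult_def
    by (simp, blast intro: generate.one)
  then show ?thesis
    using assms dim_series_carrier[of n] commutator_closed by (simp add: subset_iff)
qed

lemma (in group) dim_series_square2:
  assumes "2 \<le> n" "h \<in> dim_series G ((n + 1) div 2)"
  shows "h \<otimes> h \<in> dim_series G n"
proof -
  have "h \<otimes> h \<in> generate G {h \<otimes> h | h. h \<in> dim_series G ((n + 1) div 2)}"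
    using assms by (intro generate.incl) blast
  then have "\<one> \<otimes> (h \<otimes> h) \<in> dim_series G n"
    using assms unfolding dim_series.simps[of G n] set_mult_def
    by (simp, blast intro: generate.one)
  then show ?thesis
    using assms dim_series_carrier by (simp add: subset_iff)
qed

lemma (in group) dim_series_Suc_subset: "dim_series G (Suc n) \<subseteq> dim_series G n"
proof (induction n rule: less_induct)
  case (less n)
  show ?case
  proof (cases "n \<le> 1")
    case True
    then show ?thesis using dim_series_carrier by (simp add: dim_series.simps[of G n])
  next
    case False
    let ?m = "(n + 1) div 2" and ?k = "(Suc n + 1) div 2"
    have "?k = ?m \<or> ?k = Suc ?m" by linarith
    then have km: "dim_series G ?k \<subseteq> dim_series G ?m"
    proof
      assume "?k = Suc ?m"
      moreover have "?m < n" using False by simp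
      ultimately show ?thesis using less[of ?m] by simp
    qed simp
    have "commutator G g h \<in> dim_series G n"
      if g: "g \<in> carrier G" and h: "h \<in> dim_series G n" for g h
    proof -
      have hc: "h \<in> carrier G" using h dim_series_carrier by blast
      have "inv g \<otimes> inv h \<otimes> inv (inv g) \<in> dim_series G n"
        using g h dim_series_normal dim_series_subgroup
        by (intro normal_invE(2)) (auto intro: subgroup.m_inv_closed)
      then show ?thesis
        using g h hc subgroup.m_closed[OF dim_series_subgroup] by (simp add: commutator_def)
    qed
    then have 1: "generate G {commutator G g h | g h. g \<in> carrier G \<and> h \<in> dim_series G n}
        \<subseteq> dim_series G n"
      by (intro generate_subgroup_incl dim_series_subgroup) auto
    have 2: "generate G {h \<otimes> h | h. h \<in> dim_series G ?k} \<subseteq> dim_series G n"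
      using km False dim_series_square2
      by (intro generate_subgroup_incl dim_series_subgroup) auto
    show ?thesis
      using 1 2 subgroup.m_closed[OF dim_series_subgroup, of _ n]
      by (subst dim_series.simps) (use False in \<open>auto simp: set_mult_def subset_iff\<close>)
  qed
qed

lemma (in group) dim_series_antimono: "m \<le> n \<Longrightarrow> dim_series G n \<subseteq> dim_series G m"
  by (rule lift_Suc_antimono_le[of "dim_series G", OF dim_series_Suc_subset])

lemma (in group) dim_series_square:
  assumes "1 \<le> n" "h \<in> dim_series G n"
  shows "h \<otimes> h \<in> dim_series G (Suc n)"
proof -
  have "h \<otimes> h \<in> dim_series G (2 * n)"
    using assms by (intro dim_series_square2) auto
  then show ?thesis using dim_series_antimono[of "Suc n" "2 * n"] assms by auto
qed

lemma (in group)
  assumes n: "1 \<le> n"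
  shows dim_quotient_comm_group: "comm_group (dim_quotient G n)"
    and dim_quotient_double: "x \<in> carrier (dim_quotient G n) \<Longrightarrow>
          x \<otimes>\<^bsub>dim_quotient G n\<^esub> x = \<one>\<^bsub>dim_quotient G n\<^esub>"
proof -
  let ?D = "dim_series G n" and ?E = "dim_series G (Suc n)"
  interpret D: group "G\<lparr>carrier := ?D\<rparr>"
    by (rule subgroup_imp_group[OF dim_series_subgroup])
  interpret E: normal ?E "G\<lparr>carrier := ?D\<rparr>"
    by (rule normal_restrict_supergroup[OF dim_series_subgroup dim_series_normal
          dim_series_Suc_subset])
  have mult: "(?E #>\<^bsub>G\<lparr>carrier := ?D\<rparr>\<^esub> g) \<otimes>\<^bsub>dim_quotient G n\<^esub> (?E #>\<^bsub>G\<lparr>carrier := ?D\<rparr>\<^esub> h)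
      = ?E #>\<^bsub>G\<lparr>carrier := ?D\<rparr>\<^esub> (g \<otimes> h)" if "g \<in> ?D" "h \<in> ?D" for g h
    using E.rcos_sum[of g h] that by (simp add: dim_quotient_def)
  have sq: "x \<otimes>\<^bsub>dim_quotient G n\<^esub> x = \<one>\<^bsub>dim_quotient G n\<^esub>"
    if x: "x \<in> carrier (dim_quotient G n)" for x
  proof -
    obtain g where g: "g \<in> ?D" "x = ?E #>\<^bsub>G\<lparr>carrier := ?D\<rparr>\<^esub> g"
      using x by (auto simp: dim_quotient_def carrier_FactGroup)
    then show ?thesis
      using mult[of g g] E.rcos_const[OF D.is_group dim_series_square[OF n g(1)]]
      by (simp add: dim_quotient_def)
  qed
  then show "x \<in> carrier (dim_quotient G n) \<Longrightarrow>
          x \<otimes>\<^bsub>dim_quotient G n\<^esub> x = \<one>\<^bsub>dim_quotient G n\<^esub>" .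
  have "group (dim_quotient G n)"
    unfolding dim_quotient_def by (rule E.factorgroup_is_group)
  then interpret Q: group "dim_quotient G n" .
  show "comm_group (dim_quotient G n)"
  proof (rule Q.group_comm_groupI)
    have i: "inv\<^bsub>dim_quotient G n\<^esub> x = x" if "x \<in> carrier (dim_quotient G n)" for x
      using sq that by (simp add: Q.inv_equality)
    fix x y assume "x \<in> carrier (dim_quotient G n)" "y \<in> carrier (dim_quotient G n)"
    then show "x \<otimes>\<^bsub>dim_quotient G n\<^esub> y = y \<otimes>\<^bsub>dim_quotient G n\<^esub> x"
      using Q.inv_mult_group[of x y] by (simp add: i)
  qed
qed

lemma (in group) vectorspace_lie_space: "vectorspace (residue_ring 2) (lie_space G)"
proof -
  define S where "S = sum_group {1..} (dim_quotient G)"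
  interpret F: residues_prime 2 "residue_ring (int 2)"
    by unfold_locales auto
  have Q: "comm_group (dim_quotient G i)" if "i \<in> {1..}" for i
    using that by (intro dim_quotient_comm_group) auto
  then have Qg: "group (dim_quotient G i)" if "i \<in> {1..}" for i
    using that comm_group.axioms(2) by blast
  have cs: "carrier S = {x \<in> \<Pi>\<^sub>E i\<in>{1..}. carrier (dim_quotient G i).
      finite {i \<in> {1..}. x i \<noteq> \<one>\<^bsub>dim_quotient G i\<^esub>}}"
    unfolding S_def by (rule carrier_sum_group[OF Qg])
  interpret S: comm_group S
  proof (rule group.group_comm_groupI)
    show "group S" unfolding S_def using Qg by (rule sum_group)
    fix x y assume "x \<in> carrier S" "y \<in> carrier S"
    then have "x i \<in> carrier (dim_quotient G i)" "y i \<in> carrier (dim_quotient G i)"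
      if "i \<in> {1..}" for i
      using that unfolding cs by (simp_all add: PiE_iff)
    then show "x \<otimes>\<^bsub>S\<^esub> y = y \<otimes>\<^bsub>S\<^esub> x"
      unfolding S_def mult_sum_group
      using comm_monoid.m_comm[OF comm_group.axioms(1)[OF Q]] by (intro restrict_ext) blast
  qed
  have double: "x \<otimes>\<^bsub>S\<^esub> x = \<one>\<^bsub>S\<^esub>" if x: "x \<in> carrier S" for x
  proof -
    have "x i \<in> carrier (dim_quotient G i)" if "i \<in> {1..}" for i
      using that x unfolding cs by (simp add: PiE_iff)
    then show ?thesis
      unfolding S_def mult_sum_group one_sum_group
      by (intro restrict_ext dim_quotient_double) auto
  qed
  have L: "lie_space G = \<lparr>carrier = carrier S, monoid.mult = undefined, one = undefined,
       zero = \<one>\<^bsub>S\<^esub>, add = monoid.mult S, smult = (\<lambda>a x. x [^]\<^bsub>S\<^esub> a)\<rparr>"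
    by (simp add: lie_space_def S_def Let_def)
  have ac: "a = 0 \<or> a = 1" if "a \<in> carrier (residue_ring 2)" for a
    using that by (auto simp: residue_ring_def)
  have p1: "x [^]\<^bsub>S\<^esub> (1::int) = x" if "x \<in> carrier S" for x
    using S.int_pow_1[OF that] .
  have "abelian_group (lie_space G)"
  proof (rule abelian_groupI)
    fix x assume "x \<in> carrier (lie_space G)"
    then show "\<exists>y\<in>carrier (lie_space G). y \<oplus>\<^bsub>lie_space G\<^esub> x = \<zero>\<^bsub>lie_space G\<^esub>"
      using double[of x] by (auto simp: L)
  next
    fix x y assume "x \<in> carrier (lie_space G)" "y \<in> carrier (lie_space G)"
    then show "x \<oplus>\<^bsub>lie_space G\<^esub> y = y \<oplus>\<^bsub>lie_space G\<^esub> x"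
      by (simp add: L S.m_comm)
  qed (simp_all add: L S.m_assoc)
  then have "module (residue_ring 2) (lie_space G)"
    using F.cring
  proof (intro moduleI)
    fix a b x
    assume "a \<in> carrier (residue_ring 2)" "b \<in> carrier (residue_ring 2)"
      "x \<in> carrier (lie_space G)"
    then show
      "(a \<oplus>\<^bsub>residue_ring 2\<^esub> b) \<odot>\<^bsub>lie_space G\<^esub> x
        = a \<odot>\<^bsub>lie_space G\<^esub> x \<oplus>\<^bsub>lie_space G\<^esub> b \<odot>\<^bsub>lie_space G\<^esub> x"
      "(a \<otimes>\<^bsub>residue_ring 2\<^esub> b) \<odot>\<^bsub>lie_space G\<^esub> x
        = a \<odot>\<^bsub>lie_space G\<^esub> (b \<odot>\<^bsub>lie_space G\<^esub> x)"
      using ac[of a] ac[of b] double[of x] p1[of x]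
      by (auto simp: L residue_ring_def)
  next
    fix a x y
    assume "a \<in> carrier (residue_ring 2)" "x \<in> carrier (lie_space G)"
      "y \<in> carrier (lie_space G)"
    then show "a \<odot>\<^bsub>lie_space G\<^esub> (x \<oplus>\<^bsub>lie_space G\<^esub> y)
        = a \<odot>\<^bsub>lie_space G\<^esub> x \<oplus>\<^bsub>lie_space G\<^esub> a \<odot>\<^bsub>lie_space G\<^esub> y"
      by (simp add: L S.int_pow_distrib)
  next
    fix x assume "x \<in> carrier (lie_space G)"
    then show "\<one>\<^bsub>residue_ring 2\<^esub> \<odot>\<^bsub>lie_space G\<^esub> x = x"
      using p1[of x] by (simp add: L residue_ring_def)
  qed (auto simp: L)
  then show ?thesis
    using F.is_field by (simp add: vectorspace_def)
qed


section \<open>The Brunner-Sidki-Vieira group\<close>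

text \<open>The letters 0 and 1 are \<open>False\<close> and \<open>True\<close>.  Permutations act on the right, so the
  product of \<open>g\<close> and \<open>h\<close> applies \<open>g\<close> first.\<close>

definition word_perms :: "(bool list \<Rightarrow> bool list) monoid"
  where "word_perms = \<lparr>carrier = {g. bij g}, monoid.mult = (\<lambda>g h. h \<circ> g), one = id\<rparr>"

fun tau :: "bool list \<Rightarrow> bool list" where
  "tau [] = []"
| "tau (False # w) = True # w"
| "tau (True # w) = False # tau w"

text \<open>\<open>mu\<close> and its inverse (see \<open>mu_inv_eq\<close> below) are defined by mutual recursion.\<close>

fun mu :: "bool list \<Rightarrow> bool list" and mu_inv :: "bool list \<Rightarrow> bool list" where
  "mu [] = []"
| "mu (False # w) = True # w"
| "mu (True # w) = False # mu_inv w"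
| "mu_inv [] = []"
| "mu_inv (True # w) = False # w"
| "mu_inv (False # w) = True # mu w"

definition BSV :: "(bool list \<Rightarrow> bool list) monoid"
  where "BSV = subgroup_generated word_perms {tau, mu}"

abbreviation bsv_c :: "bool list \<Rightarrow> bool list"
  where "bsv_c \<equiv> commutator BSV tau mu"

fun tree_pair ::
  "(bool list \<Rightarrow> bool list) \<Rightarrow> (bool list \<Rightarrow> bool list) \<Rightarrow> bool list \<Rightarrow> bool list" where
  "tree_pair g0 g1 [] = []"
| "tree_pair g0 g1 (False # w) = False # g0 w"
| "tree_pair g0 g1 (True # w) = True # g1 w"

text \<open>The endomorphisms \<open>0(g) = (g, 1)\<close> and \<open>1(g) = (g, g)\<close> of the derived subgroup, given by
  formulas that make sense for every \<open>g\<close>.\<close>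

definition letter_map :: "bool \<Rightarrow> (bool list \<Rightarrow> bool list) \<Rightarrow> (bool list \<Rightarrow> bool list)"
  where "letter_map b g = (if b then tree_pair g g else tree_pair g id)"

definition word_map :: "bool list \<Rightarrow> (bool list \<Rightarrow> bool list) \<Rightarrow> (bool list \<Rightarrow> bool list)"
  where "word_map W g = foldr letter_map W g"

text \<open>\<open>TauPow n\<close>, \<open>MuPow n\<close>, \<open>WordPow W n\<close> index the elements \<open>\<tau>^(2^n)\<close>, \<open>\<mu>^(2^n)\<close>,
  \<open>W(c)^(2^n)\<close>.\<close>

datatype bsv_index = TauPow nat | MuPow nat | WordPow "bool list" nat

fun bsv_elt :: "bsv_index \<Rightarrow> bool list \<Rightarrow> bool list" where
  "bsv_elt (TauPow n) = tau [^]\<^bsub>BSV\<^esub> ((2::nat) ^ n)"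
| "bsv_elt (MuPow n) = mu [^]\<^bsub>BSV\<^esub> ((2::nat) ^ n)"
| "bsv_elt (WordPow W n) = word_map W bsv_c [^]\<^bsub>BSV\<^esub> ((2::nat) ^ n)"

definition bsv_vec :: "bsv_index \<Rightarrow> (nat \<Rightarrow> (bool list \<Rightarrow> bool list) set)"
  where "bsv_vec b = lie_class BSV (bsv_elt b)"

datatype arrow_label = LTau | LMu | LTwo

fun arrow_target ::
  "arrow_label \<Rightarrow> (nat \<Rightarrow> (bool list \<Rightarrow> bool list) set) \<Rightarrow> (nat \<Rightarrow> (bool list \<Rightarrow> bool list) set)"
where
  "arrow_target LTau v = lie_bracket BSV v (lie_class BSV tau)"
| "arrow_target LMu v = lie_bracket BSV v (lie_class BSV mu)"
| "arrow_target LTwo v = lie_frobenius BSV v"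

definition lie_graph ::
  "(nat \<Rightarrow> (bool list \<Rightarrow> bool list) set) set \<Rightarrow>
   ((nat \<Rightarrow> (bool list \<Rightarrow> bool list) set) \<times> arrow_label \<times>
    (nat \<Rightarrow> (bool list \<Rightarrow> bool list) set)) set" where
  "lie_graph V = {(v, s, arrow_target s v) | v s. v \<in> V \<and> arrow_target s v \<in> V}"

subsection \<open>\<open>BSV\<close> is a group\<close>

lemma mu_mu_inv: "mu (mu_inv w) = w" "mu_inv (mu w) = w"
proof -
  have "mu (mu_inv w) = w \<and> mu_inv (mu w) = w"
  proof (induction w)
    case (Cons b w)
    then show ?case by (cases b) auto
  qed simp
  then show "mu (mu_inv w) = w" "mu_inv (mu w) = w" by auto
qed

lemma bij_mu: "bij mu"
  by (rule o_bij[of mu_inv]) (auto simp: mu_mu_inv fun_eq_iff)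

lemma mu_inv_eq: "mu_inv = inv_into UNIV mu"
  by (rule Hilbert_Choice.inv_equality[symmetric]) (auto simp: mu_mu_inv)

lemma bij_tau: "bij tau"
proof (rule bijI)
  have "tau v = tau w \<Longrightarrow> v = w" for v w
  proof (induction v arbitrary: w)
    case Nil then show ?case by (cases w rule: tau.cases) auto
  next
    case (Cons b v) then show ?case by (cases b; cases w rule: tau.cases) auto
  qed
  then show "inj tau" by (rule injI)
  have "\<exists>v. tau v = w" for w
  proof (induction w)
    case Nil show ?case by (rule exI[of _ "[]"]) simp
  next
    case (Cons b w)
    then obtain v where v: "tau v = w" by blast
    show ?case
    proof (cases b)
      case True then show ?thesis by (intro exI[of _ "False # w"]) simp
    next
      case False then show ?thesis using v by (intro exI[of _ "True # v"]) simp
    qed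
  qed
  then show "surj tau" unfolding surj_def by metis
qed

lemma group_word_perms: "group word_perms"
proof (rule groupI)
  fix g assume "g \<in> carrier word_perms"
  then have "bij (inv_into UNIV g) \<and> g \<circ> inv_into UNIV g = id"
    by (auto simp: word_perms_def bij_imp_bij_inv fun_eq_iff bij_is_surj surj_f_inv_f)
  then show "\<exists>h\<in>carrier word_perms. h \<otimes>\<^bsub>word_perms\<^esub> g = \<one>\<^bsub>word_perms\<^esub>"
    by (auto simp: word_perms_def)
qed (auto simp: word_perms_def bij_comp o_assoc)

lemma group_BSV: "group BSV"
  unfolding BSV_def by (rule group.group_subgroup_generated[OF group_word_perms])

end

theory Submission
  imports Defs
begin

text \<open>
  With \<open>\<zeta> = \<mu>\<tau>\<close> one has \<open>c = (\<zeta>\<^sup>-\<^sup>1, \<zeta>)\<close>, and \<open>\<Gamma>/\<Gamma>'\<close> is free abelian on \<open>\<tau>, \<mu>\<close>; hence every element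
  of \<open>\<Gamma>'\<close> is uniquely \<open>c^k 0(g) 1(h)\<close> with \<open>g, h \<in> \<Gamma>'\<close>.  Iterating this, an element of \<open>\<Gamma>'\<close> is
  described, modulo the product of \<open>2^m\<close> copies of \<open>\<Gamma>'\<close>, by the exponents of the \<open>W(c)\<close> with
  \<open>|W| < m\<close>.  The intersection \<open>\<Gamma>\<^sub>n \<inter> \<Gamma>'\<close> consists of the elements for which the exponent of
  \<open>W(c)\<close> is divisible by some \<open>2^v\<close> with \<open>2^v deg W(c) \<ge> n\<close>.  That these conditions define an
  N-series closed under squaring is proved by induction on \<open>m\<close> through the sections.  Since
  \<open>deg 0W(c) = 2 deg W(c) - 1\<close> and \<open>deg 1W(c) = 2 deg W(c)\<close>, the induction needs the two-parameter
  family of conditions \<open>2^v (deg W(c) - s) \<ge> r\<close>, on which passing to a section acts by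
  \<open>s \<mapsto> (1 + s)/2\<close> or \<open>s \<mapsto> s/2\<close> and \<open>r \<mapsto> r/2\<close>.  Conversely \<open>W(c)\<close> lies in \<open>\<Gamma>\<^sub>n\<close> for \<open>n = deg W(c)\<close>,
  because \<open>[1^n 0W(c), \<tau>] = (0^(n+1) W(c))\<^sup>-\<^sup>2 0^n 1W(c)\<close> and because \<open>[\<tau>^(2^n), \<mu>]\<close> is conjugate to
  \<open>0^n(c)\<close> or its inverse.
\<close>

section \<open>Words in groups\<close>

text \<open>The sections of c lie outside the derived subgroup, so estimates inside \<Gamma>' cannot
  be pushed through sections alone: commutators with powers of \<zeta> have to be estimated along
  with them. This is why several statements are proved together at each depth, among them a sharper
  one for \<zeta>, which fixes both first-level subtrees while \<tau> and \<mu> exchange them.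
  Working at finite depth avoids infinite products, and nothing is lost: every W(g) with |W| = m and
  g in \<Gamma>' lies in \<Gamma>_n as soon as n <= 2^m + 1. For such n the candidate
  \<open>Ser m n\<close> equals the n-th term exactly (\<open>Dim_eq_Ser\<close>). From this
  equality come the inclusion of [\<Gamma>_i, \<Gamma>_j] in \<Gamma>_(i+j), spanning (an exponent
  description exists) and independence (it is unique). For the squares of 1^n(c) the vanishing of
  the brackets needs one degree more than this inclusion provides; there [0^(n+1)(c), 1^n(c)] is
  computed separately.\<close>

definition comm :: "'a::group_add \<Rightarrow> 'a \<Rightarrow> 'a"
  where "comm x y = - x - y + x + y"

definition cjg :: "'a::group_add \<Rightarrow> 'a \<Rightarrow> 'a"
  where "cjg g x = - g + x + g"

text \<open>The Knuth-Bendix completion of the group axioms: as rewrite rules they normalise words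
  of the free group, so an identity valid in all groups is proved by
  \<open>simp only\<close>.\<close>

lemmas group_word = add.assoc minus_add diff_conv_add_uminus minus_minus minus_zero
  add_0_left add_0_right left_minus right_minus minus_add_cancel add_minus_cancel

lemmas comm_word = comm_def cjg_def group_word

fun npow :: "'a::group_add \<Rightarrow> nat \<Rightarrow> 'a" where
  "npow x 0 = 0"
| "npow x (Suc n) = npow x n + x"

definition zpow :: "'a::group_add \<Rightarrow> int \<Rightarrow> 'a"
  where "zpow x k = (if 0 \<le> k then npow x (nat k) else - npow x (nat (- k)))"

lemma npow_commute: "npow x n + x = x + npow x n"
  by (induction n) (simp_all add: add.assoc)

lemma zpow_0 [simp]: "zpow x 0 = 0"
  by (simp add: zpow_def)

lemma zpow_1 [simp]: "zpow x 1 = x"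
  by (simp add: zpow_def)

lemma zpow_Suc: "zpow x (k + 1) = zpow x k + x"
proof (cases "0 \<le> k")
  case True
  then have "nat (k + 1) = Suc (nat k)" by simp
  then show ?thesis using True by (simp add: zpow_def)
next
  case False
  then have *: "nat (- k) = Suc (nat (- (k + 1)))" by simp
  have "- npow x (nat (- (k + 1))) = - (x + npow x (nat (- (k + 1)))) + x"
    by (simp only: group_word)
  moreover have "- npow x (nat (- (k + 1))) = zpow x (k + 1)"
    using False by (auto simp: zpow_def)
  ultimately show ?thesis
    using False unfolding zpow_def * by (simp add: npow_commute)
qed

lemma zpow_add: "zpow x (j + k) = zpow x j + zpow x k"
proof (induction k rule: int_induct[where k = 0])
  case (step1 k)
  then show ?case
    using zpow_Suc[of x "j + k"] zpow_Suc[of x k] by (simp add: add.assoc)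
next
  case (step2 k)
  have "zpow x (j + (k - 1)) + x = zpow x j + zpow x (k - 1) + x"
    using step2 zpow_Suc[of x "j + (k - 1)"] zpow_Suc[of x "k - 1"] by (simp add: add.assoc)
  then show ?case by simp
qed simp

lemma zpow_minus: "zpow x (- k) = - zpow x k"
proof -
  have "zpow x (- k) + zpow x k = 0"
    using zpow_add[of x "- k" k] by simp
  then show ?thesis by (simp add: eq_neg_iff_add_eq_0)
qed

lemma zpow_commute: "zpow x j + zpow x k = zpow x k + zpow x j"
  by (metis add.commute zpow_add)

lemma zpow_zpow: "zpow (zpow x j) k = zpow x (j * k)"
proof (induction k rule: int_induct[where k = 0])
  case (step1 k)
  then show ?case by (simp add: zpow_Suc distrib_left zpow_add)
next
  case (step2 k)
  have "zpow (zpow x j) (k - 1) + zpow x j = zpow x (j * (k - 1)) + zpow x j"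
    using step2 zpow_Suc[of "zpow x j" "k - 1"] by (simp add: algebra_simps flip: zpow_add)
  then show ?case by simp
qed simp

lemma zpow_hom:
  assumes "\<And>x y. f (x + y) = f x + f y"
  shows "f (zpow x k) = zpow (f x) k"
proof -
  have "f 0 + f 0 = f 0 + 0" using assms[of 0 0] by simp
  then have f0: "f 0 = 0" by (rule add_left_imp_eq)
  have fm: "f (- y) = - f y" for y
    using assms[of "- y" y] f0 by (simp add: eq_neg_iff_add_eq_0)
  have "f (npow x n) = npow (f x) n" for n
    by (induction n) (simp_all add: f0 assms)
  then show ?thesis by (simp add: zpow_def fm)
qed

section \<open>Tree automorphisms\<close>

text \<open>The group of permutations of the words over the alphabet, in additive notation, so that the
  simplifier decides the word problem in free groups by means of \<open>group_word\<close>.\<close>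

typedef wperm = "{g :: bool list \<Rightarrow> bool list. bij g}" morphisms act Abs_wperm
  by (rule exI[of _ id]) simp

setup_lifting type_definition_wperm

instantiation wperm :: group_add
begin

lift_definition zero_wperm :: wperm is id by simp
lift_definition plus_wperm :: "wperm \<Rightarrow> wperm \<Rightarrow> wperm" is "\<lambda>g h. h \<circ> g" by (rule bij_comp)
lift_definition uminus_wperm :: "wperm \<Rightarrow> wperm" is "inv_into UNIV" by (rule bij_imp_bij_inv)
definition minus_wperm :: "wperm \<Rightarrow> wperm \<Rightarrow> wperm" where "minus_wperm g h = g + - h"

instance
proof
  fix a b c :: wperm
  show "a + b + c = a + (b + c)" by transfer (simp add: o_assoc)
  show "0 + a = a" "a + 0 = a" by (transfer; simp)+
  show "- a + a = 0" by transfer (simp add: bij_is_surj flip: surj_iff)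
  show "a + - b = a - b" by (simp add: minus_wperm_def)
qed

end

lemma wperm_eqI: "(\<And>w. act g w = act h w) \<Longrightarrow> g = h"
  by transfer auto

lemma act_plus [simp]: "act (g + h) w = act h (act g w)"
  by transfer simp

lemma act_zero [simp]: "act 0 w = w"
  by transfer simp

lemma act_inverse [simp]: "act (- g) (act g w) = w" "act g (act (- g) w) = w"
  by (simp_all flip: act_plus)

lemma act_minus [simp]: "act (g - h) w = act (- h) (act g w)"
  by (simp flip: act_plus)

lemma bij_tree_pair: "bij g \<Longrightarrow> bij h \<Longrightarrow> bij (tree_pair g h)"
proof (rule o_bij[of "tree_pair (inv_into UNIV g) (inv_into UNIV h)"])
  assume *: "bij g" "bij h"
  have "tree_pair (inv_into UNIV g) (inv_into UNIV h) (tree_pair g h w) = w" for w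
    using * by (cases w rule: tree_pair.cases[of "(g, h, w)" for w]) (auto simp: bij_is_inj)
  then show "tree_pair (inv_into UNIV g) (inv_into UNIV h) \<circ> tree_pair g h = id" by auto
  have "tree_pair g h (tree_pair (inv_into UNIV g) (inv_into UNIV h) w) = w" for w
    using * by (cases w rule: tree_pair.cases[of "(g, h, w)" for w])
      (auto simp: bij_is_surj surj_f_inv_f)
  then show "tree_pair g h \<circ> tree_pair (inv_into UNIV g) (inv_into UNIV h) = id" by auto
qed

lift_definition pair :: "wperm \<Rightarrow> wperm \<Rightarrow> wperm" is tree_pair by (rule bij_tree_pair)
lift_definition \<tau> :: wperm is tau by (rule bij_tau)
lift_definition \<mu> :: wperm is mu by (rule bij_mu)

lemma act_pair [simp]: "act (pair g h) [] = []" "act (pair g h) (False # w) = False # act g w"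
  "act (pair g h) (True # w) = True # act h w"
  by (transfer; simp)+

lemma act_T [simp]: "act \<tau> [] = []" "act \<tau> (False # w) = True # w"
  "act \<tau> (True # w) = False # act \<tau> w"
  by (transfer; simp)+

lemma act_U [simp]: "act \<mu> [] = []" "act \<mu> (False # w) = True # w"
  "act \<mu> (True # w) = False # act (- \<mu>) w"
proof -
  have "act (- \<mu>) = mu_inv" by transfer (simp add: mu_inv_eq)
  then show "act \<mu> (True # w) = False # act (- \<mu>) w" by (simp add: \<mu>.rep_eq)
qed (transfer; simp)+

lemma wperm_word_eqI:
  assumes "act g [] = act h []" "\<And>w. act g (False # w) = act h (False # w)"
    "\<And>w. act g (True # w) = act h (True # w)"
  shows "g = h"
proof (rule wperm_eqI)
  fix w show "act g w = act h w"
    using assms by (cases w; cases "hd w") auto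
qed

lemma pair_add: "pair a b + pair a' b' = pair (a + a') (b + b')"
  by (rule wperm_word_eqI) auto

lemma pair_0 [simp]: "pair 0 0 = 0"
  by (rule wperm_word_eqI) auto

lemma pair_minus: "- pair a b = pair (- a) (- b)"
  by (rule minus_unique) (simp add: pair_add)

lemma pair_inject [simp]: "pair a b = pair a' b' \<longleftrightarrow> a = a' \<and> b = b'"
proof
  assume *: "pair a b = pair a' b'"
  have "act a w = act a' w \<and> act b w = act b' w" for w
    using arg_cong[OF *, of "\<lambda>g. act g (False # w)"] arg_cong[OF *, of "\<lambda>g. act g (True # w)"]
    by simp
  then show "a = a' \<and> b = b'" by (auto intro: wperm_eqI)
qed simp

lemma T_T: "\<tau> + \<tau> = pair \<tau> \<tau>"
  by (rule wperm_word_eqI) auto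

lemma U_U: "\<mu> + \<mu> = pair (- \<mu>) (- \<mu>)"
  by (rule wperm_word_eqI) auto

definition \<zeta> :: wperm where "\<zeta> = \<mu> + \<tau>"

lemma Z_eq: "\<zeta> = pair \<tau> (- \<mu>)"
  unfolding \<zeta>_def by (rule wperm_word_eqI) auto

text \<open>\<open>\<tau>\<close> exchanges the two subtrees and acts further only on the words that
  move from 1 to 0; hence only one section is twisted. \<open>U_shift\<close> has the same shape
  with \<open>- \<mu>\<close> as the twist.\<close>

lemma T_shift: "pair a b + \<tau> = \<tau> + pair (cjg \<tau> b) a"
  by (rule wperm_word_eqI) (auto simp: cjg_def)

lemma U_shift: "pair a b + \<mu> = \<mu> + pair (cjg (- \<mu>) b) a"
  by (rule wperm_word_eqI) (auto simp: cjg_def)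

lemma cjg_T: "cjg \<tau> (pair a b) = pair (cjg \<tau> b) a"
  using T_shift[of a b] by (simp add: cjg_def[of _ "pair a b"] add.assoc) 

lemma cjg_U: "cjg \<mu> (pair a b) = pair (cjg (- \<mu>) b) a"
  using U_shift[of a b] by (simp add: cjg_def[of _ "pair a b"] add.assoc)

definition \<gamma> :: wperm where "\<gamma> = comm \<tau> \<mu>"

lemma T_U: "\<tau> + \<mu> = pair (- \<mu>) \<tau>"
  by (rule wperm_word_eqI) auto

lemma C_eq: "\<gamma> = pair (- \<zeta>) \<zeta>"
proof -
  have "\<gamma> = - \<zeta> + (\<tau> + \<mu>)" by (simp only: \<gamma>_def \<zeta>_def comm_word)
  also have "\<dots> = - pair \<tau> (- \<mu>) + pair (- \<mu>) \<tau>"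
    by (simp only: T_U Z_eq)
  also have "\<dots> = pair (- \<zeta>) \<zeta>"
    by (simp only: pair_minus pair_add \<zeta>_def group_word)
  finally show ?thesis .
qed

section \<open>The group and its derived subgroup\<close>

inductive_set gen_by :: "'a::group_add set \<Rightarrow> 'a set" for S where
  zero: "0 \<in> gen_by S"
| incl: "x \<in> S \<Longrightarrow> x \<in> gen_by S"
| add: "x \<in> gen_by S \<Longrightarrow> y \<in> gen_by S \<Longrightarrow> x + y \<in> gen_by S"
| minus: "x \<in> gen_by S \<Longrightarrow> - x \<in> gen_by S"

definition sgrp :: "'a::group_add set \<Rightarrow> bool"
  where "sgrp N \<longleftrightarrow> 0 \<in> N \<and> (\<forall>x\<in>N. \<forall>y\<in>N. x + y \<in> N) \<and> (\<forall>x\<in>N. - x \<in> N)"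

definition \<Gamma> :: "wperm set" where "\<Gamma> = gen_by {\<tau>, \<mu>}"

text \<open>Encoded as the normal closure of c. Since \<tau> and \<mu> commute modulo it, it
  contains all commutators (\<open>comm_Der\<close>), so it is the derived subgroup.\<close>

definition \<Gamma>' :: "wperm set" where "\<Gamma>' = gen_by {cjg g \<gamma> | g. g \<in> \<Gamma>}"

definition nsg :: "wperm set \<Rightarrow> bool"
  where "nsg N \<longleftrightarrow> sgrp N \<and> N \<subseteq> \<Gamma> \<and> (\<forall>x\<in>N. \<forall>g\<in>\<Gamma>. cjg g x \<in> N)"

definition eqm :: "'a::group_add set \<Rightarrow> 'a \<Rightarrow> 'a \<Rightarrow> bool"
  where "eqm N x y \<longleftrightarrow> x - y \<in> N"

lemma sgrp_gen: "sgrp (gen_by S)"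
  by (auto simp: sgrp_def intro: gen_by.intros)

lemma gen_subset:
  assumes "sgrp N" "S \<subseteq> N" shows "gen_by S \<subseteq> N"
proof
  fix x assume "x \<in> gen_by S"
  then show "x \<in> N" by induction (use assms in \<open>auto simp: sgrp_def\<close>)
qed

lemma sgrp_zero: "sgrp N \<Longrightarrow> 0 \<in> N"
  and sgrp_add: "sgrp N \<Longrightarrow> x \<in> N \<Longrightarrow> y \<in> N \<Longrightarrow> x + y \<in> N"
  and sgrp_minus: "sgrp N \<Longrightarrow> x \<in> N \<Longrightarrow> - x \<in> N"
  by (simp_all add: sgrp_def)

lemma sgrp_diff: "sgrp N \<Longrightarrow> x \<in> N \<Longrightarrow> y \<in> N \<Longrightarrow> x - y \<in> N"
  using sgrp_add[of N x "- y"] sgrp_minus[of N y] by simp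

lemma sgrp_npow: "sgrp N \<Longrightarrow> x \<in> N \<Longrightarrow> npow x n \<in> N"
  by (induction n) (auto simp: sgrp_def)

lemma sgrp_zpow: "sgrp N \<Longrightarrow> x \<in> N \<Longrightarrow> zpow x k \<in> N"
  by (simp add: zpow_def sgrp_npow sgrp_minus)

lemma sgrp_cjg: "sgrp N \<Longrightarrow> x \<in> N \<Longrightarrow> g \<in> N \<Longrightarrow> cjg g x \<in> N"
  by (simp add: cjg_def sgrp_add sgrp_minus)

lemma sgrp_comm: "sgrp N \<Longrightarrow> x \<in> N \<Longrightarrow> g \<in> N \<Longrightarrow> comm x g \<in> N"
  unfolding comm_def by (intro sgrp_add sgrp_diff sgrp_minus)

lemmas sgrp_rules = sgrp_zero sgrp_add sgrp_minus sgrp_diff sgrp_zpow sgrp_cjg sgrp_comm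

lemma sgrp_Gam: "sgrp \<Gamma>" by (simp add: \<Gamma>_def sgrp_gen)
lemma sgrp_Der: "sgrp \<Gamma>'" by (simp add: \<Gamma>'_def sgrp_gen)

lemma TU_Gam [simp]: "\<tau> \<in> \<Gamma>" "\<mu> \<in> \<Gamma>"
  by (auto simp: \<Gamma>_def intro: gen_by.incl)

lemma Gam_rules [simp]:
  "0 \<in> \<Gamma>" "x \<in> \<Gamma> \<Longrightarrow> y \<in> \<Gamma> \<Longrightarrow> x + y \<in> \<Gamma>" "x \<in> \<Gamma> \<Longrightarrow> - x \<in> \<Gamma>"
  "x \<in> \<Gamma> \<Longrightarrow> y \<in> \<Gamma> \<Longrightarrow> x - y \<in> \<Gamma>" "x \<in> \<Gamma> \<Longrightarrow> zpow x k \<in> \<Gamma>"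
  "x \<in> \<Gamma> \<Longrightarrow> y \<in> \<Gamma> \<Longrightarrow> cjg x y \<in> \<Gamma>" "x \<in> \<Gamma> \<Longrightarrow> y \<in> \<Gamma> \<Longrightarrow> comm x y \<in> \<Gamma>"
  by (simp_all add: sgrp_rules sgrp_Gam)

lemma Z_Gam [simp]: "\<zeta> \<in> \<Gamma>" by (simp add: \<zeta>_def)
lemma C_Gam [simp]: "\<gamma> \<in> \<Gamma>" by (simp add: \<gamma>_def)

lemma Gam_induct [consumes 1, case_names zero \<tau> \<mu> add minus]:
  assumes "g \<in> \<Gamma>" "R 0" "R \<tau>" "R \<mu>"
    "\<And>g h. g \<in> \<Gamma> \<Longrightarrow> h \<in> \<Gamma> \<Longrightarrow> R g \<Longrightarrow> R h \<Longrightarrow> R (g + h)"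
    "\<And>g. g \<in> \<Gamma> \<Longrightarrow> R g \<Longrightarrow> R (- g)"
  shows "R g"
  using assms(1) unfolding \<Gamma>_def
  by (induction rule: gen_by.induct) (use assms(2-) in \<open>auto simp flip: \<Gamma>_def\<close>)

lemma nsg_sgrp: "nsg N \<Longrightarrow> sgrp N"
  and nsg_Gam: "nsg N \<Longrightarrow> x \<in> N \<Longrightarrow> x \<in> \<Gamma>"
  and nsg_cjg: "nsg N \<Longrightarrow> x \<in> N \<Longrightarrow> g \<in> \<Gamma> \<Longrightarrow> cjg g x \<in> N"
  by (auto simp: nsg_def)

lemmas nsg_zero = sgrp_zero[OF nsg_sgrp]
lemmas nsg_add = sgrp_add[OF nsg_sgrp]
lemmas nsg_minus = sgrp_minus[OF nsg_sgrp]
lemmas nsg_diff = sgrp_diff[OF nsg_sgrp]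
lemmas nsg_zpow = sgrp_zpow[OF nsg_sgrp]

section \<open>Commutators and congruences modulo normal subgroups\<close>

lemma cjg_0 [simp]: "cjg 0 x = x" "cjg g 0 = 0"
  by (simp_all add: cjg_def)

lemma cjg_add: "cjg g (x + y) = cjg g x + cjg g y"
  by (simp only: comm_word)

lemma cjg_minus: "cjg g (- x) = - cjg g x"
  by (simp only: comm_word)

lemma cjg_cjg: "cjg h (cjg g x) = cjg (g + h) x"
  by (simp only: comm_word)

lemma cjg_diff: "cjg g (x - y) = cjg g x - cjg g y"
  by (simp only: comm_word)

lemma cjg_eq: "cjg g x = x + comm x g"
  by (simp only: comm_word)

lemma comm_cjg: "comm x g = - x + cjg g x"
  by (simp only: comm_word)

lemma comm_swap: "comm g x = - comm x g"
  by (simp only: comm_word)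

lemma comm_0 [simp]: "comm x 0 = 0" "comm 0 x = 0"
  by (simp_all add: comm_def)

lemma comm_self [simp]: "comm x x = 0"
  by (simp only: comm_word)

lemma comm_add_right: "comm x (g + h) = comm x h + cjg h (comm x g)"
  by (simp only: comm_word)

lemma comm_minus_right: "comm x (- g) = - cjg (- g) (comm x g)"
  by (simp only: comm_word)

lemma comm_add_left: "comm (x + y) g = cjg y (comm x g) + comm y g"
  by (simp only: comm_word)

lemma comm_minus_left: "comm (- x) g = - cjg (- x) (comm x g)"
  by (simp only: comm_word)

lemma nsg_cjg_iff: "nsg N \<Longrightarrow> g \<in> \<Gamma> \<Longrightarrow> cjg g x \<in> N \<longleftrightarrow> x \<in> N"
  using nsg_cjg[of N "cjg g x" "- g"] nsg_cjg[of N x g] by (auto simp: cjg_cjg)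

text \<open>By the product and inversion rules for commutators, the elements of \<Gamma> that
  commute with \<open>x\<close> modulo \<open>N\<close> form a subgroup.\<close>

lemma comm_gen_right:
  assumes N: "nsg N" and "comm x \<tau> \<in> N" "comm x \<mu> \<in> N" and g: "g \<in> \<Gamma>"
  shows "comm x g \<in> N"
  using g
  by (induction rule: Gam_induct)
    (use assms in \<open>auto simp: comm_add_right comm_minus_right nsg_zero nsg_add nsg_minus nsg_cjg\<close>)

lemma comm_npow_right:
  assumes N: "nsg N" and "comm x g \<in> N" "g \<in> \<Gamma>"
  shows "comm x (npow g n) \<in> N"
  by (induction n)
    (use assms in \<open>auto simp: comm_add_right nsg_zero nsg_add nsg_cjg\<close>)

lemma npow_eq_zpow: "npow g n = zpow g (int n)"
  by (simp add: zpow_def)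

lemma comm_zpow_right:
  assumes "nsg N" "comm x g \<in> N" "g \<in> \<Gamma>"
  shows "comm x (zpow g k) \<in> N"
proof -
  have "npow g n \<in> \<Gamma>" for n
    by (simp add: sgrp_npow[OF sgrp_Gam] assms)
  then show ?thesis
    using comm_npow_right[OF assms] assms(1)
    by (simp add: zpow_def comm_minus_right nsg_minus nsg_cjg)
qed

lemma comm_gen_left:
  assumes N: "nsg N" and "comm \<tau> y \<in> N" "comm \<mu> y \<in> N" and g: "g \<in> \<Gamma>"
  shows "comm g y \<in> N"
  using g
  by (induction rule: Gam_induct)
    (use assms in \<open>auto simp: comm_add_left comm_minus_left nsg_zero nsg_add nsg_minus nsg_cjg\<close>)

lemma comm_add_closed:
  assumes "nsg N" "comm x g \<in> N" "comm y g \<in> N" "y \<in> \<Gamma>"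
  shows "comm (x + y) g \<in> N"
  using assms by (simp add: comm_add_left nsg_add nsg_cjg)

lemma eqm_refl: "nsg N \<Longrightarrow> eqm N x x"
  by (simp add: eqm_def nsg_zero)

lemma eqm_sym: "nsg N \<Longrightarrow> eqm N x y \<Longrightarrow> eqm N y x"
  unfolding eqm_def by (metis minus_diff_eq nsg_minus)

lemma eqm_trans: "nsg N \<Longrightarrow> eqm N x y \<Longrightarrow> eqm N y z \<Longrightarrow> eqm N x z"
proof -
  have "x - z = (x - y) + (y - z)" by (simp only: group_word)
  then show "nsg N \<Longrightarrow> eqm N x y \<Longrightarrow> eqm N y z \<Longrightarrow> eqm N x z"
    unfolding eqm_def using nsg_add[of N "x - y" "y - z"] by metis
qed

lemma eqm_add:
  assumes "nsg N" "eqm N x x'" "eqm N y y'" "x \<in> \<Gamma>"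
  shows "eqm N (x + y) (x' + y')"
proof -
  have "x + y - (x' + y') = cjg (- x) (y - y') + (x - x')"
    by (simp only: comm_word)
  then show ?thesis using assms by (simp add: eqm_def nsg_add nsg_cjg)
qed

lemma eqm_add_right: "eqm N x y \<Longrightarrow> eqm N (x + z) (y + z)"
  by (simp add: eqm_def diff_conv_add_uminus minus_add add.assoc del: add_uminus_conv_diff)

lemma eqm_add_left: "nsg N \<Longrightarrow> eqm N x y \<Longrightarrow> z \<in> \<Gamma> \<Longrightarrow> eqm N (z + x) (z + y)"
  by (rule eqm_add) (auto simp: eqm_refl)

lemma eqm_minus:
  assumes "nsg N" "eqm N x x'" "x' \<in> \<Gamma>"
  shows "eqm N (- x) (- x')"
proof -
  have "- x - - x' = - cjg x' (x - x')"
    by (simp only: comm_word)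
  then show ?thesis using assms by (simp add: eqm_def nsg_minus nsg_cjg)
qed

lemma eqm_cjg:
  assumes "nsg N" "comm x g \<in> N" "x \<in> \<Gamma>"
  shows "eqm N (cjg g x) x"
proof -
  have "cjg g x - x = cjg (- x) (comm x g)"
    by (simp only: comm_word)
  then show ?thesis using assms by (simp add: eqm_def nsg_cjg)
qed

lemma eqm_zero: "eqm N x 0 \<longleftrightarrow> x \<in> N"
  by (simp add: eqm_def)

lemma eqm_mem: "nsg N \<Longrightarrow> eqm N x y \<Longrightarrow> y \<in> N \<Longrightarrow> x \<in> N"
  unfolding eqm_def using nsg_add[of N "x - y" y] by simp

lemma eqm_mono: "eqm N x y \<Longrightarrow> N \<subseteq> N' \<Longrightarrow> eqm N' x y"
  by (auto simp: eqm_def)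

lemma Der_subset: "\<Gamma>' \<subseteq> \<Gamma>"
  unfolding \<Gamma>'_def by (rule gen_subset[OF sgrp_Gam]) auto

lemma nsg_Der: "nsg \<Gamma>'"
proof -
  have "cjg g x \<in> \<Gamma>'" if "x \<in> \<Gamma>'" "g \<in> \<Gamma>" for x g
    using that unfolding \<Gamma>'_def
  proof (induction rule: gen_by.induct)
    case (incl x)
    then show ?case
      by (intro gen_by.incl) (auto simp: cjg_cjg intro: sgrp_add[OF sgrp_Gam])
  qed (auto simp: cjg_add cjg_minus intro: gen_by.intros)
  then show ?thesis using Der_subset by (auto simp: nsg_def sgrp_Der)
qed

lemma C_Der [simp]: "\<gamma> \<in> \<Gamma>'"
  unfolding \<Gamma>'_def by (rule gen_by.incl) (auto intro: exI[of _ 0])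

lemma Der_Gam [simp]: "x \<in> \<Gamma>' \<Longrightarrow> x \<in> \<Gamma>"
  using Der_subset by auto

lemma comm_Der: "g \<in> \<Gamma> \<Longrightarrow> h \<in> \<Gamma> \<Longrightarrow> comm g h \<in> \<Gamma>'"
  by (rule comm_gen_left[OF nsg_Der]; assumption?; rule comm_gen_right[OF nsg_Der])
    (auto simp: nsg_zero[OF nsg_Der] nsg_minus[OF nsg_Der] comm_swap[of \<mu> \<tau>] simp flip: \<gamma>_def)

lemma Der_subset_normal:
  assumes "nsg N" "\<gamma> \<in> N" shows "\<Gamma>' \<subseteq> N"
  unfolding \<Gamma>'_def by (rule gen_subset) (use assms in \<open>auto simp: nsg_sgrp nsg_cjg\<close>)

section \<open>Pairs, and two copies of the derived subgroup inside it\<close>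

lemma zpow_pair: "zpow (pair a b) k = pair (zpow a k) (zpow b k)"
proof -
  have "npow (pair a b) n = pair (npow a n) (npow b n)" for n
    by (induction n) (simp_all add: pair_add)
  then show ?thesis by (simp add: zpow_def pair_minus)
qed

text \<open>\<tau>^2 = (\<tau>, \<tau>) and \<mu>^-2 = (\<mu>, \<mu>). Conjugation by such diagonal
  elements conjugates sections by an arbitrary element of \<Gamma>.\<close>

lemma pair_diag_Gam: "g \<in> \<Gamma> \<Longrightarrow> pair g g \<in> \<Gamma>"
proof (induction rule: Gam_induct)
  case \<tau>
  show ?case by (simp flip: T_T)
next
  case \<mu>
  have "pair \<mu> \<mu> = - (\<mu> + \<mu>)" by (simp only: U_U pair_minus minus_minus)
  then show ?case by simp
qed (auto simp flip: pair_add pair_minus)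

lemma cjg_pair: "cjg (pair a b) (pair x y) = pair (cjg a x) (cjg b y)"
  by (simp only: cjg_def pair_add pair_minus)

lemma comm_pair: "comm (pair a b) (pair x y) = pair (comm a x) (comm b y)"
  by (simp only: comm_def diff_conv_add_uminus pair_add pair_minus)

lemma cjg_mT: "cjg (- \<tau>) (pair a b) = pair b (cjg (- \<tau>) a)"
proof -
  have "cjg \<tau> (pair b (cjg (- \<tau>) a)) = pair a b" by (simp add: cjg_T cjg_cjg)
  then have "cjg (- \<tau>) (cjg \<tau> (pair b (cjg (- \<tau>) a))) = cjg (- \<tau>) (pair a b)" by simp
  then show ?thesis by (simp add: cjg_cjg)
qed

lemma cjg_mU: "cjg (- \<mu>) (pair a b) = pair b (cjg \<mu> a)"
proof -
  have "cjg \<mu> (pair b (cjg \<mu> a)) = pair a b" by (simp add: cjg_U cjg_cjg)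
  then have "cjg (- \<mu>) (cjg \<mu> (pair b (cjg \<mu> a))) = cjg (- \<mu>) (pair a b)" by simp
  then show ?thesis by (simp add: cjg_cjg)
qed

text \<open>Up to inversion and conjugation by a diagonal element, (c, 1) is the commutator
  [\<tau>^2, \<mu>].\<close>

lemma pair_C_Der: "pair \<gamma> 0 \<in> \<Gamma>'"
proof -
  have "comm (\<tau> + \<tau>) \<mu> = pair (comm \<tau> (- \<mu>)) 0"
    unfolding T_T comm_cjg cjg_U pair_minus pair_add by simp
  also have "\<dots> = pair (cjg (- \<mu>) (- \<gamma>)) 0"
    by (simp add: comm_minus_right \<gamma>_def cjg_minus)
  also have "\<dots> = cjg (pair (- \<mu>) (- \<mu>)) (pair (- \<gamma>) 0)"
    by (simp add: cjg_pair)
  finally have "cjg (pair (- \<mu>) (- \<mu>)) (pair (- \<gamma>) 0) \<in> \<Gamma>'"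
    using comm_Der[of "\<tau> + \<tau>" \<mu>] by simp
  then have "- pair (- \<gamma>) 0 \<in> \<Gamma>'"
    using nsg_minus[OF nsg_Der] by (simp add: nsg_cjg_iff[OF nsg_Der pair_diag_Gam])
  then show ?thesis by (simp add: pair_minus)
qed

text \<open>Conjugating (c, 1) by \<open>pair g g\<close> produces every conjugate of c as a left
  section, and these conjugates generate \<Gamma>'.\<close>

lemma pair_left_Der: "g \<in> \<Gamma>' \<Longrightarrow> pair g 0 \<in> \<Gamma>'"
  unfolding \<Gamma>'_def
proof (induction rule: gen_by.induct)
  case (incl x)
  then obtain g where "x = cjg g \<gamma>" "g \<in> \<Gamma>" by auto
  then have "pair x 0 = cjg (pair g g) (pair \<gamma> 0)" by (simp add: cjg_pair)
  then show ?case
    using nsg_cjg[OF nsg_Der pair_C_Der pair_diag_Gam[OF \<open>g \<in> \<Gamma>\<close>]] by (simp add: \<Gamma>'_def)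
next
  case (add x y)
  have "pair (x + y) 0 = pair x 0 + pair y 0" by (simp add: pair_add)
  with add show ?case by (simp add: gen_by.add)
next
  case (minus x)
  have "pair (- x) 0 = - pair x 0" by (simp add: pair_minus)
  with minus show ?case by (simp add: gen_by.minus)
qed (simp add: gen_by.zero)

lemma pair_Der: "g \<in> \<Gamma>' \<Longrightarrow> h \<in> \<Gamma>' \<Longrightarrow> pair g h \<in> \<Gamma>'"
proof -
  assume gh: "g \<in> \<Gamma>'" "h \<in> \<Gamma>'"
  have "pair 0 h = cjg \<tau> (pair h 0)" by (simp add: cjg_T)
  then have "pair 0 h \<in> \<Gamma>'" using nsg_cjg[OF nsg_Der pair_left_Der[OF gh(2)]] by simp
  moreover have "pair g h = pair g 0 + pair 0 h" by (simp add: pair_add)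
  ultimately show ?thesis using pair_left_Der[OF gh(1)] by (simp add: nsg_add[OF nsg_Der])
qed

text \<open>The normal form \<open>c^k \<cdot> 0(g) \<cdot> 1(h)\<close>, written as \<open>c^k \<cdot> (a, b)\<close> with \<open>b = h\<close> and \<open>a = g h\<close>.\<close>

definition nform_set :: "int set \<Rightarrow> wperm set \<Rightarrow> wperm set \<Rightarrow> wperm set" where
  "nform_set K A B = {zpow \<gamma> k + pair a b | k a b. k \<in> K \<and> a - b \<in> A \<and> b \<in> B}"

lemma liftI: "k \<in> K \<Longrightarrow> a - b \<in> A \<Longrightarrow> b \<in> B \<Longrightarrow> zpow \<gamma> k + pair a b \<in> nform_set K A B"
  by (auto simp: nform_set_def)

lemma pair_nform_set: "0 \<in> K \<Longrightarrow> a - b \<in> A \<Longrightarrow> b \<in> B \<Longrightarrow> pair a b \<in> nform_set K A B"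
  using liftI[of 0 K a b A B] by simp

lemma zpow_C: "zpow \<gamma> k = pair (- zpow \<zeta> k) (zpow \<zeta> k)"
  using zpow_pair[of "- \<zeta>" \<zeta> k] zpow_zpow[of \<zeta> "- 1" k] zpow_minus[of \<zeta> 1] zpow_minus[of \<zeta> k]
  by (simp add: C_eq)

text \<open>Products and conjugates exchange or twist sections. By \<open>BA\<close>, twisting an
  element of \<open>B\<close> does not change it modulo \<open>A\<close>, so the condition
  \<open>a - b \<in> A\<close> survives; by \<open>KA\<close>, conjugating c^k by a generator gives
  c^-k up to an element of \<open>A\<close> in one section.\<close>

lemma nform_set_nsg:
  assumes K: "sgrp K" and A: "nsg A" and B: "nsg B" and AB: "A \<subseteq> B" and BD: "B \<subseteq> \<Gamma>'"
    and BA: "\<And>h g. h \<in> B \<Longrightarrow> g \<in> \<Gamma> \<Longrightarrow> comm h g \<in> A"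
    and KA: "\<And>k g. k \<in> K \<Longrightarrow> g \<in> \<Gamma> \<Longrightarrow> comm (zpow \<zeta> k) g \<in> A"
  shows "nsg (nform_set K A B)" "nform_set K A B \<subseteq> \<Gamma>'"
proof -
  note A' = nsg_zero[OF A] nsg_add[OF A] nsg_minus[OF A]
  have aB: "a \<in> B" if "a - b \<in> A" "b \<in> B" for a b
    using nsg_add[OF B, of "a - b" b] that AB by auto
  have cjA: "eqm A (cjg g b) b" if "b \<in> B" "g \<in> \<Gamma>" for b g
    using eqm_cjg[OF A BA[OF that]] that nsg_Gam[OF B] by auto
  have cjAB: "cjg g a - cjg h b \<in> A \<and> cjg h b - cjg g a \<in> A \<and> cjg g a \<in> B \<and> cjg h b \<in> B"
    if "a - b \<in> A" "b \<in> B" "g \<in> \<Gamma>" "h \<in> \<Gamma>" for a b g h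
  proof -
    have "eqm A (cjg g a) b"
      using eqm_trans[OF A cjA[of a g]] that aB by (auto simp: eqm_def)
    then have "eqm A (cjg g a) (cjg h b)"
      using eqm_trans[OF A _ eqm_sym[OF A cjA[of b h]]] that by auto
    with eqm_sym[OF A this] that aB show ?thesis by (auto simp: eqm_def nsg_cjg[OF B])
  qed
  have cjAB': "a - cjg h b \<in> A \<and> cjg h b - a \<in> A \<and> a \<in> B \<and> cjg h b \<in> B"
      "b - cjg h a \<in> A \<and> cjg h a - b \<in> A \<and> b \<in> B \<and> cjg h a \<in> B"
    if "a - b \<in> A" "b \<in> B" "h \<in> \<Gamma>" for a b h
    using cjAB[of a b 0 h] cjAB[of a b h 0] that by auto
  have addA: "a + a' - (b + b') \<in> A" if "a - b \<in> A" "b \<in> B" "a' - b' \<in> A" "b' \<in> B" for a b a' b'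
    using eqm_add[OF A, of a b a' b'] that aB nsg_Gam[OF B] by (auto simp: eqm_def)
  have L0: "0 \<in> nform_set K A B"
    using liftI[of 0 K 0 0 A B] sgrp_zero[OF K] nsg_zero[OF A] nsg_zero[OF B] by simp
  have Ladd: "x + y \<in> nform_set K A B" if xy: "x \<in> nform_set K A B" "y \<in> nform_set K A B" for x y
  proof -
    obtain k a b where x: "x = zpow \<gamma> k + pair a b" "k \<in> K" "a - b \<in> A" "b \<in> B"
      using xy by (auto simp: nform_set_def)
    obtain k' a' b' where y: "y = zpow \<gamma> k' + pair a' b'" "k' \<in> K" "a' - b' \<in> A" "b' \<in> B"
      using xy by (auto simp: nform_set_def)
    have "x + y = zpow \<gamma> (k + k') + (cjg (zpow \<gamma> k') (pair a b) + pair a' b')"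
      unfolding x y by (simp only: zpow_add comm_word)
    also have "\<dots> = zpow \<gamma> (k + k')
        + pair (cjg (- zpow \<zeta> k') a + a') (cjg (zpow \<zeta> k') b + b')"
      by (simp only: zpow_C[of k'] cjg_pair pair_add)
    also have "\<dots> \<in> nform_set K A B"
      using x y cjAB[of a b "- zpow \<zeta> k'" "zpow \<zeta> k'"]
      by (intro liftI addA) (auto simp: sgrp_add[OF K] nsg_add[OF B])
    finally show ?thesis .
  qed
  have Lminus: "- x \<in> nform_set K A B" if x': "x \<in> nform_set K A B" for x
  proof -
    obtain k a b where x: "x = zpow \<gamma> k + pair a b" "k \<in> K" "a - b \<in> A" "b \<in> B"
      using x' by (auto simp: nform_set_def)
    have "- x = zpow \<gamma> (- k) + - cjg (zpow \<gamma> (- k)) (pair a b)"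
      unfolding x by (simp only: zpow_minus comm_word)
    also have "\<dots> = zpow \<gamma> (- k) + pair (- cjg (zpow \<zeta> k) a) (- cjg (- zpow \<zeta> k) b)"
      by (simp only: zpow_minus zpow_C minus_minus cjg_pair pair_minus)
    also have "\<dots> \<in> nform_set K A B"
      using x cjAB[of a b "zpow \<zeta> k" "- zpow \<zeta> k"] nsg_Gam[OF B]
        eqm_minus[OF A, of "cjg (zpow \<zeta> k) a" "cjg (- zpow \<zeta> k) b"]
      by (intro liftI) (auto simp: sgrp_minus[OF K] nsg_minus[OF B] eqm_def)
    finally show ?thesis .
  qed
  have LP: "pair a b \<in> nform_set K A B" if "a - b \<in> A" "b \<in> B" for a b
    using pair_nform_set that sgrp_zero[OF K] by blast
  have w: "pair w 0 \<in> nform_set K A B" "pair 0 w \<in> nform_set K A B" if "w \<in> A" for w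
    using LP[of w 0] LP[of 0 w] that nsg_zero[OF B] nsg_minus[OF A] AB by auto
  have Lc: "zpow \<gamma> k \<in> nform_set K A B" if "k \<in> K" for k
    using liftI[of k K 0 0 A B] that nsg_zero[OF A] nsg_zero[OF B] by simp
  have dec: "cjg g x \<in> nform_set K A B"
    if "x \<in> nform_set K A B" and "\<And>k. k \<in> K \<Longrightarrow> cjg g (zpow \<gamma> k) \<in> nform_set K A B"
      and "\<And>a b. a - b \<in> A \<Longrightarrow> b \<in> B \<Longrightarrow> cjg g (pair a b) \<in> nform_set K A B" for g x
    using that Ladd by (auto simp: nform_set_def[of K A B] cjg_add)
  have c1: "pair (x + w) (- x) = pair x (- x) + pair w 0" "pair x (- x + w) = pair x (- x) + pair 0 w" for x w
    by (simp_all add: pair_add)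
  \<comment> \<open>These are the two shapes taken by conjugates of \<open>zpow \<gamma> k\<close>
    under the generators and their inverses.\<close>
  have *: "pair (zpow \<zeta> k + w) (- zpow \<zeta> k) \<in> nform_set K A B" "pair (zpow \<zeta> k) (- zpow \<zeta> k + w) \<in> nform_set K A B"
    if "k \<in> K" "w \<in> A" for k w
  proof -
    have "pair (zpow \<zeta> k) (- zpow \<zeta> k) = zpow \<gamma> (- k)"
      by (simp add: zpow_C zpow_minus pair_minus)
    then show "pair (zpow \<zeta> k + w) (- zpow \<zeta> k) \<in> nform_set K A B"
      "pair (zpow \<zeta> k) (- zpow \<zeta> k + w) \<in> nform_set K A B"
      using Lc[of "- k"] that w sgrp_minus[OF K] by (simp_all only: c1 Ladd)
  qed
  have gP: "cjg \<tau> (pair a b) \<in> nform_set K A B" "cjg \<mu> (pair a b) \<in> nform_set K A B"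
      "cjg (- \<tau>) (pair a b) \<in> nform_set K A B" "cjg (- \<mu>) (pair a b) \<in> nform_set K A B"
    if "a - b \<in> A" "b \<in> B" for a b
    using cjAB'[OF that] aB[OF that] by (simp_all add: cjg_T cjg_U cjg_mT cjg_mU LP)
  have gC: "cjg \<tau> (zpow \<gamma> k) \<in> nform_set K A B" "cjg \<mu> (zpow \<gamma> k) \<in> nform_set K A B"
      "cjg (- \<tau>) (zpow \<gamma> k) \<in> nform_set K A B" "cjg (- \<mu>) (zpow \<gamma> k) \<in> nform_set K A B" if "k \<in> K" for k
    using *[OF that KA[of k]] *[OF that KA[of "- k"]] that sgrp_minus[OF K]
    unfolding zpow_C cjg_T cjg_U cjg_mT cjg_mU by (simp_all add: cjg_eq zpow_minus)
  have gens: "cjg \<tau> x \<in> nform_set K A B" "cjg \<mu> x \<in> nform_set K A B" "cjg (- \<tau>) x \<in> nform_set K A B"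
    "cjg (- \<mu>) x \<in> nform_set K A B" if "x \<in> nform_set K A B" for x
    using dec[OF that] gP gC by blast+
  \<comment> \<open>Stated for \<open>g\<close> and \<open>- g\<close> together, so that the
    inversion case of the induction over \<Gamma> is immediate.\<close>
  have Lcj: "cjg g x \<in> nform_set K A B \<and> cjg (- g) x \<in> nform_set K A B"
    if "g \<in> \<Gamma>" "x \<in> nform_set K A B" for g x
    using that(1) that(2)
  proof (induction arbitrary: x rule: Gam_induct)
    case (add g h)
    have "cjg (g + h) x = cjg h (cjg g x)" "cjg (- (g + h)) x = cjg (- g) (cjg (- h) x)"
      by (simp_all only: comm_word)
    with add show ?case by simp
  qed (auto simp: gens)
  show sub: "nform_set K A B \<subseteq> \<Gamma>'"
    using BD aB by (auto simp: nform_set_def intro!: nsg_add[OF nsg_Der] nsg_zpow[OF nsg_Der] pair_Der)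
  show "nsg (nform_set K A B)"
    using sub Lcj by (auto simp: nsg_def sgrp_def L0 Ladd Lminus)
qed

text \<open>Existence of the normal form: the left side is a normal subgroup containing c, hence
  contains its normal closure.\<close>

lemma nform_set_Der: "nform_set UNIV \<Gamma>' \<Gamma>' = \<Gamma>'"
proof
  have *: "nsg (nform_set UNIV \<Gamma>' \<Gamma>')" "nform_set UNIV \<Gamma>' \<Gamma>' \<subseteq> \<Gamma>'"
    by (rule nform_set_nsg; auto simp: nsg_Der comm_Der sgrp_def)+
  then show "nform_set UNIV \<Gamma>' \<Gamma>' \<subseteq> \<Gamma>'" by simp
  have "\<gamma> \<in> nform_set UNIV \<Gamma>' \<Gamma>'"
    using liftI[of 1 UNIV 0 0 \<Gamma>' \<Gamma>'] by (simp add: nsg_zero[OF nsg_Der])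
  then show "\<Gamma>' \<subseteq> nform_set UNIV \<Gamma>' \<Gamma>'"
    by (rule Der_subset_normal[OF *(1)])
qed

lemma Der_cases:
  assumes "x \<in> \<Gamma>'"
  obtains k a b where "x = zpow \<gamma> k + pair a b" "a \<in> \<Gamma>'" "b \<in> \<Gamma>'"
proof -
  obtain k a b where *: "x = zpow \<gamma> k + pair a b" "a - b \<in> \<Gamma>'" "b \<in> \<Gamma>'"
    using assms by (subst (asm) nform_set_Der[symmetric]) (auto simp: nform_set_def)
  have "a \<in> \<Gamma>'" using nsg_add[OF nsg_Der *(2,3)] by simp
  with * that show ?thesis by blast
qed

section \<open>Freeness of the abelianisation\<close>

lemma zpow_double: "zpow x (2 * k) = zpow (x + x) k"
  using zpow_zpow[of x 2 k] zpow_add[of x 1 1] by simp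

lemma zpow_T_double: "zpow \<tau> (2 * i) = pair (zpow \<tau> i) (zpow \<tau> i)"
  by (simp add: zpow_double T_T zpow_pair)

lemma zpow_U_double: "zpow \<mu> (2 * i) = pair (zpow \<mu> (- i)) (zpow \<mu> (- i))"
  using zpow_zpow[of \<mu> "- 1" i] by (simp add: zpow_double U_U zpow_pair zpow_minus)


text \<open>Exponent pairs of elements of the derived subgroup, in the coordinates \<open>s = p + q\<close> and
  \<open>d = p - q\<close>.  The two sections of such an element have \<open>d\<close>-coordinate \<open>s / 2\<close>, and their
  \<open>s\<close>-coordinates add up to \<open>d\<close>.  Two such steps halve \<open>s\<close>, so \<open>s = 0\<close> by descent.\<close>

definition Lam :: "int \<Rightarrow> int \<Rightarrow> bool"
  where "Lam s d \<longleftrightarrow> (\<exists>p q. s = p + q \<and> d = p - q \<and> zpow \<tau> p + zpow \<mu> q \<in> \<Gamma>')"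

lemma eqm_Der_swap:
  assumes "x \<in> \<Gamma>" "y \<in> \<Gamma>" shows "eqm \<Gamma>' (x + y) (y + x)"
proof -
  have "x + y - (y + x) = comm (- x) (- y)" by (simp only: comm_word)
  then show ?thesis using assms by (simp add: eqm_def comm_Der)
qed

lemma TU_add: 
  "eqm \<Gamma>' (zpow \<tau> p + zpow \<mu> q + (zpow \<tau> p' + zpow \<mu> q')) (zpow \<tau> (p + p') + zpow \<mu> (q + q'))"
proof -
  have "eqm \<Gamma>' (zpow \<mu> q + zpow \<tau> p') (zpow \<tau> p' + zpow \<mu> q)"
    by (simp add: eqm_Der_swap)
  then have "eqm \<Gamma>' (zpow \<tau> p + ((zpow \<mu> q + zpow \<tau> p') + zpow \<mu> q'))
      (zpow \<tau> p + ((zpow \<tau> p' + zpow \<mu> q) + zpow \<mu> q'))"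
    by (intro eqm_add_left[OF nsg_Der] eqm_add_right) auto
  then show ?thesis by (simp add: zpow_add add.assoc)
qed

lemma TU_minus: "eqm \<Gamma>' (- (zpow \<tau> p + zpow \<mu> q)) (zpow \<tau> (- p) + zpow \<mu> (- q))"
  using eqm_Der_swap[of "zpow \<mu> (- q)" "zpow \<tau> (- p)"]
  by (simp add: minus_add zpow_minus del: add_uminus_conv_diff)

lemma zpow_Z: "eqm \<Gamma>' (zpow \<zeta> k) (zpow \<tau> k + zpow \<mu> k)"
proof (induction k rule: int_induct[where k = 0])
  case (step1 k)
  have "eqm \<Gamma>' (zpow \<zeta> k + \<zeta>) (zpow \<tau> k + zpow \<mu> k + (zpow \<tau> 1 + zpow \<mu> 1))"
    using step1 eqm_Der_swap[of \<mu> \<tau>] by (intro eqm_add[OF nsg_Der]) (auto simp: \<zeta>_def)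
  from eqm_trans[OF nsg_Der this TU_add] show ?case by (simp add: zpow_Suc)
next
  case (step2 k)
  have "eqm \<Gamma>' (- \<zeta>) (- (zpow \<tau> 1 + zpow \<mu> 1))"
    using eqm_Der_swap[of \<mu> \<tau>] by (intro eqm_minus[OF nsg_Der]) (auto simp: \<zeta>_def)
  then have "eqm \<Gamma>' (zpow \<zeta> k + - \<zeta>) (zpow \<tau> k + zpow \<mu> k + (zpow \<tau> (-1) + zpow \<mu> (-1)))"
    using step2 eqm_trans[OF nsg_Der _ TU_minus[of 1 1]] by (intro eqm_add[OF nsg_Der]) auto
  from eqm_trans[OF nsg_Der this TU_add] show ?case
    using zpow_add[of \<zeta> k "-1"] by (simp add: zpow_minus)
qed (simp add: eqm_refl nsg_Der)

lemma Lam_add: "Lam s d \<Longrightarrow> Lam s' d' \<Longrightarrow> Lam (s + s') (d + d')"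
proof -
  assume "Lam s d" "Lam s' d'"
  then obtain p q p' q' where *: "s = p + q" "d = p - q" "zpow \<tau> p + zpow \<mu> q \<in> \<Gamma>'"
    "s' = p' + q'" "d' = p' - q'" "zpow \<tau> p' + zpow \<mu> q' \<in> \<Gamma>'"
    by (auto simp: Lam_def)
  have "zpow \<tau> (p + p') + zpow \<mu> (q + q') \<in> \<Gamma>'"
    using eqm_mem[OF nsg_Der eqm_sym[OF nsg_Der TU_add]] nsg_add[OF nsg_Der *(3,6)] by blast
  then show "Lam (s + s') (d + d')"
    unfolding Lam_def by (intro exI[of _ "p + p'"] exI[of _ "q + q'"]) (simp add: *)
qed

text \<open>Modulo \<Gamma>', \<zeta>^k has the exponent pair (k, k); dividing it out lowers the sum
  of the exponents by 2k and keeps their difference.\<close>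

lemma section_Lam:
  assumes "zpow \<tau> p + zpow \<mu> q = zpow \<zeta> k + g" "g \<in> \<Gamma>'"
  shows "Lam (p + q - 2 * k) (p - q)"
proof -
  have "eqm \<Gamma>' (zpow \<zeta> k + g) (zpow \<tau> k + zpow \<mu> k + 0)"
    using assms by (intro eqm_add[OF nsg_Der zpow_Z]) (auto simp: eqm_zero)
  then have "eqm \<Gamma>' (zpow \<tau> p + zpow \<mu> q) (zpow \<tau> k + zpow \<mu> k)"
    by (simp add: assms)
  then have "eqm \<Gamma>' (zpow \<tau> p + zpow \<mu> q + - (zpow \<tau> k + zpow \<mu> k))
       (zpow \<tau> k + zpow \<mu> k + - (zpow \<tau> k + zpow \<mu> k))"
    by (rule eqm_add_right)
  then have "zpow \<tau> p + zpow \<mu> q + - (zpow \<tau> k + zpow \<mu> k) \<in> \<Gamma>'"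
    by (simp only: right_minus eqm_zero)
  moreover have "eqm \<Gamma>' (zpow \<tau> p + zpow \<mu> q + - (zpow \<tau> k + zpow \<mu> k))
       (zpow \<tau> (p + - k) + zpow \<mu> (q + - k))"
    by (rule eqm_trans[OF nsg_Der eqm_add[OF nsg_Der eqm_refl[OF nsg_Der] TU_minus] TU_add]) auto
  ultimately have "zpow \<tau> (p - k) + zpow \<mu> (q - k) \<in> \<Gamma>'"
    using eqm_mem[OF nsg_Der eqm_sym[OF nsg_Der]] by (metis add_uminus_conv_diff)
  then show ?thesis
    unfolding Lam_def by (intro exI[of _ "p - k"] exI[of _ "q - k"]) simp
qed

lemma Gam_Nil: "g \<in> \<Gamma> \<Longrightarrow> act g [] = []"
proof (induction rule: Gam_induct)
  case (minus g)
  then show ?case using act_inverse(1)[of g "[]"] by simp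
qed auto

lemma Lam_step:
  assumes "Lam s d"
  obtains u v where "even s" "u + v = d" "Lam u (s div 2)" "Lam v (s div 2)"
proof -
  obtain p q where pq: "s = p + q" "d = p - q" "zpow \<tau> p + zpow \<mu> q \<in> \<Gamma>'"
    using assms by (auto simp: Lam_def)
  then obtain k g h where x: "zpow \<tau> p + zpow \<mu> q = zpow \<gamma> k + pair g h" "g \<in> \<Gamma>'" "h \<in> \<Gamma>'"
    using Der_cases by metis
  then have x': "zpow \<tau> p + zpow \<mu> q = pair (zpow \<zeta> (- k) + g) (zpow \<zeta> k + h)"
    by (simp add: zpow_C pair_add zpow_minus)
  \<comment> \<open>Elements of \<Gamma>' fix the first letter while both generators change it, so
    \<open>p\<close> and \<open>q\<close> have the same parity.\<close>
  have "act (zpow \<tau> p + zpow \<mu> q) [False] = [False]"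
    using x by (simp add: zpow_C Gam_Nil)
  then have "even p \<or> even q \<longrightarrow> even p \<and> even q"
    by (cases "even p"; cases "even q")
      (auto elim!: evenE oddE simp: zpow_Suc zpow_T_double zpow_U_double Gam_Nil)
  then consider i j where "p = 2 * i" "q = 2 * j" | i j where "p = 2 * i + 1" "q = 2 * j + 1"
    by (metis evenE oddE)
  then show ?thesis
  proof cases
    case 1
    then have "zpow \<tau> i + zpow \<mu> (- j) = zpow \<zeta> (- k) + g" "zpow \<tau> i + zpow \<mu> (- j) = zpow \<zeta> k + h"
      using x' by (auto simp: zpow_T_double zpow_U_double pair_add)
    from section_Lam[OF this(1) x(2)] section_Lam[OF this(2) x(3)] show ?thesis
      using 1 pq by (intro that[of "i - j + 2 * k" "i - j - 2 * k"]) auto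
  next
    case 2
    \<comment> \<open>The odd factors are collected in the middle as \<open>\<tau> + \<mu>\<close>,
      whose sections are given by \<open>T_U\<close>.\<close>
    have "zpow \<tau> p + zpow \<mu> q = zpow \<tau> (2 * i) + (\<tau> + \<mu>) + zpow \<mu> (2 * j)"
      using zpow_add[of \<tau> "2 * i" 1] zpow_add[of \<mu> 1 "2 * j"] 2 by (simp add: add.commute add.assoc)
    also have "\<dots> = pair (zpow \<tau> i + - \<mu> + zpow \<mu> (- j)) (zpow \<tau> i + \<tau> + zpow \<mu> (- j))"
      by (simp only: zpow_T_double zpow_U_double T_U pair_add)
    also have "\<dots> = pair (zpow \<tau> i + zpow \<mu> (- j - 1)) (zpow \<tau> (i + 1) + zpow \<mu> (- j))"
    proof -
      have "- j - 1 = - 1 + - j" by simp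
      then have "zpow \<mu> (- j - 1) = - \<mu> + zpow \<mu> (- j)"
        by (simp only: zpow_add zpow_minus zpow_1)
      then show ?thesis by (simp only: zpow_Suc add.assoc)
    qed
    finally have "zpow \<tau> i + zpow \<mu> (- j - 1) = zpow \<zeta> (- k) + g"
      "zpow \<tau> (i + 1) + zpow \<mu> (- j) = zpow \<zeta> k + h"
      using x' by auto
    from section_Lam[OF this(1) x(2)] section_Lam[OF this(2) x(3)] show ?thesis
      using 2 pq
      by (intro that[of "i - j - 1 + 2 * k" "i - j + 1 - 2 * k"]) (auto simp: algebra_simps)
  qed
qed

lemma Lam_zero:
  assumes "Lam s d" shows "s = 0 \<and> d = 0"
proof -
  have s: "s = 0" if "Lam s d" for s d
    using that
  proof (induction "nat \<bar>s\<bar>" arbitrary: s d rule: less_induct)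
    case less
    show ?case
    proof (rule ccontr)
      assume "s \<noteq> 0"
      obtain u v where uv: "even s" "Lam u (s div 2)" using Lam_step[OF less.prems] by metis
      obtain u' v' where uv': "u' + v' = s div 2" "Lam u' (u div 2)" "Lam v' (u div 2)"
        using Lam_step[OF uv(2)] by metis
      \<comment> \<open>Here \<open>u'\<close> and \<open>v'\<close> come from the two sections of a
        section; adding their pairs gives a pair whose first coordinate is
        \<open>s div 2\<close>.\<close>
      have "Lam (s div 2) (u div 2 + u div 2)"
        using Lam_add[OF uv'(2,3)] uv'(1) by simp
      moreover have "nat \<bar>s div 2\<bar> < nat \<bar>s\<bar>" using \<open>s \<noteq> 0\<close> uv(1) by auto
      ultimately have "s div 2 = 0" using less.hyps by blast
      then show False using \<open>s \<noteq> 0\<close> uv(1) by auto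
    qed
  qed
  \<comment> \<open>\<open>d\<close> is a sum of two numbers that are themselves first coordinates,
    hence zero.\<close>
  with Lam_step[OF assms] show ?thesis using assms by (metis add_0)
qed

lemma TU_Der:
  assumes "zpow \<tau> p + zpow \<mu> q \<in> \<Gamma>'" shows "p = 0 \<and> q = 0"
proof -
  have "Lam (p + q) (p - q)" using assms by (auto simp: Lam_def)
  from Lam_zero[OF this] show ?thesis by auto
qed

lemma zpow_Z_Der:
  assumes "zpow \<zeta> k \<in> \<Gamma>'" shows "k = 0"
  using TU_Der[OF eqm_mem[OF nsg_Der eqm_sym[OF nsg_Der zpow_Z] assms]] by simp

text \<open>The right section determines \<zeta>^k modulo \<Gamma>', where \<zeta> has infinite
  order; after that only pairs are compared.\<close>

lemma normal_form_unique:
  assumes "zpow \<gamma> k + pair a b = zpow \<gamma> k' + pair a' b'" "a \<in> \<Gamma>'" "b \<in> \<Gamma>'" "a' \<in> \<Gamma>'" "b' \<in> \<Gamma>'"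
  shows "k = k' \<and> a = a' \<and> b = b'"
proof -
  have "zpow \<zeta> k + b = zpow \<zeta> k' + b'"
    using assms by (simp add: zpow_C pair_add)
  then have "- zpow \<zeta> k' + zpow \<zeta> k = b' - b"
    by (metis add.assoc add_minus_cancel diff_conv_add_uminus minus_add_cancel right_minus add.right_neutral)
  then have "zpow \<zeta> (- k' + k) = b' - b" by (simp only: zpow_add zpow_minus)
  then have "k = k'" using zpow_Z_Der[of "- k' + k"] nsg_diff[OF nsg_Der assms(5,3)] by simp
  then show ?thesis using assms(1) by simp
qed

section \<open>The filtration of the derived subgroup\<close>

text \<open>If x has degree w and squaring doubles degrees, these are the exponents k for which the
  degree of x^k is guaranteed to be at least r.\<close>

definition exps :: "real \<Rightarrow> real \<Rightarrow> int set"
  where "exps w r = {k. k = 0 \<or> (\<exists>v. 2 ^ v dvd k \<and> r \<le> 2 ^ v * w)}"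

text \<open>\<open>Fil m s r\<close> restricts the exponents of the \<open>W(c)\<close> with \<open>|W| < m\<close> to multiples of some \<open>2^v\<close>
  with \<open>r \<le> 2^v (deg W(c) - s)\<close>.  The disjunct \<open>k = 0\<close> of \<open>exps\<close> matters for \<open>s = 2\<close>.\<close>

fun Fil :: "nat \<Rightarrow> real \<Rightarrow> real \<Rightarrow> wperm set" where
  "Fil 0 s r = \<Gamma>'"
| "Fil (Suc m) s r = nform_set (exps (2 - s) r) (Fil m ((1 + s) / 2) (r / 2)) (Fil m (s / 2) (r / 2))"

lemma exps_0 [simp]: "0 \<in> exps w r"
  by (simp add: exps_def)

lemma exps_cases:
  assumes "k \<in> exps w r"
  obtains "k = 0" | v j where "k = 2 ^ v * j" "r \<le> 2 ^ v * w"
  using assms by (auto simp: exps_def elim!: dvdE)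

lemma exps_mono:
  assumes "\<And>x. 1 \<le> x \<Longrightarrow> r \<le> x * w \<Longrightarrow> r' \<le> x * w'"
  shows "exps w r \<subseteq> exps w' r'"
proof
  fix k assume "k \<in> exps w r"
  then show "k \<in> exps w' r'"
    using assms[of "2 ^ v" for v] by (auto simp: exps_def)
qed

lemma exps_half: "exps (w / 2) (r / 2) = exps w r"
  by (auto simp: exps_def)

lemma exps_double: "k \<in> exps w r \<Longrightarrow> 2 * k \<in> exps (w / 2) r"
proof (erule exps_cases)
  fix v j assume "k = 2 ^ v * j" "r \<le> 2 ^ v * w"
  then have "2 ^ Suc v dvd 2 * k" "r \<le> 2 ^ Suc v * (w / 2)" by auto
  then show ?thesis unfolding exps_def by blast
qed simp

lemma sgrp_exps:
  assumes "0 \<le> w" shows "sgrp (exps w r)"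
proof -
  have "k + k' \<in> exps w r" if k: "k \<in> exps w r" "k' \<in> exps w r" for k k'
  proof (cases "k = 0 \<or> k' = 0")
    case False
    then obtain v v' where "2 ^ v dvd k" "r \<le> 2 ^ v * w" "2 ^ v' dvd k'" "r \<le> 2 ^ v' * w"
      using k by (auto simp: exps_def)
    then have "2 ^ min v v' dvd k + k'" "r \<le> 2 ^ min v v' * w"
      by (auto simp: min_def intro!: dvd_add
          intro: power_le_dvd[of _ v k v'] power_le_dvd[of _ v' k' v])
    then show ?thesis by (auto simp: exps_def)
  qed (use that in auto)
  moreover have "- k \<in> exps w r" if "k \<in> exps w r" for k
    using that by (auto simp: exps_def)
  ultimately show ?thesis by (auto simp: sgrp_def)
qed

lemma nform_set_mono: "K \<subseteq> K' \<Longrightarrow> A \<subseteq> A' \<Longrightarrow> B \<subseteq> B' \<Longrightarrow> nform_set K A B \<subseteq> nform_set K' A' B'"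
  by (force simp: nform_set_def)

text \<open>Real \<open>x \<ge> 1\<close> and \<open>d \<ge> 2\<close> stand for 2^v and deg W. This
  keeps the induction uniform: passing to a section replaces \<open>d\<close> by 2d - 1 or 2d, which
  preserves \<open>d \<ge> 2\<close>.\<close>

lemma Fil_mono:
  assumes "\<And>x d. 1 \<le> x \<Longrightarrow> 2 \<le> d \<Longrightarrow> r \<le> x * (d - s) \<Longrightarrow> r' \<le> x * (d - s')"
  shows "Fil m s r \<subseteq> Fil m s' r'"
  using assms
proof (induction m arbitrary: s r s' r')
  case (Suc m)
  have "Fil m ((1 + s) / 2) (r / 2) \<subseteq> Fil m ((1 + s') / 2) (r' / 2)"
  proof (rule Suc.IH)
    fix x d :: real assume "1 \<le> x" "2 \<le> d" "r / 2 \<le> x * (d - (1 + s) / 2)"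
    then show "r' / 2 \<le> x * (d - (1 + s') / 2)"
      using Suc.prems[of x "2 * d - 1"] by (simp add: field_simps)
  qed
  moreover have "Fil m (s / 2) (r / 2) \<subseteq> Fil m (s' / 2) (r' / 2)"
  proof (rule Suc.IH)
    fix x d :: real assume "1 \<le> x" "2 \<le> d" "r / 2 \<le> x * (d - s / 2)"
    then show "r' / 2 \<le> x * (d - s' / 2)"
      using Suc.prems[of x "2 * d"] by (simp add: field_simps)
  qed
  moreover have "exps (2 - s) r \<subseteq> exps (2 - s') r'"
    by (rule exps_mono) (use Suc.prems[of _ 2] in simp)
  ultimately show ?case by (simp add: nform_set_mono)
qed simp

text \<open>As c (d - 2) <= d - 2 for a factor \<open>c\<close> between 0 and 1, it suffices to
  compare at the minimal degree d = 2. The factors used are 1, 1/2 (\<open>Fil_half\<close>) and 1 -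
  s (\<open>zpow_Z_comm\<close>).\<close>

lemma Fil_le:
  assumes "0 \<le> c" "c \<le> 1" "c * (2 - s) \<le> 2 - s'" "r' \<le> c * r"
  shows "Fil m s r \<subseteq> Fil m s' r'"
proof (rule Fil_mono)
  fix x d :: real assume x: "1 \<le> x" "2 \<le> d" and r: "r \<le> x * (d - s)"
  have "c * (d - 2) \<le> d - 2" using x assms by (simp add: mult_left_le_one_le)
  then have "c * (d - s) \<le> d - s'" using assms(3) by (simp add: algebra_simps)
  then have "x * (c * (d - s)) \<le> x * (d - s')" using x by simp
  moreover have "c * r \<le> c * (x * (d - s))" using r assms(1) by (simp add: mult_left_mono)
  ultimately show "r' \<le> x * (d - s')" using assms(4) by (simp add: algebra_simps)
qed

lemma Fil_le1: "s' \<le> s \<Longrightarrow> r' \<le> r \<Longrightarrow> Fil m s r \<subseteq> Fil m s' r'"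
  by (rule Fil_le[of 1]) auto

lemma Fil_half: "s' \<le> 1 + s / 2 \<Longrightarrow> r' \<le> r / 2 \<Longrightarrow> Fil m s r \<subseteq> Fil m s' r'"
  by (rule Fil_le[of "1 / 2"]) auto

text \<open>Trades shift for degree: lowering \<open>s\<close> by \<open>t\<close> raises 2^v (d -
  s) by 2^v t, which is at least \<open>t\<close>. Thus a commutator with shift 1 becomes a gain of
  one degree.\<close>

lemma Fil_shift: "0 \<le> t \<Longrightarrow> Fil m (s + t) r \<subseteq> Fil m s (r + t)"
proof (rule Fil_mono)
  fix x d :: real assume "0 \<le> t" "1 \<le> x" "r \<le> x * (d - (s + t))"
  moreover have "t \<le> x * t" using \<open>0 \<le> t\<close> \<open>1 \<le> x\<close> by (simp add: mult_le_cancel_right1)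
  ultimately show "r + t \<le> x * (d - s)" by (simp add: algebra_simps)
qed

lemma Fil_top: "r \<le> 2 - s \<Longrightarrow> 0 \<le> s \<Longrightarrow> Fil m s r = \<Gamma>'"
proof (induction m arbitrary: s r)
  case (Suc m)
  have "exps (2 - s) r = UNIV" using Suc.prems by (auto simp: exps_def intro!: exI[of _ 0])
  then show ?case
    using Suc.IH[of "r / 2" "(1 + s) / 2"] Suc.IH[of "r / 2" "s / 2"] Suc.prems nform_set_Der
    by (simp add: field_simps)
qed simp

lemma Fil_Der: "Fil m s r \<subseteq> \<Gamma>'"
proof (induction m arbitrary: s r)
  case (Suc m)
  have "Fil (Suc m) s r \<subseteq> nform_set UNIV \<Gamma>' \<Gamma>'"
    using Suc by (simp add: nform_set_mono)
  then show ?case by (simp add: nform_set_Der)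
qed simp

lemma zpow_2_power: "zpow x (2 ^ Suc v * j) = zpow x (2 ^ v * j) + zpow x (2 ^ v * j)"
  by (simp add: algebra_simps flip: zpow_add)

text \<open>The sections of c are inverse to each other, so exchanging them inverts c, up to the
  twist of one section. This is the source of the factor c^-2 in [c, \<tau>].\<close>

lemma zpow_C_cjg_T: "cjg \<tau> (zpow \<gamma> k) = zpow \<gamma> (- k) + pair (comm (zpow \<zeta> k) \<tau>) 0"
  by (simp add: zpow_C zpow_minus cjg_T pair_minus pair_add comm_cjg)

lemma zpow_C_cjg_U: "cjg \<mu> (zpow \<gamma> k) = zpow \<gamma> (- k) + pair (comm (zpow \<zeta> k) (- \<mu>)) 0"
  by (simp add: zpow_C zpow_minus cjg_U pair_minus pair_add comm_cjg)

lemma zpow_C_comm_T: "comm (zpow \<gamma> k) \<tau> = zpow \<gamma> (- 2 * k) + pair (comm (zpow \<zeta> k) \<tau>) 0"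
proof -
  have "zpow \<gamma> (- 2 * k) = - zpow \<gamma> k + zpow \<gamma> (- k)"
    by (simp flip: zpow_minus zpow_add)
  then show ?thesis unfolding comm_cjg[of "zpow \<gamma> k"] zpow_C_cjg_T by (simp only: add.assoc)
qed

lemma zpow_C_comm_U: "comm (zpow \<gamma> k) \<mu> = zpow \<gamma> (- 2 * k) + pair (comm (zpow \<zeta> k) (- \<mu>)) 0"
proof -
  have "zpow \<gamma> (- 2 * k) = - zpow \<gamma> k + zpow \<gamma> (- k)"
    by (simp flip: zpow_minus zpow_add)
  then show ?thesis unfolding comm_cjg[of "zpow \<gamma> k"] zpow_C_cjg_U by (simp only: add.assoc)
qed

lemma pair_left_comm_T: "comm (pair g 0) \<tau> = pair (- g) g"
  by (simp add: comm_cjg cjg_T pair_minus pair_add)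

lemma pair_left_comm_U: "comm (pair g 0) \<mu> = pair (- g) g"
  by (simp add: comm_cjg cjg_U pair_minus pair_add)

lemma pair_diag_comm_T: "comm (pair h h) \<tau> = pair (comm h \<tau>) 0"
  by (simp add: comm_cjg cjg_T pair_minus pair_add)

lemma pair_diag_comm_U: "comm (pair h h) \<mu> = pair (comm h (- \<mu>)) 0"
  by (simp add: comm_cjg cjg_U pair_minus pair_add)

lemma comm_zpow_zpow: "comm (zpow x j) (zpow x k) = 0"
proof -
  have "comm (zpow x j) (zpow x k) = - (zpow x k + zpow x j) + (zpow x j + zpow x k)"
    by (simp only: comm_word)
  then show ?thesis unfolding zpow_commute[of x j k] by (simp only: left_minus)
qed

lemma Fil_Suc_cases:
  assumes "x \<in> Fil (Suc m) s r"
  obtains k g h where "x = zpow \<gamma> k + pair g 0 + pair h h" "k \<in> exps (2 - s) r"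
    "g \<in> Fil m ((1 + s) / 2) (r / 2)" "h \<in> Fil m (s / 2) (r / 2)"
proof -
  obtain k a b where *: "x = zpow \<gamma> k + pair a b" "k \<in> exps (2 - s) r"
    "a - b \<in> Fil m ((1 + s) / 2) (r / 2)" "b \<in> Fil m (s / 2) (r / 2)"
    using assms by (auto simp: nform_set_def)
  then have "x = zpow \<gamma> k + pair (a - b) 0 + pair b b"
    by (simp add: pair_add add.assoc)
  with * that show ?thesis by blast
qed

text \<open>The reason for the shifts of \<open>s\<close>: commutation with \<open>\<tau>\<close> or \<open>\<mu>\<close> raises the degree by 1, except that
  \<open>[c, \<tau>]\<close> also involves \<open>c\<^sup>-\<^sup>2\<close>, whence \<open>1 + s / 2\<close> in place of \<open>1 + s\<close>.  The square does not
  occur for \<open>\<zeta>\<close>.\<close>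

locale Fil_level =
  fixes m :: nat
  assumes nsg_Fil: "0 \<le> s \<Longrightarrow> s \<le> 2 \<Longrightarrow> nsg (Fil m s r)"
    and Fil_comm: "0 \<le> s \<Longrightarrow> s \<le> 1 \<Longrightarrow> x \<in> Fil m s r \<Longrightarrow> g \<in> \<Gamma> \<Longrightarrow> comm x g \<in> Fil m (1 + s / 2) r"
    and Fil_comm_Z: "0 \<le> s \<Longrightarrow> s \<le> 1 \<Longrightarrow> x \<in> Fil m s r \<Longrightarrow> comm x \<zeta> \<in> Fil m (1 + s) r"
    and Fil_double: "0 \<le> s \<Longrightarrow> s \<le> 1 \<Longrightarrow> x \<in> Fil m s r \<Longrightarrow> x + x \<in> Fil m s (2 * r)"
    and Fil_comm_Fil: "0 \<le> s \<Longrightarrow> 0 \<le> s' \<Longrightarrow> s + s' \<le> 1 \<Longrightarrow> 0 \<le> r \<Longrightarrow> 0 \<le> r' \<Longrightarrow>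
      x \<in> Fil m s r \<Longrightarrow> y \<in> Fil m s' r' \<Longrightarrow> comm x y \<in> Fil m (s + s') (r + r')"
begin

section \<open>From depth m to depth m + 1\<close>

lemma Fil_Gam [simp]: "x \<in> Fil m s r \<Longrightarrow> x \<in> \<Gamma>"
  using Fil_Der Der_Gam by blast

text \<open>\<zeta> counts as an element of degree 1. With X = \<zeta>^(2^v j) one has [y, X^2] =
  [y, X]^2 [[y, X], X], and both factors gain another 2^v (1 - s'). In the base case
  \<open>Fil_comm_Z\<close> gives the shift 1 + s, of which \<open>Fil_shift\<close> converts 1 - s'
  into degree.\<close>

lemma comm_zpow_Z_power:
  assumes "0 \<le> s" "0 \<le> s'" "s + s' \<le> 1" "0 \<le> r" "y \<in> Fil m s r"
  shows "comm y (zpow \<zeta> (2 ^ v * j)) \<in> Fil m (s + s') (r + 2 ^ v * (1 - s'))"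
  using assms(4,5)
proof (induction v arbitrary: r y)
  case 0
  have "comm y (zpow \<zeta> j) \<in> Fil m (1 + s) r"
    using 0 assms by (intro comm_zpow_right nsg_Fil Fil_comm_Z) auto
  also have "Fil m (1 + s) r \<subseteq> Fil m (s + s') (r + (1 - s'))"
    using Fil_shift[of "1 - s'" m "s + s'" r] assms by (simp add: add.commute)
  finally show ?case by simp
next
  case (Suc v)
  define X where "X = zpow \<zeta> (2 ^ v * j)"
  define y1 where "y1 = comm y X"
  let ?e = "2 ^ v * (1 - s') :: real"
  have e: "0 \<le> ?e" using assms by simp
  have y1: "y1 \<in> Fil m (s + s') (r + ?e)" using Suc by (simp add: X_def y1_def)
  then have "y1 \<in> Fil m s (r + ?e)" using Fil_le1[of s "s + s'" "r + ?e" "r + ?e"] assms by auto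
  then have "comm y1 X \<in> Fil m (s + s') (r + ?e + ?e)"
    using Suc e unfolding X_def by (intro Suc.IH) auto
  moreover have "y1 + y1 \<in> Fil m (s + s') (r + ?e + ?e)"
    using Fil_double[OF _ _ y1] Fil_le1[of "s + s'" "s + s'" "r + ?e + ?e" "2 * (r + ?e)" m]
      Suc.prems assms by auto
  ultimately have "y1 + y1 + comm y1 X \<in> Fil m (s + s') (r + ?e + ?e)"
    using assms by (intro nsg_add[OF nsg_Fil, of "s + s'" "y1 + y1"]) auto
  moreover have "zpow \<zeta> (2 ^ Suc v * j) = X + X"
    by (simp only: X_def zpow_2_power)
  then have "comm y (zpow \<zeta> (2 ^ Suc v * j)) = y1 + y1 + comm y1 X"
    by (simp only: y1_def comm_word)
  ultimately show ?case by (simp add: algebra_simps)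
qed

lemma comm_zpow_Z:
  assumes "0 \<le> s" "0 \<le> s'" "s + s' \<le> 1" "0 \<le> r" "y \<in> Fil m s r" "k \<in> exps (1 - s') r'"
  shows "comm y (zpow \<zeta> k) \<in> Fil m (s + s') (r + r')"
  using assms(6)
proof (cases rule: exps_cases)
  case 1
  then show ?thesis using assms nsg_zero[OF nsg_Fil] by simp
next
  case (2 v j)
  then show ?thesis
    using comm_zpow_Z_power[OF assms(1-5), of v j]
      Fil_le1[of "s + s'" "s + s'" "r + r'" "r + 2 ^ v * (1 - s')" m] by auto
qed

text \<open>[X^2, g] is a conjugate of [[X, g], X] times [X, g]^2, so each doubling of the exponent
  doubles the bound.\<close>

lemma zpow_Z_power_comm:
  assumes "g \<in> \<Gamma>"
  shows "comm (zpow \<zeta> (2 ^ v * j)) g \<in> Fil m 1 (2 ^ v)"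
proof (induction v)
  case 0
  show ?case using Fil_top[of 1 1 m] assms by (simp add: comm_Der)
next
  case (Suc v)
  define X where "X = zpow \<zeta> (2 ^ v * j)"
  define y where "y = comm X g"
  have y: "y \<in> Fil m 1 (2 ^ v)" using Suc by (simp add: X_def y_def)
  have "comm y X \<in> Fil m 1 (2 ^ v + 2 ^ v)"
    using comm_zpow_Z_power[of 1 0 "2 ^ v" y v j] y by (simp add: X_def)
  moreover have "y + y \<in> Fil m 1 (2 ^ v + 2 ^ v)"
    using Fil_double[OF _ _ y] by simp
  moreover have "X \<in> \<Gamma>" by (simp add: X_def)
  ultimately have "cjg (- y) (comm y X) + (y + y) \<in> Fil m 1 (2 ^ v + 2 ^ v)"
    using y by (intro nsg_add[OF nsg_Fil, where y = "y + y"] nsg_cjg nsg_Fil) auto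
  moreover have "zpow \<zeta> (2 ^ Suc v * j) = X + X"
    by (simp only: X_def zpow_2_power)
  then have "comm (zpow \<zeta> (2 ^ Suc v * j)) g = cjg (- y) (comm y X) + (y + y)"
    by (simp only: y_def comm_word)
  ultimately show ?case by simp
qed

lemma zpow_Z_comm:
  assumes "0 \<le> s" "s \<le> 1" "k \<in> exps (1 - s) r" "g \<in> \<Gamma>"
  shows "comm (zpow \<zeta> k) g \<in> Fil m (1 + s) r"
  using assms(3)
proof (cases rule: exps_cases)
  case 1
  then show ?thesis using assms nsg_zero[OF nsg_Fil] by simp
next
  case (2 v j)
  \<comment> \<open>The factor 1 - s carries the weight 2 - 1 of the source to the weight 2 - (1 +
    s) of the target.\<close>
  have "Fil m 1 (2 ^ v) \<subseteq> Fil m (1 + s) r"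
    using assms 2 by (intro Fil_le[of "1 - s"]) (auto simp: algebra_simps)
  then show ?thesis
    using zpow_Z_power_comm[OF assms(4), of v j] 2 by auto
qed

text \<open>\<open>nform_set_nsg\<close> requires commutators of the right sections to have shift (1
  + s)/2. \<open>Fil_comm\<close> supplies 1 + s/4, which is enough exactly when s <= 2.\<close>

lemma Fil_Suc_normal:
  assumes s: "0 \<le> s" "s \<le> 2"
  shows "nsg (Fil (Suc m) s r)"
  unfolding Fil.simps
proof (rule nform_set_nsg)
  show "Fil m ((1 + s) / 2) (r / 2) \<subseteq> Fil m (s / 2) (r / 2)"
    by (rule Fil_le1) auto
  show "comm h g \<in> Fil m ((1 + s) / 2) (r / 2)" if "h \<in> Fil m (s / 2) (r / 2)" "g \<in> \<Gamma>" for h g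
    using Fil_comm[OF _ _ that] Fil_le1[of "(1 + s) / 2" "1 + s / 2 / 2" "r / 2" "r / 2" m] s by auto
  show "comm (zpow \<zeta> k) g \<in> Fil m ((1 + s) / 2) (r / 2)" if "k \<in> exps (2 - s) r" "g \<in> \<Gamma>" for k g
    using zpow_Z_comm[of "s / 2" k "r / 2" g] that s exps_half[of "2 - s" r]
      Fil_le1[of "(1 + s) / 2" "1 + s / 2" "r / 2" "r / 2" m] by (auto simp: diff_divide_distrib)
qed (use s in \<open>auto intro!: sgrp_exps nsg_Fil Fil_Der\<close>)

lemma Fil_Suc_rules:
  assumes s: "0 \<le> s" "s \<le> 2"
  shows Fil_Suc_zpow: "k \<in> exps (2 - s) r \<Longrightarrow> zpow \<gamma> k \<in> Fil (Suc m) s r"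
    and Fil_Suc_pair: "a - b \<in> Fil m ((1 + s) / 2) (r / 2) \<Longrightarrow> b \<in> Fil m (s / 2) (r / 2) \<Longrightarrow>
          pair a b \<in> Fil (Suc m) s r"
    and Fil_Suc_left: "a \<in> Fil m ((1 + s) / 2) (r / 2) \<Longrightarrow> pair a 0 \<in> Fil (Suc m) s r"
    and Fil_Suc_both: "w \<in> Fil m ((1 + s) / 2) (r / 2) \<Longrightarrow> w' \<in> Fil m ((1 + s) / 2) (r / 2) \<Longrightarrow>
          pair w w' \<in> Fil (Suc m) s r"
proof -
  have z: "0 \<in> Fil m ((1 + s) / 2) (r / 2)" "0 \<in> Fil m (s / 2) (r / 2)"
    using s by (auto intro!: nsg_zero nsg_Fil)
  then show "k \<in> exps (2 - s) r \<Longrightarrow> zpow \<gamma> k \<in> Fil (Suc m) s r"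
    using liftI[of k "exps (2 - s) r" 0 0] by simp
  show *: "pair a b \<in> Fil (Suc m) s r"
    if "a - b \<in> Fil m ((1 + s) / 2) (r / 2)" "b \<in> Fil m (s / 2) (r / 2)" for a b
    using that by (simp add: pair_nform_set)
  show "a \<in> Fil m ((1 + s) / 2) (r / 2) \<Longrightarrow> pair a 0 \<in> Fil (Suc m) s r"
    using *[of a 0] z by simp
  assume "w \<in> Fil m ((1 + s) / 2) (r / 2)" "w' \<in> Fil m ((1 + s) / 2) (r / 2)"
  then show "pair w w' \<in> Fil (Suc m) s r"
    using Fil_le1[of "s / 2" "(1 + s) / 2" "r / 2" "r / 2" m] s by (intro * nsg_diff nsg_Fil) auto
qed

lemma Fil_Suc_comm:
  assumes s: "0 \<le> s" "s \<le> 1" and x: "x \<in> Fil (Suc m) s r" and g: "g \<in> \<Gamma>"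
  shows "comm x g \<in> Fil (Suc m) (1 + s / 2) r"
proof -
  let ?R = "Fil (Suc m) (1 + s / 2) r"
  have R: "nsg ?R" using s by (intro Fil_Suc_normal) auto
  have half: "(1 + (1 + s / 2)) / 2 = 1 + s / 4" "(1 + s / 2) / 2 = 1 / 2 + s / 4"
    by (simp_all add: field_simps)
  note rules = Fil_Suc_rules[of "1 + s / 2", unfolded half]
  obtain k a h where x: "x = zpow \<gamma> k + pair a 0 + pair h h" "k \<in> exps (2 - s) r"
    and a: "a \<in> Fil m ((1 + s) / 2) (r / 2)" and h: "h \<in> Fil m (s / 2) (r / 2)"
    using Fil_Suc_cases[OF x] by blast
  have k: "k \<in> exps (1 - s / 2) (r / 2)"
    using x(2) exps_half[of "2 - s" r] by (simp add: diff_divide_distrib)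
  \<comment> \<open>The origin of the shift 1 + s/2: its weight 1 - s/2 is half of 2 - s, the loss
    that one doubling of the exponent compensates.\<close>
  have "- (2 * k) \<in> exps (1 - s / 2) r"
    using exps_double[OF x(2)] s by (intro sgrp_minus[OF sgrp_exps]) (auto simp: diff_divide_distrib)
  then have "zpow \<gamma> (- 2 * k) \<in> ?R"
    using s by (intro rules(1)) auto
  moreover have "comm (zpow \<zeta> k) g \<in> Fil m (1 + s / 4) (r / 2)" if "g \<in> \<Gamma>" for g
    using zpow_Z_comm[OF _ _ k that] Fil_le1[of "1 + s / 4" "1 + s / 2" "r / 2" "r / 2" m] s by auto
  ultimately have 1: "comm (zpow \<gamma> k) \<tau> \<in> ?R" "comm (zpow \<gamma> k) \<mu> \<in> ?R"
    using s unfolding zpow_C_comm_T zpow_C_comm_U by (auto intro!: nsg_add[OF R] rules(3) simp del: Fil.simps)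
  \<comment> \<open>The commutator is the pair (a^-1, a), so the difference of its sections is a^-2;
    doubling \<open>r\<close> and then \<open>Fil_half\<close> buy the required shift.\<close>
  have "- a \<in> Fil m ((1 + s) / 2) (r / 2)"
    using a s by (intro nsg_minus nsg_Fil) auto
  then have "- a + - a \<in> Fil m ((1 + s) / 2) (2 * (r / 2))"
    using s by (intro Fil_double) auto
  then have "- a - a \<in> Fil m (1 + s / 4) (r / 2)"
    using Fil_half[of "1 + s / 4" "(1 + s) / 2" "r / 2" r m] s by auto
  moreover have "a \<in> Fil m (1 / 2 + s / 4) (r / 2)"
    using a Fil_le1[of "1 / 2 + s / 4" "(1 + s) / 2" "r / 2" "r / 2" m] s by auto
  ultimately have 2: "comm (pair a 0) \<tau> \<in> ?R" "comm (pair a 0) \<mu> \<in> ?R"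
    using s unfolding pair_left_comm_T pair_left_comm_U by (auto intro!: rules(2) simp del: Fil.simps)
  have "comm h g \<in> Fil m (1 + s / 4) (r / 2)" if "g \<in> \<Gamma>" for g
    using Fil_comm[OF _ _ h that] s by simp
  then have 3: "comm (pair h h) \<tau> \<in> ?R" "comm (pair h h) \<mu> \<in> ?R"
    using s unfolding pair_diag_comm_T pair_diag_comm_U by (auto intro!: rules(3) simp del: Fil.simps)
  have G: "pair a 0 \<in> \<Gamma>" "pair h h \<in> \<Gamma>"
    using pair_Der[OF subsetD[OF Fil_Der a] nsg_zero[OF nsg_Der]]
      pair_Der[OF subsetD[OF Fil_Der h] subsetD[OF Fil_Der h]] by auto
  then show ?thesis
    using comm_gen_right[OF R _ _ g] unfolding x
    by (simp only: comm_add_closed[OF R comm_add_closed[OF R 1(1) 2(1) G(1)] 3(1) G(2)]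
        comm_add_closed[OF R comm_add_closed[OF R 1(2) 2(2) G(1)] 3(2) G(2)])
qed

lemma Fil_Suc_comm_Z:
  assumes s: "0 \<le> s" "s \<le> 1" and x: "x \<in> Fil (Suc m) s r"
  shows "comm x \<zeta> \<in> Fil (Suc m) (1 + s) r"
proof -
  let ?R = "Fil (Suc m) (1 + s) r"
  have R: "nsg ?R" using s by (intro Fil_Suc_normal) auto
  have half: "(1 + (1 + s)) / 2 = 1 + s / 2"
    by (simp add: field_simps)
  note rules = Fil_Suc_rules[of "1 + s", unfolded half]
  let ?N = "Fil m (1 + s / 2) (r / 2)"
  have NN: "nsg ?N" using s by (intro nsg_Fil) auto
  obtain k a h where x: "x = zpow \<gamma> k + pair a 0 + pair h h" "k \<in> exps (2 - s) r"
    and a: "a \<in> Fil m ((1 + s) / 2) (r / 2)" and h: "h \<in> Fil m (s / 2) (r / 2)"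
    using Fil_Suc_cases[OF x] by blast
  have k: "k \<in> exps (1 - s / 2) (r / 2)"
    using x(2) exps_half[of "2 - s" r] by (simp add: diff_divide_distrib)
  \<comment> \<open>As \<zeta> = (\<tau>, \<mu>^-1) preserves both subtrees, no power of c splits
    off.\<close>
  have "comm (zpow \<gamma> k) \<zeta> = pair (comm (zpow \<zeta> (- k)) \<tau>) (comm (zpow \<zeta> k) (- \<mu>))"
    by (simp add: zpow_C Z_eq comm_pair zpow_minus)
  moreover have "- k \<in> exps (1 - s / 2) (r / 2)"
    using k s by (intro sgrp_minus[OF sgrp_exps]) auto
  ultimately have 1: "comm (zpow \<gamma> k) \<zeta> \<in> ?R"
    using zpow_Z_comm[OF _ _ k] zpow_Z_comm[of "s / 2" "- k"] s
    by (auto intro!: rules(4) simp del: Fil.simps)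
  have "comm a \<tau> \<in> ?N"
    using Fil_comm[OF _ _ a TU_Gam(1)] Fil_le1[of "1 + s / 2" "1 + (1 + s) / 2 / 2" "r / 2" "r / 2" m] s
    by auto
  moreover have "comm (pair a 0) \<zeta> = pair (comm a \<tau>) 0"
    by (simp add: Z_eq comm_pair)
  ultimately have 2: "comm (pair a 0) \<zeta> \<in> ?R"
    using s by (auto intro!: rules(3) simp del: Fil.simps)
  \<comment> \<open>For the diagonal factor the difference of the sections is [h, \<tau>] -
    [h, \<mu>^-1]. Up to commutators of \<open>w\<close> this is [h, \<zeta>], to which the sharper
    bound at depth \<open>m\<close> applies.\<close>
  define w where "w = comm h \<mu>"
  have w: "w \<in> Fil m (1 + s / 4) (r / 2)"
    using Fil_comm[OF _ _ h TU_Gam(2)] s by (simp add: w_def)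
  then have w1: "w \<in> Fil m 1 (r / 2)"
    using Fil_le1[of 1 "1 + s / 4" "r / 2" "r / 2" m] s by auto
  have cw: "comm w g \<in> ?N" if "g \<in> \<Gamma>" for g
    using Fil_comm[OF _ _ w1 that] Fil_le1[of "1 + s / 2" "1 + 1 / 2" "r / 2" "r / 2" m] s by auto
  have "comm h \<zeta> \<in> ?N"
    using Fil_comm_Z[OF _ _ h] s by simp
  moreover have "comm h \<tau> - comm h (- \<mu>) = comm h \<zeta> + (- comm w \<tau> + comm w (- \<mu>))"
    by (simp only: w_def \<zeta>_def comm_word)
  ultimately have "comm h \<tau> - comm h (- \<mu>) \<in> ?N"
    using cw by (simp only:) (intro nsg_add[OF NN] nsg_minus[OF NN]; simp)
  moreover have "comm h (- \<mu>) \<in> Fil m ((1 + s) / 2) (r / 2)"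
    using Fil_comm[OF _ _ h, of "- \<mu>"] Fil_le1[of "(1 + s) / 2" "1 + s / 2 / 2" "r / 2" "r / 2" m] s
    by auto
  moreover have "comm (pair h h) \<zeta> = pair (comm h \<tau>) (comm h (- \<mu>))"
    by (simp add: Z_eq comm_pair)
  ultimately have 3: "comm (pair h h) \<zeta> \<in> ?R"
    using s by (auto intro!: rules(2) simp del: Fil.simps)
  have G: "pair a 0 \<in> \<Gamma>" "pair h h \<in> \<Gamma>"
    using pair_Der[OF subsetD[OF Fil_Der a] nsg_zero[OF nsg_Der]]
      pair_Der[OF subsetD[OF Fil_Der h] subsetD[OF Fil_Der h]] by auto
  show ?thesis
    unfolding x by (rule comm_add_closed[OF R comm_add_closed[OF R 1 2 G(1)] 3 G(2)])
qed

lemma Fil_Suc_double: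
  assumes s: "0 \<le> s" "s \<le> 1" and x: "x \<in> Fil (Suc m) s r"
  shows "x + x \<in> Fil (Suc m) s (2 * r)"
proof (cases "0 \<le> r")
  \<comment> \<open>For negative \<open>r\<close> the target is all of \<Gamma>'; the estimate
    \<open>comm_zpow_Z\<close> below requires \<open>0 \<le> r\<close>.\<close>
  case False
  then show ?thesis
    using Fil_top[of "2 * r" s "Suc m"] subsetD[OF Fil_Der x] s by (simp add: nsg_add[OF nsg_Der])
next
  case r: True
  obtain k g h where x: "x = zpow \<gamma> k + pair g 0 + pair h h" "k \<in> exps (2 - s) r"
    and g: "g \<in> Fil m ((1 + s) / 2) (r / 2)" and h: "h \<in> Fil m (s / 2) (r / 2)"
    using Fil_Suc_cases[OF x] by blast
  let ?N = "Fil m ((1 + s) / 2) r" and ?M = "Fil m (s / 2) r"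
  have N: "nsg ?N" and M: "nsg ?M" using s by (auto intro!: nsg_Fil)
  define X where "X = zpow \<zeta> k"
  have [simp]: "X \<in> \<Gamma>" "g \<in> \<Gamma>" "h \<in> \<Gamma>" using g h by (auto simp: X_def)
  have "k \<in> exps (1 - s / 2) (r / 2)"
    using x(2) exps_half[of "2 - s" r] by (simp add: diff_divide_distrib)
  moreover have "exps (1 - s / 2) (r / 2) \<subseteq> exps (1 - 0) (r / 2)"
  proof (rule exps_mono)
    fix y :: real assume "1 \<le> y" "r / 2 \<le> y * (1 - s / 2)"
    moreover have "y * (1 - s / 2) \<le> y * (1 - 0)"
      using s \<open>1 \<le> y\<close> by (intro mult_left_mono) auto
    ultimately show "r / 2 \<le> y * (1 - 0)" by linarith
  qed
  ultimately have k: "k \<in> exps (1 - 0) (r / 2)" by blast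
  have k2: "2 * k \<in> exps (1 - 1 / 2) (r / 2)"
    using exps_double[OF k] by simp
  define p where "p = cjg (- X) (g + h) + (g + h)"
  define q where "q = cjg X h + h"
  have xx: "x + x = zpow \<gamma> (2 * k) + pair p q"
  proof -
    have "x = zpow \<gamma> k + pair (g + h) h"
      by (simp add: x pair_add add.assoc)
    then have "x + x = zpow \<gamma> k + zpow \<gamma> k + (cjg (zpow \<gamma> k) (pair (g + h) h) + pair (g + h) h)"
      by (simp only: comm_word)
    also have "zpow \<gamma> k + zpow \<gamma> k = zpow \<gamma> (2 * k)"
      by (simp flip: zpow_add)
    finally show ?thesis
      by (simp only: zpow_C[of k] cjg_pair pair_add p_def q_def X_def)
  qed
  have hh: "h + h \<in> ?M"
    using Fil_double[OF _ _ h] s by simp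
  have hX: "comm h X \<in> ?M"
    using comm_zpow_Z[OF _ _ _ _ h k] s r by (simp add: X_def)
  have "q = cjg (- h) (comm h X) + (h + h)"
    by (simp only: q_def comm_word)
  then have q: "q \<in> ?M"
    using hh hX by (simp add: nsg_add[OF M] nsg_cjg[OF M])
  have gg: "g + g \<in> ?N"
    using Fil_double[OF _ _ g] s by simp
  have "- k \<in> exps (1 - 0) (r / 2)"
    using k by (intro sgrp_minus[OF sgrp_exps]) auto
  then have gX: "comm g (- X) \<in> ?N"
    using comm_zpow_Z[OF _ _ _ _ g, of 0 "- k" "r / 2"] s r by (simp add: X_def zpow_minus)
  define e where "e = cjg (- X) h"
  have "e \<in> Fil m (s / 2) (r / 2)"
    unfolding e_def using h s by (intro nsg_cjg nsg_Fil) auto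
  then have "- e \<in> Fil m 0 (r / 2)"
    using Fil_le1[of 0 "s / 2" "r / 2" "r / 2" m] s by (intro nsg_minus nsg_Fil) auto
  then have ge: "comm g (- e) \<in> ?N"
    using Fil_comm_Fil[OF _ _ _ _ _ g, of 0 "r / 2" "- e"] s r by simp
  \<comment> \<open>The two sections conjugate \<open>h\<close> by X^-1 and by X. The discrepancy
    comes from a commutator with X^2, and its exponent 2k buys the shift 1/2 that separates
    \<open>?N\<close> from \<open>?M\<close>.\<close>
  have "comm h (X + X) \<in> ?N"
    using comm_zpow_Z[OF _ _ _ _ h k2] s r zpow_add[of \<zeta> k k]
    by (simp add: X_def add_divide_distrib add.commute[of "1 / 2"])
  then have hXX: "- cjg (- X) (cjg (- h) (comm h (X + X))) \<in> ?N"
    by (intro nsg_minus[OF N] nsg_cjg[OF N]) auto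
  have "p - q = cjg (- g) (comm g (- X)) + (g + g) + comm g (- e)
      + - cjg (- X) (cjg (- h) (comm h (X + X)))"
    by (simp only: p_def q_def e_def comm_word)
  then have "p - q \<in> ?N"
    using gX gg ge hXX
    by (simp add: nsg_add[OF N] nsg_cjg[OF N] del: add_uminus_conv_diff)
  moreover have "2 * k \<in> exps (2 - s) (2 * r)"
    using exps_double[OF x(2)] exps_half[of "2 - s" "2 * r"] by simp
  ultimately show ?thesis
    using q s unfolding xx by (auto intro!: liftI)
qed

text \<open>The sections of the commutator must agree modulo \<open>N\<close>. There
  \<open>g\<close> and \<open>g'\<close> drop out, and what remains of the left section differs from
  the right one by inverting the powers \<open>X\<close>, \<open>Y\<close> of \<zeta>. As [X, Y] =
  1, only [X, h'] and [h, Y] are affected; they lie in \<open>M\<close>, on which \<Gamma> acts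
  trivially and inversion is invisible modulo \<open>N\<close>.\<close>

lemma Fil_Suc_comm_Fil:
  assumes s: "0 \<le> s" "0 \<le> s'" "s + s' \<le> 1" and r: "0 \<le> r" "0 \<le> r'"
    and x: "x \<in> Fil (Suc m) s r" and y: "y \<in> Fil (Suc m) s' r'"
  shows "comm x y \<in> Fil (Suc m) (s + s') (r + r')"
proof -
  define N where "N = Fil m ((1 + (s + s')) / 2) ((r + r') / 2)"
  define M where "M = Fil m ((s + s') / 2) ((r + r') / 2)"
  have N: "nsg N" and M: "nsg M"
    unfolding N_def M_def using s by (auto intro!: nsg_Fil)
  obtain k g h where x: "x = zpow \<gamma> k + pair g 0 + pair h h" and k: "k \<in> exps (2 - s) r"
    and g: "g \<in> Fil m ((1 + s) / 2) (r / 2)" and h: "h \<in> Fil m (s / 2) (r / 2)"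
    using Fil_Suc_cases[OF x] by blast
  obtain k' g' h' where y: "y = zpow \<gamma> k' + pair g' 0 + pair h' h'" and k': "k' \<in> exps (2 - s') r'"
    and g': "g' \<in> Fil m ((1 + s') / 2) (r' / 2)" and h': "h' \<in> Fil m (s' / 2) (r' / 2)"
    using Fil_Suc_cases[OF y] by blast
  have kk: "k \<in> exps (1 - s / 2) (r / 2)" "- k \<in> exps (1 - s / 2) (r / 2)"
    "k' \<in> exps (1 - s' / 2) (r' / 2)" "- k' \<in> exps (1 - s' / 2) (r' / 2)"
    using k k' exps_half[of "2 - s" r] exps_half[of "2 - s'" r'] s
    by (auto simp: diff_divide_distrib intro!: sgrp_minus[OF sgrp_exps])
  define X where "X = zpow \<zeta> k"
  define Y where "Y = zpow \<zeta> k'"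
  have XY: "comm X Y = 0" "comm (- X) (- Y) = 0"
    by (simp_all add: X_def Y_def comm_zpow_zpow flip: zpow_minus)
  have G [simp]: "X \<in> \<Gamma>" "Y \<in> \<Gamma>" "g \<in> \<Gamma>" "h \<in> \<Gamma>" "g' \<in> \<Gamma>" "h' \<in> \<Gamma>"
    using g h g' h' by (auto simp: X_def Y_def)
  have sums: "(1 + s) / 2 + s' / 2 = (1 + (s + s')) / 2" "(1 + s') / 2 + s / 2 = (1 + (s + s')) / 2"
    "s / 2 + s' / 2 = (s + s') / 2" "s' / 2 + s / 2 = (s + s') / 2"
    "r / 2 + r' / 2 = (r + r') / 2" "r' / 2 + r / 2 = (r + r') / 2"
    by (simp_all add: field_simps)
  have uN: "comm u w \<in> N"
    if u: "u \<in> Fil m ((1 + s) / 2) (r / 2)" and "w \<in> {Y, - Y} \<union> Fil m (s' / 2) (r' / 2)" for u w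
    using that(2) comm_zpow_Z[OF _ _ _ _ u kk(3)] comm_zpow_Z[OF _ _ _ _ u kk(4)]
      Fil_comm_Fil[OF _ _ _ _ _ u, of "s' / 2" "r' / 2" w] s r
    unfolding sums by (auto simp: N_def Y_def zpow_minus)
  have uN': "comm u w \<in> N"
    if u: "u \<in> Fil m ((1 + s') / 2) (r' / 2)" and "w \<in> {X, - X} \<union> Fil m (s / 2) (r / 2)" for u w
    using that(2) comm_zpow_Z[OF _ _ _ _ u kk(1)] comm_zpow_Z[OF _ _ _ _ u kk(2)]
      Fil_comm_Fil[OF _ _ _ _ _ u, of "s / 2" "r / 2" w] s r
    unfolding sums by (auto simp: N_def X_def zpow_minus)
  have hh: "comm h h' \<in> M"
    using Fil_comm_Fil[OF _ _ _ _ _ h h'] s r by (simp add: M_def sums)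
  have hY: "comm h Y \<in> M"
    using comm_zpow_Z[OF _ _ _ _ h kk(3)] s r by (simp add: M_def Y_def sums)
  have hX: "comm X h' \<in> M"
    using nsg_minus[OF M, of "comm h' X"] comm_zpow_Z[OF _ _ _ _ h' kk(1)] s r
    by (simp add: M_def X_def sums comm_swap[of "zpow \<zeta> k" h'])
  have MG: "eqm N (cjg \<delta> w) w" if "w \<in> M" "\<delta> \<in> \<Gamma>" for w \<delta>
  proof -
    have "comm w \<delta> \<in> Fil m (1 + (s + s') / 2 / 2) ((r + r') / 2)"
      using that s by (intro Fil_comm) (auto simp: M_def)
    also have "\<dots> \<subseteq> N"
      unfolding N_def using s by (intro Fil_le1) (simp_all add: field_simps)
    finally show ?thesis
      using that nsg_Gam[OF M] by (intro eqm_cjg[OF N]) auto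
  qed
  \<comment> \<open>Doubling \<open>w\<close> doubles the degree bound; giving this back through
    \<open>Fil_half\<close> raises the shift enough to reach \<open>N\<close>.\<close>
  have MM: "eqm N (- w) w" if "w \<in> M" for w
  proof -
    have "w + w \<in> Fil m ((s + s') / 2) (2 * ((r + r') / 2))"
      using that s by (intro Fil_double) (auto simp: M_def)
    also have "\<dots> \<subseteq> N"
      unfolding N_def using s by (intro Fil_half) (simp_all add: field_simps)
    finally have "w + w \<in> N" .
    moreover have "- w - w = - (w + w)" by (simp only: group_word)
    ultimately show ?thesis by (simp add: eqm_def nsg_minus[OF N] del: minus_add_distrib)
  qed
  define A where "A = cjg X g + (- X + h)"
  define A' where "A' = cjg Y g' + (- Y + h')"
  have xP: "x = pair A (X + h)" and yP: "y = pair A' (Y + h')"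
    by (simp_all only: x y A_def A'_def X_def Y_def zpow_C pair_add comm_word)
  have u: "cjg X g \<in> Fil m ((1 + s) / 2) (r / 2)" "cjg Y g' \<in> Fil m ((1 + s') / 2) (r' / 2)"
    using g g' s by (auto intro!: nsg_cjg nsg_Fil)
  have [simp]: "cjg X g \<in> \<Gamma>" "cjg Y g' \<in> \<Gamma>" "A \<in> \<Gamma>" "A' \<in> \<Gamma>"
    unfolding A_def A'_def by (intro Gam_rules G)+
  have u'_Fil: "cjg Y g' \<in> Fil m (s' / 2) (r' / 2)"
    using u(2) Fil_le1[of "s' / 2" "(1 + s') / 2" "r' / 2" "r' / 2" m] s by auto
  note eqm_trans[OF N, trans]
  have "comm (cjg X g) (- Y) \<in> N" "comm (cjg X g) h' \<in> N" "comm (cjg X g) (cjg Y g') \<in> N"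
    using uN[OF u(1)] u'_Fil h' by blast+
  then have "comm (cjg X g) A' \<in> N"
    unfolding A'_def comm_add_right by (intro nsg_add[OF N] nsg_cjg[OF N]) simp_all
  then have "eqm N (comm A A') (comm (- X + h) A')"
    unfolding A_def comm_add_left[of "cjg X g"]
    using eqm_add_right[of N "cjg (- X + h) (comm (cjg X g) A')" 0]
    by (simp add: eqm_zero nsg_cjg[OF N] del: add_uminus_conv_diff)
  also have "eqm N \<dots> (comm (- X + h) (- Y + h'))"
  proof -
    have "comm (- X) (cjg Y g') \<in> N" "comm h (cjg Y g') \<in> N"
      using uN'[OF u(2)] h nsg_minus[OF N]
      by (auto simp: comm_swap[of "- X"] comm_swap[of h])
    then have "comm (- X + h) (cjg Y g') \<in> N"
      unfolding comm_add_left by (intro nsg_add[OF N] nsg_cjg[OF N]) auto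
    then have "eqm N (cjg (- Y + h') (comm (- X + h) (cjg Y g'))) 0"
      by (auto simp: eqm_zero intro!: nsg_cjg[OF N])
    from eqm_add_left[OF N this, of "comm (- X + h) (- Y + h')"] show ?thesis
      unfolding A'_def comm_add_right[of _ "cjg Y g'"] by simp
  qed
  also have "eqm N \<dots> (comm (X + h) (Y + h'))"
  proof -
    have *: "comm (\<sigma> + h) (\<eta> + h') = cjg h (comm \<sigma> h') + comm h h' + cjg h' (comm h \<eta>)"
      if "comm \<sigma> \<eta> = 0" for \<sigma> \<eta>
      unfolding comm_add_left comm_add_right that by (simp add: add.assoc)
    have X: "eqm N (comm (- X) h') (comm X h')"
      unfolding comm_minus_left
      using hX by (intro eqm_trans[OF N eqm_minus[OF N MG] MM]) auto
    have Y: "eqm N (comm h (- Y)) (comm h Y)"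
      unfolding comm_minus_right
      using hY by (intro eqm_trans[OF N eqm_minus[OF N MG] MM]) auto
    have c: "eqm N (cjg \<delta> a) (cjg \<delta> b)" if "eqm N a b" "\<delta> \<in> \<Gamma>" for a b \<delta>
      using that by (simp add: eqm_def nsg_cjg[OF N] flip: cjg_diff)
    show ?thesis
      unfolding *[OF XY(1)] *[OF XY(2)]
      by (intro eqm_add[OF N] eqm_refl[OF N] c X Y) auto
  qed
  finally have AB: "comm A A' - comm (X + h) (Y + h') \<in> N"
    using N by (simp add: eqm_def)
  have "comm (X + h) (Y + h') \<in> M"
    unfolding comm_add_left comm_add_right XY using hh hX hY
    by (auto intro!: nsg_add[OF M] nsg_cjg[OF M])
  then show ?thesis
    using AB s unfolding xP yP comm_pair N_def M_def by (intro Fil_Suc_pair) auto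
qed

lemma Fil_level_Suc: "Fil_level (Suc m)"
  by unfold_locales
    (simp_all only: Fil_Suc_normal Fil_Suc_comm Fil_Suc_comm_Z Fil_Suc_double Fil_Suc_comm_Fil)

end

lemma Fil_level: "Fil_level m"
proof (induction m)
  case 0
  show ?case
    by unfold_locales (auto simp: nsg_Der comm_Der nsg_add[OF nsg_Der])
qed (rule Fil_level.Fil_level_Suc)

interpretation FL: Fil_level m for m
  by (rule Fil_level)

section \<open>Powers of the generators and the candidate series\<close>

lemma Fil_0_mem: "0 \<le> s \<Longrightarrow> s \<le> 2 \<Longrightarrow> 0 \<in> Fil m s r"
  by (rule nsg_zero[OF FL.nsg_Fil])

text \<open>Even powers of \<tau> and \<mu> are diagonal pairs (h, h) with, up to sign, half the
  exponent, and their commutators with generators have a single nontrivial section, the left one.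
  The shift 1 is the fixed point of x -> (1 + x)/2, so only the degree bound is halved on passing to
  that section.\<close>

lemma TU_power_comm:
  assumes "X \<in> {\<tau>, \<mu>}" "g \<in> \<Gamma>"
  shows "comm (zpow X (2 ^ v * j)) g \<in> Fil m 1 (2 ^ v)"
  using assms(2)
proof (induction v arbitrary: m j g)
  case 0
  have "zpow X (2 ^ 0 * j) \<in> \<Gamma>" using assms(1) by (intro Gam_rules) auto
  from comm_Der[OF this 0] show ?case using Fil_top[of 1 1 m] by simp
next
  case (Suc v)
  show ?case
  proof (cases m)
    case 0
    then show ?thesis using Suc.prems assms(1) by (auto simp: comm_Der)
  next
    case m: (Suc m')
    have "\<exists>i. zpow X (2 ^ Suc v * j) = pair (zpow X (2 ^ v * i)) (zpow X (2 ^ v * i))"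
    proof -
      have "zpow \<tau> (2 ^ Suc v * j) = pair (zpow \<tau> (2 ^ v * j)) (zpow \<tau> (2 ^ v * j))"
        using zpow_T_double[of "2 ^ v * j"] by (simp only: power_Suc mult.assoc)
      moreover have "zpow \<mu> (2 ^ Suc v * j) = pair (zpow \<mu> (2 ^ v * - j)) (zpow \<mu> (2 ^ v * - j))"
        using zpow_U_double[of "2 ^ v * j"] by (simp only: power_Suc mult.assoc mult_minus_right)
      ultimately show ?thesis using assms(1) by blast
    qed
    then obtain h i where h: "zpow X (2 ^ Suc v * j) = pair h h" "h = zpow X (2 ^ v * i)"
      by blast
    have IH: "comm h g \<in> Fil m' 1 (2 ^ v)" if "g \<in> \<Gamma>" for g
      unfolding h(2) by (rule Suc.IH[OF that])
    have "pair (comm h g) 0 \<in> Fil (Suc m') 1 (2 ^ Suc v)" if "g \<in> \<Gamma>" for g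
      using IH[OF that] by (intro FL.Fil_Suc_left) auto
    then show ?thesis
      unfolding h(1) m
      by (intro comm_gen_right[OF FL.nsg_Fil _ _ Suc.prems]) (auto simp: pair_diag_comm_T pair_diag_comm_U simp del: Fil.simps)
  qed
qed

lemma TU_exps_comm:
  assumes "X \<in> {\<tau>, \<mu>}" "k \<in> exps 1 r" "g \<in> \<Gamma>"
  shows "comm (zpow X k) g \<in> Fil m 1 r"
  using assms(2)
proof (cases rule: exps_cases)
  case (2 v j)
  then show ?thesis using TU_power_comm[OF assms(1,3), of v j m] Fil_le1[of 1 1 r "2 ^ v" m] by auto
qed (simp add: Fil_0_mem)

text \<open>Any X in \<Gamma> counts as an element of degree at least 1: the shift 1 in the
  hypothesis pays for the first commutator, and each squaring of X doubles the gain.\<close>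

lemma comm_power:
  assumes "X \<in> \<Gamma>" "0 \<le> \<rho>" "\<And>g. g \<in> \<Gamma> \<Longrightarrow> comm y g \<in> Fil m 1 \<rho>"
  shows "comm y (zpow X (2 ^ w * j)) \<in> Fil m 0 (\<rho> + 2 ^ w)"
  using assms(2,3)
proof (induction w arbitrary: y \<rho>)
  case 0
  then show ?case using Fil_shift[of 1 m 0 \<rho>] assms(1) by auto
next
  case (Suc w)
  define Y where "Y = zpow X (2 ^ w * j)"
  define y1 where "y1 = comm y Y"
  have y1: "y1 \<in> Fil m 0 (\<rho> + 2 ^ w)"
    unfolding y1_def Y_def by (rule Suc.IH) (use Suc.prems in auto)
  then have "comm y1 g \<in> Fil m 1 (\<rho> + 2 ^ w)" if "g \<in> \<Gamma>" for g
    using FL.Fil_comm[OF _ _ y1 that] by simp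
  then have "comm y1 Y \<in> Fil m 0 (\<rho> + 2 ^ w + 2 ^ w)"
    unfolding Y_def using Suc.prems by (intro Suc.IH) auto
  moreover have "y1 + y1 \<in> Fil m 0 (\<rho> + 2 ^ w + 2 ^ w)"
    using FL.Fil_double[OF _ _ y1] Fil_le1[of 0 0 "\<rho> + 2 ^ w + 2 ^ w" "2 * (\<rho> + 2 ^ w)" m] Suc.prems(1)
    by auto
  ultimately have "y1 + y1 + comm y1 Y \<in> Fil m 0 (\<rho> + 2 ^ w + 2 ^ w)"
    by (intro nsg_add[OF FL.nsg_Fil, where x = "y1 + y1"]) auto
  moreover have "zpow X (2 ^ Suc w * j) = Y + Y"
    by (simp only: Y_def zpow_2_power)
  then have "comm y (zpow X (2 ^ Suc w * j)) = y1 + y1 + comm y1 Y"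
    by (simp only: y1_def comm_word)
  ultimately show ?case by (simp add: algebra_simps)
qed

lemma comm_exps:
  assumes "X \<in> \<Gamma>" "0 \<le> \<rho>" "\<And>g. g \<in> \<Gamma> \<Longrightarrow> comm y g \<in> Fil m 1 \<rho>" "k \<in> exps 1 r"
  shows "comm y (zpow X k) \<in> Fil m 0 (\<rho> + r)"
  using assms(4)
proof (cases rule: exps_cases)
  case (2 v j)
  then show ?thesis
    using comm_power[OF assms(1-3), of v j] Fil_le1[of 0 0 "\<rho> + r" "\<rho> + 2 ^ v" m] by auto
qed (simp add: Fil_0_mem)

text \<open>The intended value of the dimension series, up to the kernel of a section of large depth \<open>m\<close>.\<close>

definition Ser :: "nat \<Rightarrow> real \<Rightarrow> wperm set" where
  "Ser m r = {zpow \<tau> a + zpow \<mu> b + g | a b g. a \<in> exps 1 r \<and> b \<in> exps 1 r \<and> g \<in> Fil m 0 r}"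

lemma Ser_cases:
  assumes "x \<in> Ser m r"
  obtains a b g where "x = zpow \<tau> a + zpow \<mu> b + g" "a \<in> exps 1 r" "b \<in> exps 1 r" "g \<in> Fil m 0 r"
  using assms by (auto simp: Ser_def)

lemma Ser_I: "a \<in> exps 1 r \<Longrightarrow> b \<in> exps 1 r \<Longrightarrow> g \<in> Fil m 0 r \<Longrightarrow> zpow \<tau> a + zpow \<mu> b + g \<in> Ser m r"
  by (auto simp: Ser_def)

lemma exps_add: "0 \<le> w \<Longrightarrow> j \<in> exps w r \<Longrightarrow> k \<in> exps w r \<Longrightarrow> j + k \<in> exps w r"
  and exps_minus: "0 \<le> w \<Longrightarrow> k \<in> exps w r \<Longrightarrow> - k \<in> exps w r"
  using sgrp_add[OF sgrp_exps] sgrp_minus[OF sgrp_exps] by auto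

lemma F1_F0: "Fil m 1 r \<subseteq> Fil m 0 r"
  by (rule Fil_le1) auto

lemma Ser_Gam: "x \<in> Ser m r \<Longrightarrow> x \<in> \<Gamma>"
  by (auto elim!: Ser_cases)

lemma Fil_Ser: "g \<in> Fil m 0 r \<Longrightarrow> g \<in> Ser m r"
  using Ser_I[of 0 r 0 g m] by simp

lemma Ser_add_Fil: "x \<in> Ser m r \<Longrightarrow> g \<in> Fil m 0 r \<Longrightarrow> x + g \<in> Ser m r"
  by (erule Ser_cases) (auto simp: add.assoc intro!: Ser_I[unfolded add.assoc] nsg_add[OF FL.nsg_Fil])

lemma Ser_cm1:
  assumes "x \<in> Ser m r" "g \<in> \<Gamma>" shows "comm x g \<in> Fil m 1 r"
  using assms(1)
proof (cases rule: Ser_cases)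
  case (1 a b h)
  have "comm h g \<in> Fil m 1 r" using FL.Fil_comm[OF _ _ 1(4) assms(2)] by simp
  then show ?thesis
    unfolding 1(1) using 1 assms(2)
    by (intro comm_add_closed[OF FL.nsg_Fil] TU_exps_comm) auto
qed

text \<open>Expanding \<open>y\<close> leaves powers of generators, handled by
  \<open>comm_exps\<close>, and [x, h] with \<open>h\<close> in \<Gamma>'. The latter is reversed,
  so that \<open>x\<close> can be expanded in turn.\<close>

lemma Ser_comm_Ser:
  assumes x: "x \<in> Ser m r" and y: "y \<in> Ser m r'" and r: "0 \<le> r" "0 \<le> r'"
  shows "comm x y \<in> Fil m 0 (r + r')"
proof -
  have N: "nsg (Fil m 0 (r + r'))" by (intro FL.nsg_Fil) auto
  obtain a b g where x': "x = zpow \<tau> a + zpow \<mu> b + g"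
    "a \<in> exps 1 r" "b \<in> exps 1 r" "g \<in> Fil m 0 r"
    using x by (rule Ser_cases)
  obtain a' b' h where y': "y = zpow \<tau> a' + zpow \<mu> b' + h"
    "a' \<in> exps 1 r'" "b' \<in> exps 1 r'" "h \<in> Fil m 0 r'"
    using y by (rule Ser_cases)
  have "comm h (zpow \<tau> a) \<in> Fil m 0 (r' + r)" "comm h (zpow \<mu> b) \<in> Fil m 0 (r' + r)"
    using comm_exps[OF _ r(2) Ser_cm1[OF Fil_Ser[OF y'(4)]]] x' by auto
  moreover have "comm h g \<in> Fil m 0 (r' + r)"
    using FL.Fil_comm_Fil[OF _ _ _ r(2,1) y'(4) x'(4)] by simp
  ultimately have "comm h x \<in> Fil m 0 (r + r')"
    unfolding x'(1) comm_add_right using x'(4) y'(4)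
    by (auto simp: add.commute[of r] intro!: nsg_add[OF FL.nsg_Fil] nsg_cjg[OF FL.nsg_Fil])
  then have "comm x h \<in> Fil m 0 (r + r')"
    unfolding comm_swap[of x h] by (rule nsg_minus[OF N])
  moreover have "comm x (zpow \<tau> a') \<in> Fil m 0 (r + r')" "comm x (zpow \<mu> b') \<in> Fil m 0 (r + r')"
    using comm_exps[OF _ r(1) Ser_cm1[OF x]] y' by auto
  ultimately show ?thesis
    unfolding y'(1) comm_add_right using y'(4) by (auto intro!: nsg_add[OF N] nsg_cjg[OF N])
qed

lemma nsg_Ser: "nsg (Ser m r)"
proof -
  have N: "nsg (Fil m 0 r)" by (intro FL.nsg_Fil) auto
  have cm0: "comm x g \<in> Fil m 0 r" if "x \<in> Ser m r" "g \<in> \<Gamma>" for x g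
    using Ser_cm1[OF that] F1_F0 by auto
  have TUE: "zpow \<tau> a \<in> Ser m r" "zpow \<mu> a \<in> Ser m r" if "a \<in> exps 1 r" for a
    using that Ser_I[of a r 0 0 m] Ser_I[of 0 r a 0 m] by (auto simp: Fil_0_mem)
  have add: "x + y \<in> Ser m r" if "x \<in> Ser m r" "y \<in> Ser m r" for x y
    using that(2)
  proof (cases rule: Ser_cases)
    case y: (1 a' b' g')
    show ?thesis using that(1)
    proof (cases rule: Ser_cases)
      case x: (1 a b g)
      have "x + y = zpow \<tau> (a + a') + zpow \<mu> (b + b') +
        (cjg (zpow \<mu> b') (comm (zpow \<mu> b) (zpow \<tau> a') + cjg (zpow \<tau> a') g) + g')"
        unfolding x y zpow_add by (simp only: comm_word)
      also have "\<dots> \<in> Ser m r"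
        using x y cm0[OF TUE(2)]
        by (intro Ser_I nsg_add[OF N] nsg_cjg[OF N] exps_add) auto
      finally show ?thesis .
    qed
  qed
  have minus: "- x \<in> Ser m r" if "x \<in> Ser m r" for x
    using that
  proof (cases rule: Ser_cases)
    case x: (1 a b g)
    have "zpow \<tau> (- a) + zpow \<mu> (- b) + comm (zpow \<mu> (- b)) (zpow \<tau> (- a)) \<in> Ser m r"
      using x cm0[OF TUE(2)] by (intro Ser_I exps_minus) (auto simp: exps_minus)
    moreover have "- x = - g + (zpow \<tau> (- a) + zpow \<mu> (- b) + comm (zpow \<mu> (- b)) (zpow \<tau> (- a)))"
      unfolding x zpow_minus by (simp only: comm_word)
    ultimately show ?thesis using add[OF Fil_Ser[OF nsg_minus[OF N x(4)]]] by simp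
  qed
  have "cjg g x \<in> Ser m r" if "x \<in> Ser m r" "g \<in> \<Gamma>" for x g
    unfolding cjg_eq[of g x] by (rule Ser_add_Fil[OF that(1) cm0[OF that]])
  moreover have "0 \<in> Ser m r" by (rule Fil_Ser) (simp add: Fil_0_mem)
  ultimately show ?thesis
    using add minus Ser_Gam by (auto simp: nsg_def sgrp_def)
qed

lemma Ser_double:
  assumes "x \<in> Ser m r" "0 \<le> r" shows "x + x \<in> Ser m (2 * r)"
  using assms(1)
proof (cases rule: Ser_cases)
  case (1 a b g)
  have N: "nsg (Fil m 0 (2 * r))" by (intro FL.nsg_Fil) auto
  let ?d = "zpow \<tau> a + zpow \<mu> b"
  have e: "zpow \<tau> a \<in> Ser m r" "zpow \<mu> b \<in> Ser m r" "?d \<in> Ser m r"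
    using 1 Ser_I[of a r 0 0 m] Ser_I[of 0 r b 0 m] Ser_I[of a r b 0 m] by (auto simp: Fil_0_mem)
  have "comm (zpow \<mu> b) (zpow \<tau> a) \<in> Fil m 0 (2 * r)" "comm g ?d \<in> Fil m 0 (2 * r)"
    using Ser_comm_Ser[OF e(2,1)] Ser_comm_Ser[OF Fil_Ser[OF 1(4)] e(3)] assms(2) by simp_all
  moreover have "g + g \<in> Fil m 0 (2 * r)"
    using FL.Fil_double[OF _ _ 1(4)] by simp
  moreover have "2 * a \<in> exps 1 (2 * r)" "2 * b \<in> exps 1 (2 * r)"
    using exps_double[of a 1 r] exps_double[of b 1 r] 1 exps_half[of 1 "2 * r"] by auto
  moreover have "x + x = zpow \<tau> (a + a) + zpow \<mu> (b + b) +
      (cjg (zpow \<mu> b) (comm (zpow \<mu> b) (zpow \<tau> a)) + (cjg (- g) (comm g ?d) + (g + g)))"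
    unfolding 1 zpow_add by (simp only: comm_word)
  ultimately show ?thesis
    using 1(4) by (auto intro!: Ser_I nsg_add[OF N] nsg_cjg[OF N])
qed

lemma Ser_1: "Ser m 1 = \<Gamma>"
proof
  show "Ser m 1 \<subseteq> \<Gamma>" using Ser_Gam by auto
  have 1: "k \<in> exps 1 1" for k by (auto simp: exps_def intro!: exI[of _ 0])
  then have "\<tau> \<in> Ser m 1" "\<mu> \<in> Ser m 1"
    using Ser_I[of 1 1 0 0 m] Ser_I[of 0 1 1 0 m] by (auto simp: Fil_0_mem)
  then show "\<Gamma> \<subseteq> Ser m 1"
    unfolding \<Gamma>_def by (intro gen_subset nsg_sgrp nsg_Ser) auto
qed

lemma Ser_comm_Suc:
  assumes "x \<in> Ser m r" "g \<in> \<Gamma>" shows "comm x g \<in> Fil m 0 (r + 1)"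
  using Ser_cm1[OF assms] Fil_shift[of 1 m 0 r] by auto

section \<open>The dimension series\<close>

declare act_plus [simp del] act_zero [simp del] act_minus [simp del]

interpretation BSV: group BSV
  by (rule group_BSV)

interpretation wp: group word_perms
  by (rule group_word_perms)

lemma act_simps:
  "act g \<otimes>\<^bsub>word_perms\<^esub> act h = act (g + h)" "\<one>\<^bsub>word_perms\<^esub> = act 0"
  "act g \<in> carrier word_perms" "inv\<^bsub>word_perms\<^esub> (act g) = act (- g)"
proof -
  show *: "act g \<otimes>\<^bsub>word_perms\<^esub> act h = act (g + h)" "\<one>\<^bsub>word_perms\<^esub> = act 0"
    "act g \<in> carrier word_perms" for g h
    using act by (auto simp: word_perms_def plus_wperm.rep_eq zero_wperm.rep_eq)
  show "inv\<^bsub>word_perms\<^esub> (act g) = act (- g)"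
    by (rule wp.inv_equality) (auto simp: *)
qed

lemma carrier_BSV: "carrier BSV = act ` \<Gamma>"
proof -
  have TU: "act ` {\<tau>, \<mu>} = {tau, mu}" by (simp add: \<tau>.rep_eq \<mu>.rep_eq)
  have "generate word_perms (act ` {\<tau>, \<mu>}) = act ` gen_by {\<tau>, \<mu>}"
  proof
    show "generate word_perms (act ` {\<tau>, \<mu>}) \<subseteq> act ` gen_by {\<tau>, \<mu>}"
    proof
      fix x assume "x \<in> generate word_perms (act ` {\<tau>, \<mu>})"
      then show "x \<in> act ` gen_by {\<tau>, \<mu>}"
      proof induction
        case (eng x y)
        then show ?case by (auto simp: act_simps intro: gen_by.add)
      next
        case (inv h)
        then obtain x where "h = act x" "x \<in> {\<tau>, \<mu>}" by blast
        then show ?case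
          using gen_by.minus[OF gen_by.incl, of x "{\<tau>, \<mu>}"] by (simp only: act_simps imageI)
      qed (auto simp: act_simps intro: gen_by.intros)
    qed
    show "act ` gen_by {\<tau>, \<mu>} \<subseteq> generate word_perms (act ` {\<tau>, \<mu>})"
    proof safe
      fix x assume "x \<in> gen_by {\<tau>, \<mu>}"
      then show "act x \<in> generate word_perms (act ` {\<tau>, \<mu>})"
      proof induction
        case zero
        then show ?case using generate.one[of word_perms] by (simp add: act_simps)
      next
        case (incl x)
        then show ?case by (intro generate.incl) auto
      next
        case (add x y)
        then show ?case using generate.eng by (fastforce simp: act_simps(1)[symmetric])
      next
        case (minus x)
        then show ?case
          using wp.generate_m_inv_closed[of "act ` {\<tau>, \<mu>}" "act x"] act_simps(3,4) by auto
      qed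
    qed
  qed
  moreover have "carrier word_perms \<inter> {tau, mu} = act ` {\<tau>, \<mu>}"
    unfolding TU[symmetric] using act_simps(3) by auto
  ultimately show ?thesis
    by (simp add: BSV_def carrier_subgroup_generated \<Gamma>_def)
qed

lemma act_BSV [simp]:
  "act g \<otimes>\<^bsub>BSV\<^esub> act h = act (g + h)" "\<one>\<^bsub>BSV\<^esub> = act 0"
  "act g \<in> carrier BSV \<longleftrightarrow> g \<in> \<Gamma>"
  by (auto simp: BSV_def act_simps carrier_BSV[unfolded BSV_def] act_inject)

lemma act_inv [simp]: "g \<in> \<Gamma> \<Longrightarrow> inv\<^bsub>BSV\<^esub> (act g) = act (- g)"
  by (rule BSV.inv_equality) auto

lemma act_commutator [simp]:
  "g \<in> \<Gamma> \<Longrightarrow> h \<in> \<Gamma> \<Longrightarrow> commutator BSV (act g) (act h) = act (comm g h)"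
  by (simp add: commutator_def comm_def)

lemma act_pow: "act g [^]\<^bsub>BSV\<^esub> (n::nat) = act (npow g n)"
  by (induction n) auto

definition Dim :: "nat \<Rightarrow> wperm set"
  where "Dim n = {g. act g \<in> dim_series BSV n}"

lemma act_Dim: "act ` Dim n = dim_series BSV n"
proof -
  have "dim_series BSV n \<subseteq> act ` \<Gamma>"
    using BSV.dim_series_carrier by (simp add: carrier_BSV)
  then show ?thesis by (auto simp: Dim_def)
qed

lemma Dim_Gam: "g \<in> Dim n \<Longrightarrow> g \<in> \<Gamma>"
  using BSV.dim_series_carrier[of n] by (auto simp: Dim_def)

lemma nsg_Dim: "nsg (Dim n)"
proof -
  have S: "subgroup (dim_series BSV n) BSV" by (rule BSV.dim_series_subgroup)
  have "0 \<in> Dim n" using subgroup.one_closed[OF S] by (simp add: Dim_def)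
  moreover have "x + y \<in> Dim n" if "x \<in> Dim n" "y \<in> Dim n" for x y
    using subgroup.m_closed[OF S, of "act x" "act y"] that by (simp add: Dim_def)
  moreover have "- x \<in> Dim n" if "x \<in> Dim n" for x
    using subgroup.m_inv_closed[OF S, of "act x"] that Dim_Gam[OF that] by (simp add: Dim_def)
  moreover have "cjg g x \<in> Dim n" if "x \<in> Dim n" "g \<in> \<Gamma>" for g x
    using normal.inv_op_closed1[OF BSV.dim_series_normal, of "act g" "act x" n] that
    by (simp add: Dim_def cjg_def)
  ultimately show ?thesis using Dim_Gam by (auto simp: nsg_def sgrp_def)
qed

lemma Dim_1: "Dim (Suc 0) = \<Gamma>"
  by (auto simp: Dim_def)

lemma Dim_antimono: "m \<le> n \<Longrightarrow> Dim n \<subseteq> Dim m"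
  using BSV.dim_series_antimono by (auto simp: Dim_def)

lemma Dim_comm_Gam: "1 \<le> n \<Longrightarrow> g \<in> \<Gamma> \<Longrightarrow> h \<in> Dim n \<Longrightarrow> comm g h \<in> Dim (Suc n)"
  using BSV.dim_series_commutator[of n "act g" "act h"] Dim_Gam[of h n] by (simp add: Dim_def)

lemma Dim_double:
  assumes "1 \<le> k" "h \<in> Dim k" "n \<le> 2 * k" shows "h + h \<in> Dim n"
proof -
  have "h + h \<in> Dim (2 * k)"
    using BSV.dim_series_square2[of "2 * k" "act h"] assms by (simp add: Dim_def)
  then show ?thesis using Dim_antimono assms(3) by auto
qed

text \<open>Minimality of the series: its recursion adjoins only commutators and squares of terms
  already contained in \<open>A\<close>, and products of these.\<close>

lemma Dim_least:
  assumes A: "\<And>n. nsg (A n)" and "\<Gamma> \<subseteq> A 1"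
    and comm: "\<And>n g h. 2 \<le> n \<Longrightarrow> g \<in> \<Gamma> \<Longrightarrow> h \<in> A (n - 1) \<Longrightarrow> comm g h \<in> A n"
    and dbl: "\<And>n h. 2 \<le> n \<Longrightarrow> h \<in> A ((n + 1) div 2) \<Longrightarrow> h + h \<in> A n"
    and n: "1 \<le> n"
  shows "Dim n \<subseteq> A n"
  using n
proof (induction n rule: less_induct)
  case (less n)
  show ?case
  proof (cases "n = 1")
    case True
    then show ?thesis using assms Dim_1 by auto
  next
    case False
    have sub: "Dim k \<subseteq> A k" if "1 \<le> k" "k < n" for k
      using less.IH[OF that(2,1)] .
    have "subgroup (act ` A n) BSV"
    proof (rule BSV.subgroupI)
      show "act ` A n \<subseteq> carrier BSV" "act ` A n \<noteq> {}"
        using nsg_Gam[OF A] nsg_zero[OF A] by auto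
    next
      fix a assume "a \<in> act ` A n"
      then show "inv\<^bsub>BSV\<^esub> a \<in> act ` A n"
        using nsg_minus[OF A] by (auto simp: nsg_Gam[OF A])
    next
      fix a b assume "a \<in> act ` A n" "b \<in> act ` A n"
      then show "a \<otimes>\<^bsub>BSV\<^esub> b \<in> act ` A n"
        using nsg_add[OF A] by auto
    qed
    then have S: "generate BSV X \<subseteq> act ` A n" if "X \<subseteq> act ` A n" for X
      using BSV.generate_subgroup_incl that by blast
    have "{commutator BSV g h | g h. g \<in> carrier BSV \<and> h \<in> dim_series BSV (n - 1)} \<subseteq> act ` A n"
    proof safe
      fix g h assume "g \<in> carrier BSV" "h \<in> dim_series BSV (n - 1)"
      then obtain g' h' where *: "g = act g'" "g' \<in> \<Gamma>" "h = act h'" "h' \<in> Dim (n - 1)"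
        unfolding carrier_BSV act_Dim[symmetric] by blast
      then have "comm g' h' \<in> A n"
        using comm[of n g' h'] subsetD[OF sub, of "n - 1" h'] False less.prems by auto
      then show "commutator BSV g h \<in> act ` A n"
        using * Dim_Gam by simp
    qed
    note 1 = S[OF this]
    have "{h \<otimes>\<^bsub>BSV\<^esub> h | h. h \<in> dim_series BSV ((n + 1) div 2)} \<subseteq> act ` A n"
    proof safe
      fix h assume "h \<in> dim_series BSV ((n + 1) div 2)"
      then obtain h' where *: "h = act h'" "h' \<in> Dim ((n + 1) div 2)"
        unfolding act_Dim[symmetric] by blast
      then have "h' + h' \<in> A n"
        using dbl[of n h'] subsetD[OF sub, of "(n + 1) div 2" h'] False less.prems by auto
      then show "h \<otimes>\<^bsub>BSV\<^esub> h \<in> act ` A n"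
        using * by simp
    qed
    note 2 = S[OF this]
    have "dim_series BSV n \<subseteq> act ` A n"
    proof
      fix x assume "x \<in> dim_series BSV n"
      then obtain a b where "x = a \<otimes>\<^bsub>BSV\<^esub> b" "a \<in> act ` A n" "b \<in> act ` A n"
        using subsetD[OF 1] subsetD[OF 2] False less.prems
        by (subst (asm) dim_series.simps) (auto simp: set_mult_def)
      then show "x \<in> act ` A n"
        using nsg_add[OF A] by auto
    qed
    then show ?thesis
      unfolding act_Dim[symmetric] by (auto simp: act_inject)
  qed
qed

lemma Dim_subset_Ser:
  assumes "1 \<le> n" shows "Dim n \<subseteq> Ser m (real n)"
proof (rule Dim_least)
  show "nsg (Ser m (real n))" for n by (rule nsg_Ser)
  show "\<Gamma> \<subseteq> Ser m (real 1)" by (simp add: Ser_1)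
  show "comm g h \<in> Ser m (real n)" if "2 \<le> n" "g \<in> \<Gamma>" "h \<in> Ser m (real (n - 1))" for n g h
    using nsg_minus[OF FL.nsg_Fil Ser_comm_Suc[OF that(3,2)]] that(1)
    by (auto simp: comm_swap[of g h] of_nat_diff intro!: Fil_Ser)
  show "h + h \<in> Ser m (real n)" if "2 \<le> n" "h \<in> Ser m (real ((n + 1) div 2))" for n h
  proof -
    \<comment> \<open>Twice the ceiling of n/2 is at least n.\<close>
    have "exps 1 (2 * real ((n + 1) div 2)) \<subseteq> exps 1 (real n)"
      by (rule exps_mono) linarith
    moreover have "Fil m 0 (2 * real ((n + 1) div 2)) \<subseteq> Fil m 0 (real n)"
      by (rule Fil_le1) linarith+
    ultimately have "Ser m (2 * real ((n + 1) div 2)) \<subseteq> Ser m (real n)"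
      by (fastforce simp: Ser_def)
    then show ?thesis using Ser_double[OF that(2)] by auto
  qed
qed (use assms in auto)

section \<open>Degrees of the elements W(c)\<close>

definition letter :: "bool \<Rightarrow> wperm \<Rightarrow> wperm"
  where "letter b x = pair x (if b then x else 0)"

definition wact :: "bool list \<Rightarrow> wperm \<Rightarrow> wperm"
  where "wact W x = foldr letter W x"

text \<open>The degree in recursive form; \<open>wdeg_eq\<close> recovers the closed formula. The
  subtraction is never truncated, since \<open>wdeg\<close> is at least 2.\<close>

fun wdeg :: "bool list \<Rightarrow> nat" where
  "wdeg [] = 2"
| "wdeg (b # W) = 2 * wdeg W - (if b then 0 else 1)"

lemma wact_simps [simp]: "wact [] x = x" "wact (b # W) x = letter b (wact W x)"
  by (simp_all add: wact_def)

lemma wact_append: "wact (V @ W) x = wact V (wact W x)"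
  by (simp add: wact_def)

lemma act_wact: "act (wact W x) = word_map W (act x)"
proof (induction W)
  case (Cons b W)
  have "act (letter b y) = letter_map b (act y)" for y
    by (simp add: letter_def letter_map_def pair.rep_eq zero_wperm.rep_eq)
  with Cons show ?case by (simp add: word_map_def)
qed (simp add: word_map_def)

lemma act_C: "act \<gamma> = bsv_c"
  using act_commutator[of \<tau> \<mu>] by (simp add: \<gamma>_def \<tau>.rep_eq \<mu>.rep_eq)

lemma letter_add: "letter b (x + y) = letter b x + letter b y"
  by (simp add: letter_def pair_add)

lemma wact_add: "wact W (x + y) = wact W x + wact W y"
  by (induction W) (simp_all add: letter_add)

lemma wact_0 [simp]: "wact W 0 = 0"
  by (induction W) (simp_all add: letter_def)

lemma wact_minus: "wact W (- x) = - wact W x"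
proof -
  have "wact W (- x) + wact W x = 0" by (simp flip: wact_add)
  then show ?thesis by (simp add: eq_neg_iff_add_eq_0)
qed

lemma wact_zpow: "wact W (zpow x k) = zpow (wact W x) k"
  by (rule zpow_hom[of "wact W"]) (rule wact_add)

lemma wact_zpow_split: "zpow (wact (V @ b # W) x) k = wact (V @ [b]) (zpow (wact W x) k)"
  using wact_append[of "V @ [b]" W x] by (simp add: wact_zpow)

text \<open>Conjugation by (h, h) acts on both sections alike, so a word map turns conjugation by g
  into conjugation by 1^n(g), n being the length of the word.\<close>

lemma wact_cjg: "wact W (cjg g x) = cjg (wact (replicate (length W) True) g) (wact W x)"
proof (induction W)
  case (Cons b W)
  have "letter b (cjg h y) = cjg (letter True h) (letter b y)" for h y
    by (simp add: letter_def cjg_pair)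
  with Cons show ?case by simp
qed simp

lemma wact_True_Gam: "g \<in> \<Gamma> \<Longrightarrow> wact (replicate n True) g \<in> \<Gamma>"
  by (induction n) (simp_all add: letter_def pair_diag_Gam)

lemma wact_Der: "x \<in> \<Gamma>' \<Longrightarrow> wact W x \<in> \<Gamma>'"
  by (induction W) (simp_all add: letter_def pair_Der nsg_zero[OF nsg_Der])

lemma comm_wact_False_True:
  "comm (wact (replicate n False) x) (wact (replicate n True) y) = wact (replicate n False) (comm x y)"
  by (induction n) (simp_all add: letter_def comm_pair)

lemma wdeg_ge: "2 ^ length W + 1 \<le> wdeg W"
  by (induction W) auto

lemma wdeg_ge_2: "2 \<le> wdeg W"
  using wdeg_ge[of W] one_le_power[of "2 :: nat" "length W"] by linarith

lemma wdeg_eq: "wdeg W = (\<Sum>i<length W. of_bool (W ! i) * 2 ^ i) + 2 ^ length W + 1"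
proof (induction W)
  case (Cons b W)
  have "(\<Sum>i<length (b # W). of_bool ((b # W) ! i) * 2 ^ i)
      = of_bool b + 2 * (\<Sum>i<length W. of_bool (W ! i) * 2 ^ i :: nat)"
    by (simp add: sum.lessThan_Suc_shift sum_distrib_left algebra_simps
        del: sum.lessThan_Suc sum_of_bool_mult_eq sum_mult_of_bool_eq)
  then show ?case using Cons by simp
qed simp

lemma wdeg_True: "wdeg (replicate n True @ W) = 2 ^ n * wdeg W"
  by (induction n) auto

lemma wdeg_False: "wdeg (replicate n False @ W) = 2 ^ n * (wdeg W - 1) + 1"
  by (induction n) (use wdeg_ge_2[of W] in auto)

text \<open>In the real coordinates of \<open>F\<close>, prefixing \<open>V\<close> shifts the degree by \<open>ws V\<close> and then scales
  it by \<open>2 ^ length V\<close>.\<close>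

definition wshift :: "bool list \<Rightarrow> real"
  where "wshift V = 2 - wdeg V / 2 ^ length V"

lemma wdeg_append: "real (wdeg (V @ W)) = 2 ^ length V * (wdeg W - wshift V)"
proof (induction V)
  case (Cons b V)
  define \<beta> :: real where "\<beta> = (if b then 0 else 1)"
  have wdeg: "real (wdeg (b # X)) = 2 * real (wdeg X) - \<beta>" for X
    using wdeg_ge_2[of X] by (simp add: of_nat_diff \<beta>_def)
  have "wshift (b # V) = wshift V + \<beta> / 2 ^ Suc (length V)"
    unfolding wshift_def wdeg by (simp add: field_simps)
  then show ?case
    using Cons wdeg[of "V @ W"] by (simp add: field_simps)
qed (simp add: wshift_def)

lemma wshift_snoc: "wshift (V @ [False]) = (1 + wshift V) / 2" "wshift (V @ [True]) = wshift V / 2"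
  unfolding wshift_def[of "V @ _"] wdeg_append by (simp_all add: field_simps)

text \<open>Conjugate up to inversion.  This does not affect leading terms, since \<open>\<Gamma>\<close> acts trivially on
  \<open>\<Gamma>\<^sub>n/\<Gamma>\<^sub>n\<^sub>+\<^sub>1\<close>, a vector space over the field with two elements.\<close>

definition conj_pm :: "wperm \<Rightarrow> wperm \<Rightarrow> bool"
  where "conj_pm x y \<longleftrightarrow> (\<exists>g\<in>\<Gamma>. x = cjg g y \<or> x = - cjg g y)"

lemma conj_pm_refl: "conj_pm x x"
  by (auto simp: conj_pm_def intro: bexI[of _ 0])

lemma conj_pm_cjg: "conj_pm x y \<Longrightarrow> g \<in> \<Gamma> \<Longrightarrow> conj_pm (cjg g x) y"
  by (auto simp: conj_pm_def cjg_minus cjg_cjg intro: bexI[of _ "_ + g"])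

lemma conj_pm_minus: "conj_pm x y \<Longrightarrow> conj_pm (- x) y"
  by (auto simp: conj_pm_def)

lemma conj_pm_wact: "conj_pm x y \<Longrightarrow> conj_pm (wact W x) (wact W y)"
  using wact_True_Gam by (auto simp: conj_pm_def wact_cjg wact_minus)

lemma conj_pm_trans: "conj_pm x y \<Longrightarrow> conj_pm y z \<Longrightarrow> conj_pm x z"
  by (auto simp: conj_pm_def cjg_minus cjg_cjg intro: bexI[of _ "_ + _"])

lemma conj_pm_sym: "conj_pm x y \<Longrightarrow> conj_pm y x"
  unfolding conj_pm_def
proof (elim bexE)
  fix g assume "g \<in> \<Gamma>" "x = cjg g y \<or> x = - cjg g y"
  then show "\<exists>g\<in>\<Gamma>. y = cjg g x \<or> y = - cjg g x"
    by (intro bexI[of _ "- g"]) (auto simp: cjg_cjg cjg_minus)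
qed

lemma conj_pm_nsg: "nsg N \<Longrightarrow> conj_pm x y \<Longrightarrow> y \<in> N \<Longrightarrow> x \<in> N"
  by (auto simp: conj_pm_def nsg_minus nsg_cjg)

lemma conj_pm_eqm:
  assumes "conj_pm x y" "y \<in> Dim n" "1 \<le> n"
  shows "eqm (Dim (Suc n)) x y"
proof -
  obtain g where g: "g \<in> \<Gamma>" "x = cjg g y \<or> x = - cjg g y"
    using assms by (auto simp: conj_pm_def)
  have "comm y g \<in> Dim (Suc n)"
    using nsg_minus[OF nsg_Dim Dim_comm_Gam[OF assms(3) g(1) assms(2)]] by (simp flip: comm_swap)
  then have 1: "eqm (Dim (Suc n)) (cjg g y) y"
    using assms Dim_Gam by (intro eqm_cjg[OF nsg_Dim]) auto
  have "- y - y = - (y + y)" by (simp only: group_word)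
  then have "eqm (Dim (Suc n)) (- y) y"
    using nsg_minus[OF nsg_Dim Dim_double[OF assms(3,2), of "Suc n"]] assms
    by (simp add: eqm_def del: minus_add_distrib)
  then show ?thesis
    using g 1 eqm_trans[OF nsg_Dim eqm_minus[OF nsg_Dim 1]] Dim_Gam[OF assms(2)] by blast
qed

lemma comm_minus_conj_pm: "g \<in> \<Gamma> \<Longrightarrow> conj_pm (comm x (- g)) (comm x g)"
  unfolding comm_minus_right by (intro conj_pm_minus conj_pm_cjg conj_pm_refl) auto

lemma comm_minus_left_conj_pm: "x \<in> \<Gamma> \<Longrightarrow> conj_pm (comm (- x) g) (comm x g)"
  unfolding comm_minus_left by (intro conj_pm_minus conj_pm_cjg conj_pm_refl) auto

text \<open>[(h, h), \<tau>] = ([h, \<tau>], 1) and [(h, h), \<mu>] = ([h, \<mu>^-1], 1); the change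
  of sign in the second is absorbed by \<open>conj_pm\<close>.\<close>

lemma wact_True_comm:
  assumes "s \<in> {\<tau>, \<mu>}"
  shows "conj_pm (comm (wact (replicate n True) x) s) (wact (replicate n False) (comm x s))"
proof (induction n)
  case (Suc n)
  let ?h = "wact (replicate n True) x"
  obtain s' where s': "s' = s \<or> s' = - s" "comm (pair ?h ?h) s = pair (comm ?h s') 0"
    using assms pair_diag_comm_T pair_diag_comm_U by blast
  have "conj_pm (comm ?h s') (comm ?h s)"
    using s'(1) comm_minus_conj_pm[of s ?h] assms by (auto simp: conj_pm_refl)
  from conj_pm_wact[OF conj_pm_trans[OF this Suc], of "[False]"] show ?case
    by (simp add: s'(2) letter_def)
qed (simp add: conj_pm_refl)

lemma zpow_TU_comm: "conj_pm (comm (zpow \<tau> (2 ^ n)) \<mu>) (wact (replicate n False) \<gamma>)"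
    "conj_pm (comm (zpow \<mu> (2 ^ n)) \<tau>) (wact (replicate n False) \<gamma>)"
proof (induction n)
  case 0
  show "conj_pm (comm (zpow \<tau> (2 ^ 0)) \<mu>) (wact (replicate 0 False) \<gamma>)"
    "conj_pm (comm (zpow \<mu> (2 ^ 0)) \<tau>) (wact (replicate 0 False) \<gamma>)"
    using conj_pm_minus[OF conj_pm_refl, of \<gamma>] by (simp_all add: conj_pm_refl \<gamma>_def comm_swap[of \<mu> \<tau>])
next
  case (Suc n)
  let ?t = "zpow \<tau> (2 ^ n)" and ?u = "zpow \<mu> (2 ^ n)"
  have "comm (zpow \<tau> (2 ^ Suc n)) \<mu> = pair (comm ?t (- \<mu>)) 0"
    by (simp add: zpow_T_double pair_diag_comm_U)
  moreover have "conj_pm (comm ?t (- \<mu>)) (wact (replicate n False) \<gamma>)"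
    by (rule conj_pm_trans[OF comm_minus_conj_pm Suc(1)]) simp
  ultimately show "conj_pm (comm (zpow \<tau> (2 ^ Suc n)) \<mu>) (wact (replicate (Suc n) False) \<gamma>)"
    using conj_pm_wact[of _ _ "[False]"] by (fastforce simp: letter_def)
  have "comm (zpow \<mu> (2 ^ Suc n)) \<tau> = pair (comm (- ?u) \<tau>) 0"
    by (simp add: zpow_U_double pair_diag_comm_T zpow_minus)
  moreover have "conj_pm (comm (- ?u) \<tau>) (wact (replicate n False) \<gamma>)"
    by (rule conj_pm_trans[OF comm_minus_left_conj_pm Suc(2)]) simp
  ultimately show "conj_pm (comm (zpow \<mu> (2 ^ Suc n)) \<tau>) (wact (replicate (Suc n) False) \<gamma>)"
    using conj_pm_wact[of _ _ "[False]"] by (fastforce simp: letter_def)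
qed

lemma Dim_power:
  assumes "x \<in> Dim d" "1 \<le> d" shows "zpow x (2 ^ v * j) \<in> Dim (2 ^ v * d)"
proof (induction v)
  case 0
  show ?case using nsg_zpow[OF nsg_Dim assms(1)] by simp
next
  case (Suc v)
  have "zpow x (2 ^ v * j) + zpow x (2 ^ v * j) \<in> Dim (2 ^ Suc v * d)"
    using assms by (intro Dim_double[OF _ Suc]) auto
  then show ?case by (simp only: zpow_2_power)
qed

lemma Dim_exps:
  assumes "x \<in> Dim d" "1 \<le> d" "k \<in> exps (real d) (real n)"
  shows "zpow x k \<in> Dim n"
  using assms(3)
proof (cases rule: exps_cases)
  case (2 v j)
  then have "n \<le> 2 ^ v * d" by (metis (mono_tags) of_nat_le_iff of_nat_mult of_nat_numeral of_nat_power)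
  then show ?thesis using Dim_power[OF assms(1,2), of v j] Dim_antimono 2 by auto
qed (simp add: nsg_zero[OF nsg_Dim])

lemma word_cases:
  obtains n where "W = replicate n b" | n W' where "W = replicate n b @ (\<not> b) # W'"
proof -
  have "(\<exists>n. W = replicate n b) \<or> (\<exists>n W'. W = replicate n b @ (\<not> b) # W')"
  proof (induction W)
    case Nil
    then show ?case by (auto intro: exI[of _ 0])
  next
    case (Cons a W)
    show ?case
    proof (cases "a = b")
      case True
      from Cons show ?thesis
      proof (elim disjE exE)
        fix n assume "W = replicate n b"
        then show ?thesis using True by (intro disjI1 exI[of _ "Suc n"]) simp
      next
        fix n W' assume "W = replicate n b @ (\<not> b) # W'"
        then show ?thesis using True by (intro disjI2 exI[of _ "Suc n"] exI[of _ W']) simp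
      qed
    next
      case False
      then show ?thesis by (intro disjI2 exI[of _ 0] exI[of _ W]) auto
    qed
  qed
  with that show ?thesis by blast
qed

lemma wact_comm_left:
  assumes "s \<in> {\<tau>, \<mu>}"
  shows "wact V (comm (letter False y) s) = - (wact (V @ [False]) y + wact (V @ [False]) y) + wact (V @ [True]) y"
proof -
  have "comm (letter False y) s = pair (- y) y"
    using assms by (auto simp: letter_def pair_left_comm_T pair_left_comm_U)
  also have "\<dots> = - (letter False y + letter False y) + letter True y"
    by (simp only: letter_def if_True if_False pair_add pair_minus group_word)
  finally show ?thesis by (simp only: wact_add wact_minus wact_append wact_simps)
qed

text \<open>The first part makes a commutator with a generator land in the right degree, the second
  makes the accompanying square negligible, and the third is needed for the induction on the degree
  in \<open>word_Dim\<close>.\<close>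

lemma wdeg_step: "wdeg (replicate n True @ False # W) + 1 = wdeg (replicate n False @ True # W)"
    "wdeg (replicate n False @ True # W) < 2 * wdeg (replicate n False @ False # W)"
    "wdeg (replicate n False @ False # W) < wdeg (replicate n False @ True # W)"
proof -
  obtain e where e: "wdeg W = e + 2" using wdeg_ge_2[of W] by (metis add.commute le_iff_add)
  show "wdeg (replicate n True @ False # W) + 1 = wdeg (replicate n False @ True # W)"
    "wdeg (replicate n False @ True # W) < 2 * wdeg (replicate n False @ False # W)"
    "wdeg (replicate n False @ False # W) < wdeg (replicate n False @ True # W)"
    unfolding wdeg_True wdeg_False by (simp_all add: e algebra_simps)
qed

text \<open>The induction is on the degree, not on the length: 0^n 1W' is reached from 1^n 0W' and
  0^n 0W', words of the same length but of smaller degree.\<close>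

lemma word_Dim: "wact W \<gamma> \<in> Dim (wdeg W)"
proof (induction "wdeg W" arbitrary: W rule: less_induct)
  case less
  show ?case
  proof (cases W rule: word_cases[of _ False])
    case (1 n)
    have t: "zpow \<tau> (2 ^ n) \<in> Dim (2 ^ n)"
      using Dim_power[of \<tau> 1 n 1] by (simp add: Dim_1)
    have 2: "comm \<mu> (zpow \<tau> (2 ^ n)) \<in> Dim (Suc (2 ^ n))"
      by (rule Dim_comm_Gam[OF _ _ t]) auto
    have "conj_pm (comm (zpow \<tau> (2 ^ n)) \<mu>) (comm \<mu> (zpow \<tau> (2 ^ n)))"
      unfolding comm_swap[of \<mu>] by (intro conj_pm_sym[OF conj_pm_minus] conj_pm_refl)
    from conj_pm_nsg[OF nsg_Dim conj_pm_trans[OF conj_pm_sym[OF zpow_TU_comm(1)] this] 2] show ?thesis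
      using 1 wdeg_False[of n "[]"] by simp
  next
    case (2 n W')
    let ?a = "wact (replicate n False @ False # W') \<gamma>"
    have a: "?a \<in> Dim (wdeg (replicate n False @ False # W'))"
      by (rule less.hyps) (use 2 wdeg_step in simp)
    have W: "W = replicate n False @ True # W'" using 2 by simp
    then have "?a + ?a \<in> Dim (wdeg W)"
      using wdeg_step[of n W'] wdeg_ge_2[of "replicate n False @ False # W'"] by (intro Dim_double[OF _ a]) auto
    let ?x = "wact (replicate n True @ False # W') \<gamma>"
    have "?x \<in> Dim (wdeg (replicate n True @ False # W'))"
      by (rule less.hyps) (use W wdeg_step[of n W'] in simp)
    then have "comm \<tau> ?x \<in> Dim (wdeg W)"
      using Dim_comm_Gam[of "wdeg (replicate n True @ False # W')" \<tau> ?x]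
        wdeg_step(1)[of n W'] wdeg_ge_2[of "replicate n True @ False # W'"] W by simp
    then have "comm ?x \<tau> \<in> Dim (wdeg W)"
      using nsg_minus[OF nsg_Dim] by (simp add: comm_swap[of ?x])
    moreover have "conj_pm (wact (replicate n False) (comm (letter False (wact W' \<gamma>)) \<tau>)) (comm ?x \<tau>)"
      using conj_pm_sym[OF wact_True_comm[of \<tau> n "letter False (wact W' \<gamma>)"]] by (simp add: wact_append)
    ultimately have "wact (replicate n False) (comm (letter False (wact W' \<gamma>)) \<tau>) \<in> Dim (wdeg W)"
      using conj_pm_nsg[OF nsg_Dim] by blast
    then have "- (?a + ?a) + wact W \<gamma> \<in> Dim (wdeg W)"
      unfolding wact_comm_left[of \<tau>, simplified] by (simp add: W wact_append)
    then have "(?a + ?a) + (- (?a + ?a) + wact W \<gamma>) \<in> Dim (wdeg W)"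
      using \<open>?a + ?a \<in> Dim (wdeg W)\<close> by (rule nsg_add[OF nsg_Dim, rotated])
    then show ?thesis by (simp only: add_minus_cancel)
  qed
qed

lemma exps_scale: "0 < c \<Longrightarrow> exps (c * w) (c * r) = exps w r"
  by (auto simp: exps_def mult.left_commute)

text \<open>Peels off one normal-form level after another. \<open>wshift V\<close> and n / 2^|V| are
  the parameters that (0, n) turns into along the prefix \<open>V\<close>. \<open>H\<close> is
  arbitrary because it serves twice: with a term of the dimension series and with the elements whose
  class lies in the span.\<close>

lemma Fil_prefix:
  assumes H: "sgrp H"
    and words: "\<And>W k. k \<in> exps (real (wdeg W)) n \<Longrightarrow> zpow (wact W \<gamma>) k \<in> H"
    and deep: "\<And>W g. length W = M \<Longrightarrow> g \<in> \<Gamma>' \<Longrightarrow> wact W g \<in> H"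
    and g: "g \<in> Fil m (wshift V) (n / 2 ^ length V)" and "length V + m = M"
  shows "wact V g \<in> H"
  using g assms(5)
proof (induction m arbitrary: V g)
  case 0
  then show ?case using deep by simp
next
  case (Suc m)
  obtain k a h where g: "g = zpow \<gamma> k + pair a 0 + pair h h" and k: "k \<in> exps (2 - wshift V) (n / 2 ^ length V)"
    and ah: "a \<in> Fil m ((1 + wshift V) / 2) (n / 2 ^ length V / 2)"
      "h \<in> Fil m (wshift V / 2) (n / 2 ^ length V / 2)"
    using Fil_Suc_cases[OF Suc.prems(1)] by blast
  have "wact (V @ [False]) a \<in> H" "wact (V @ [True]) h \<in> H"
    by (rule Suc.IH; use ah Suc.prems(2) in \<open>simp add: wshift_snoc mult.commute\<close>)+
  moreover have "zpow (wact V \<gamma>) k \<in> H"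
  proof (rule words)
    have "exps (2 ^ length V * (2 - wshift V)) (2 ^ length V * (n / 2 ^ length V)) =
        exps (2 - wshift V) (n / 2 ^ length V)"
      by (rule exps_scale) simp
    moreover have "2 ^ length V * (2 - wshift V) = wdeg V"
      by (simp add: wshift_def)
    ultimately show "k \<in> exps (real (wdeg V)) n" using k by simp
  qed
  moreover have "wact V g = zpow (wact V \<gamma>) k + wact (V @ [False]) a + wact (V @ [True]) h"
    by (simp add: g wact_add wact_zpow wact_append letter_def)
  ultimately show ?case using H by (simp add: sgrp_add)
qed

lemma Fil_subset:
  assumes "sgrp H" "\<And>W k. k \<in> exps (real (wdeg W)) n \<Longrightarrow> zpow (wact W \<gamma>) k \<in> H"
    and "\<And>W g. length W = m \<Longrightarrow> g \<in> \<Gamma>' \<Longrightarrow> wact W g \<in> H"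
  shows "Fil m 0 n \<subseteq> H"
  using Fil_prefix[of H n m _ m "[]"] assms by (auto simp: wshift_def)

lemma wact_Der_Dim:
  assumes "g \<in> \<Gamma>'" shows "wact W g \<in> Dim (wdeg W)"
proof -
  have "g \<in> {g. wact W g \<in> Dim (wdeg W)}"
    using assms unfolding \<Gamma>'_def
  proof (rule subsetD[OF gen_subset, rotated -1])
    show "sgrp {g. wact W g \<in> Dim (wdeg W)}"
      using nsg_zero[OF nsg_Dim] nsg_add[OF nsg_Dim] nsg_minus[OF nsg_Dim]
      by (auto simp: sgrp_def wact_add wact_minus)
    show "{cjg g \<gamma> |g. g \<in> \<Gamma>} \<subseteq> {g. wact W g \<in> Dim (wdeg W)}"
      using nsg_cjg[OF nsg_Dim word_Dim wact_True_Gam] by (auto simp: wact_cjg)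
  qed
  then show ?thesis by simp
qed

lemma Dim_deep:
  assumes "g \<in> \<Gamma>'" "n \<le> 2 ^ length W + 1" shows "wact W g \<in> Dim n"
  using subsetD[OF Dim_antimono wact_Der_Dim[OF assms(1)], of n W] wdeg_ge[of W] assms(2) by simp

text \<open>The bound on \<open>n\<close> comes from truncation: elements W(g) with |W| = m, which
  \<open>Ser m\<close> leaves unrestricted, have degree at least 2^m + 1.\<close>

lemma Dim_eq_Ser:
  assumes "1 \<le> n" "n \<le> 2 ^ m + 1" shows "Dim n = Ser m n"
proof
  show "Dim n \<subseteq> Ser m n" by (rule Dim_subset_Ser[OF assms(1)])
  have "Fil m 0 n \<subseteq> Dim n"
  proof (rule Fil_subset[OF nsg_sgrp[OF nsg_Dim]])
    show "zpow (wact W \<gamma>) k \<in> Dim n" if "k \<in> exps (real (wdeg W)) (real n)" for W k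
      using Dim_exps[OF word_Dim _ that] wdeg_ge_2[of W] by simp
    show "wact W g \<in> Dim n" if "length W = m" "g \<in> \<Gamma>'" for W g
      using Dim_deep that assms by simp
  qed
  moreover have "zpow X a \<in> Dim n" if "a \<in> exps 1 n" "X \<in> {\<tau>, \<mu>}" for X a
    using Dim_exps[of X 1 a n] that by (auto simp: Dim_1)
  ultimately show "Ser m n \<subseteq> Dim n"
    by (auto simp: Ser_def intro!: nsg_add[OF nsg_Dim])
qed

text \<open>Read off from the explicit description; the depth i + j is large enough for all three
  degrees.\<close>

lemma Dim_comm:
  assumes "x \<in> Dim i" "y \<in> Dim j" "1 \<le> i" "1 \<le> j" shows "comm x y \<in> Dim (i + j)"
proof -
  have b: "k \<le> 2 ^ (i + j) + 1" if "k \<le> i + j" for k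
    using less_exp[of "i + j"] that by linarith
  have "x \<in> Ser (i + j) i" "y \<in> Ser (i + j) j"
    using assms Dim_eq_Ser[OF _ b] by auto
  then have "comm x y \<in> Fil (i + j) 0 (real i + real j)"
    by (rule Ser_comm_Ser) auto
  then show ?thesis
    using Fil_Ser Dim_eq_Ser[OF _ b, of "i + j"] assms by auto
qed

section \<open>Leading terms of commutators with the generators\<close>

lemma comm_double: "comm (x + x) s = cjg (- comm x s) (comm (comm x s) x) + (comm x s + comm x s)"
  by (simp only: comm_word)

lemma conj_pm_comm_Z: "conj_pm (comm \<zeta> \<tau>) \<gamma>" "conj_pm (comm \<zeta> (- \<mu>)) \<gamma>"
proof -
  have "comm \<zeta> \<tau> = - cjg \<tau> \<gamma>" by (simp only: \<zeta>_def \<gamma>_def comm_word)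
  then show "conj_pm (comm \<zeta> \<tau>) \<gamma>" by (auto simp: conj_pm_def)
  have "comm \<zeta> (- \<mu>) = - cjg (- \<mu>) \<gamma>" by (simp only: \<zeta>_def \<gamma>_def comm_word)
  then show "conj_pm (comm \<zeta> (- \<mu>)) \<gamma>" by (auto simp: conj_pm_def)
qed

lemma conj_pm_eqm_wact: "conj_pm x (wact W \<gamma>) \<Longrightarrow> eqm (Dim (Suc (wdeg W))) x (wact W \<gamma>)"
  using conj_pm_eqm[OF _ word_Dim] wdeg_ge_2[of W] by simp

lemma eqm_left: "nsg N \<Longrightarrow> eqm N x y \<Longrightarrow> a \<in> N \<Longrightarrow> eqm N (a + x) y"
  using eqm_trans[of N "a + x" x y] nsg_minus[of N] 
  by (simp add: eqm_def group_word del: add_uminus_conv_diff)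

lemma arrow_power:
  "eqm (Dim (2 ^ n + 2)) (comm (zpow \<tau> (2 ^ n)) \<mu>) (wact (replicate n False) \<gamma>)"
  "eqm (Dim (2 ^ n + 2)) (comm (zpow \<mu> (2 ^ n)) \<tau>) (wact (replicate n False) \<gamma>)"
  using conj_pm_eqm_wact[OF zpow_TU_comm(1)[of n]] conj_pm_eqm_wact[OF zpow_TU_comm(2)[of n]] wdeg_False[of n "[]"]
  by auto

lemma conj_pm_eqm_trans:
  assumes "conj_pm x y" "eqm (Dim (Suc n)) y z" "z \<in> Dim n" "1 \<le> n"
  shows "eqm (Dim (Suc n)) x z"
proof -
  have "y \<in> Dim n"
    using eqm_mem[OF nsg_Dim eqm_mono[OF assms(2) Dim_antimono] assms(3)] by simp
  from eqm_trans[OF nsg_Dim conj_pm_eqm[OF assms(1) this assms(4)] assms(2)] show ?thesis .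
qed

lemma arrow_True:
  assumes "s \<in> {\<tau>, \<mu>}"
  shows "eqm (Dim (2 ^ (n + 1) + 2)) (comm (wact (replicate n True) \<gamma>) s)
     (wact (replicate (n + 1) False) \<gamma>)"
proof -
  let ?V = "replicate n False" and ?W = "replicate (n + 1) False"
  have d: "Suc (wdeg ?W) = 2 ^ (n + 1) + 2"
    using wdeg_False[of "n + 1" "[]"] by simp
  obtain s' where s': "s' \<in> {\<tau>, - \<mu>}" "comm \<gamma> s = zpow \<gamma> (- 2) + pair (comm \<zeta> s') 0"
    using assms zpow_C_comm_T[of 1] zpow_C_comm_U[of 1] by auto
  have "conj_pm (wact ?W (comm \<zeta> s')) (wact ?W \<gamma>)"
    using s'(1) conj_pm_comm_Z by (intro conj_pm_wact) auto
  moreover have "wact ?W (comm \<zeta> s') = wact ?V (pair (comm \<zeta> s') 0)"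
    using wact_append[of ?V "[False]"] by (simp add: letter_def flip: replicate_append_same)
  ultimately have "conj_pm (wact ?V (pair (comm \<zeta> s') 0)) (wact ?W \<gamma>)"
    by (simp only:)
  then have 1: "eqm (Dim (Suc (wdeg ?W))) (wact ?V (pair (comm \<zeta> s') 0)) (wact ?W \<gamma>)"
    by (rule conj_pm_eqm_wact)
  \<comment> \<open>The factor c^-2 of [c, s] becomes the inverse square of 0^n(c), in degree 2 (2^n
    + 1), one above the degree of 0^(n+1)(c).\<close>
  have "zpow (wact ?V \<gamma>) (2 ^ 1 * - 1) \<in> Dim (2 ^ 1 * wdeg ?V)"
    by (rule Dim_power[OF word_Dim]) (use wdeg_ge_2[of ?V] in simp)
  then have "wact ?V (zpow \<gamma> (- 2)) \<in> Dim (Suc (wdeg ?W))"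
    using wdeg_False[of n "[]"] d by (simp add: wact_zpow)
  from eqm_left[OF nsg_Dim 1 this]
  have "eqm (Dim (Suc (wdeg ?W))) (wact ?V (comm \<gamma> s)) (wact ?W \<gamma>)"
    by (simp only: s'(2) wact_add)
  from conj_pm_eqm_trans[OF wact_True_comm[OF assms] this word_Dim] show ?thesis
    unfolding d using wdeg_ge_2[of ?W] by simp
qed

lemma arrow_False:
  assumes "s \<in> {\<tau>, \<mu>}"
  shows "eqm (Dim (Suc (wdeg (replicate n False @ True # W))))
     (comm (wact (replicate n True @ False # W) \<gamma>) s) (wact (replicate n False @ True # W) \<gamma>)"
proof -
  let ?a = "wact (replicate n False @ False # W) \<gamma>" and ?d = "wdeg (replicate n False @ True # W)"
  have "?a + ?a \<in> Dim (Suc ?d)"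
    using wdeg_step(2)[of n W] wdeg_ge_2[of "replicate n False @ False # W"]
    by (intro Dim_double[OF _ word_Dim]) auto
  from eqm_left[OF nsg_Dim eqm_refl[OF nsg_Dim] nsg_minus[OF nsg_Dim this]]
  have "eqm (Dim (Suc ?d)) (- (?a + ?a) + wact (replicate n False @ True # W) \<gamma>)
      (wact (replicate n False @ True # W) \<gamma>)" .
  then have "eqm (Dim (Suc ?d)) (wact (replicate n False) (comm (letter False (wact W \<gamma>)) s))
      (wact (replicate n False @ True # W) \<gamma>)"
    unfolding wact_comm_left[OF assms] by (simp only: wact_append wact_simps)
  from conj_pm_eqm_trans[OF wact_True_comm[OF assms] this word_Dim] show ?thesis
    using wdeg_ge_2[of "replicate n False @ True # W"] by (simp add: wact_append)
qed

text \<open>By \<open>comm_double\<close>, [x^2, s] consists of [x, s]^2, which already lies deep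
  enough, and a conjugate of [[x, s], x], which is the term to control.\<close>

lemma comm_square_Dim:
  assumes "comm x s \<in> Dim (d + 1)" "comm (comm x s) x \<in> Dim (2 * d + 2)"
  shows "comm (x + x) s \<in> Dim (2 * d + 2)"
proof -
  have "comm x s + comm x s \<in> Dim (2 * d + 2)"
    by (rule Dim_double[OF _ assms(1)]) auto
  then show ?thesis
    unfolding comm_double using assms Dim_Gam[OF assms(1)]
    by (intro nsg_add[OF nsg_Dim nsg_cjg[OF nsg_Dim]]) auto
qed

text \<open>The N-series property alone gives degree \<open>2^(n+2) + 1\<close>; the gain of 1 is due to
  \<open>[c, \<zeta>] = (c\<^sup>\<alpha>, c\<^sup>-\<^sup>\<beta>)\<close> being congruent to a product of a square and \<open>1(c\<^sup>-\<^sup>\<beta>)\<close>.\<close>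

lemma comm_False_True_Dim:
  "comm (wact (replicate (n + 1) False) \<gamma>) (wact (replicate n True) \<gamma>) \<in> Dim (2 * 2 ^ (n + 1) + 2)"
proof -
  let ?V = "replicate (n + 1) False" and ?N = "2 * 2 ^ (n + 1) + 2 :: nat"
  have "comm (wact ?V \<gamma>) (wact (replicate n True) \<gamma>)
      = comm (wact (replicate n False) (pair \<gamma> 0)) (wact (replicate n True) \<gamma>)"
    using wact_append[of "replicate n False" "[False]"] by (simp add: letter_def flip: replicate_append_same)
  also have "\<dots> = wact (replicate n False) (comm (pair \<gamma> 0) \<gamma>)"
    by (rule comm_wact_False_True)
  also have "comm (pair \<gamma> 0) \<gamma> = pair (comm \<gamma> (- \<zeta>)) 0"
    by (subst (2) C_eq) (simp add: comm_pair)
  also have "wact (replicate n False) (pair (comm \<gamma> (- \<zeta>)) 0) = wact ?V (comm \<gamma> (- \<zeta>))"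
    using wact_append[of "replicate n False" "[False]"] by (simp add: letter_def flip: replicate_append_same)
  finally have 1: "comm (wact ?V \<gamma>) (wact (replicate n True) \<gamma>) = wact ?V (comm \<gamma> (- \<zeta>))" .
  define p where "p = comm (- \<zeta>) \<tau>"
  define q where "q = comm \<zeta> (- \<mu>)"
  have "p = cjg (- \<zeta>) (cjg \<tau> \<gamma>)" "q = cjg (- \<mu>) (- \<gamma>)"
    by (simp_all only: p_def q_def \<zeta>_def \<gamma>_def comm_word)
  have "comm \<gamma> \<zeta> = pair p q"
    by (simp only: C_eq Z_eq[symmetric]) (subst (2) Z_eq, simp only: comm_pair p_def q_def)
  also have "\<dots> = letter False (p - q) + letter True q"
    by (simp add: letter_def pair_add)
  finally have "wact ?V (comm \<gamma> \<zeta>) = (wact (?V @ [False]) p + wact (?V @ [False]) (- q)) + wact (?V @ [True]) q"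
    by (simp only: wact_add wact_append wact_simps diff_conv_add_uminus letter_add)
  moreover have "wact (?V @ [True]) q \<in> Dim ?N"
  proof -
    have "conj_pm q \<gamma>" unfolding q_def by (rule conj_pm_comm_Z)
    from conj_pm_nsg[OF nsg_Dim conj_pm_wact[OF this] word_Dim, of "?V @ [True]"]
    show ?thesis
      using subsetD[OF Dim_antimono, of ?N "wdeg (?V @ [True])"] wdeg_False[of "n + 1" "[True]"] by auto
  qed
  moreover have "wact (?V @ [False]) p + wact (?V @ [False]) (- q) \<in> Dim ?N"
  proof -
    let ?e = "wact (?V @ [False]) \<gamma>"
    have d: "wdeg (?V @ [False]) = 2 * 2 ^ (n + 1) + 1"
      using wdeg_False[of "n + 1" "[False]"] by simp
    have "conj_pm p \<gamma>" "conj_pm (- q) \<gamma>"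
      using conj_pm_trans[OF comm_minus_left_conj_pm conj_pm_comm_Z(1)] conj_pm_minus[OF conj_pm_comm_Z(2)]
      by (auto simp: p_def q_def)
    \<comment> \<open>Both factors have the leading term of \<open>?e\<close>, so modulo
      \<open>Dim ?N\<close> their product is the square of \<open>?e\<close>.\<close>
    from this[THEN conj_pm_wact, THEN conj_pm_eqm_wact, of "?V @ [False]"] have "eqm (Dim ?N) (wact (?V @ [False]) p) ?e" "eqm (Dim ?N) (wact (?V @ [False]) (- q)) ?e"
      by (simp_all only: d) (simp_all only: Suc_eq_plus1 add.assoc one_add_one)
    moreover have "wact (?V @ [False]) p \<in> \<Gamma>"
      by (intro Der_Gam wact_Der) (simp add: p_def comm_Der)
    ultimately have "eqm (Dim ?N) (wact (?V @ [False]) p + wact (?V @ [False]) (- q)) (?e + ?e)"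
      by (intro eqm_add[OF nsg_Dim])
    moreover have "?e + ?e \<in> Dim ?N"
      by (rule Dim_double[OF _ word_Dim]) (use d in auto)
    ultimately show ?thesis by (rule eqm_mem[OF nsg_Dim])
  qed
  ultimately have "wact ?V (comm \<gamma> \<zeta>) \<in> Dim ?N"
    by (simp only: nsg_add[OF nsg_Dim])
  moreover have "conj_pm (wact ?V (comm \<gamma> (- \<zeta>))) (wact ?V (comm \<gamma> \<zeta>))"
    by (intro conj_pm_wact comm_minus_conj_pm) simp
  ultimately show ?thesis
    unfolding 1 using conj_pm_nsg[OF nsg_Dim] by blast
qed

text \<open>Only the first square needs \<open>comm_False_True_Dim\<close>: there [x, s] has leading
  term 0^(n+1)(c), and \<open>Dim_comm\<close> falls one degree short. Afterwards [x, s] is already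
  one degree deeper than usual and \<open>Dim_comm\<close> suffices.\<close>

lemma no_arrow_True:
  assumes s: "s \<in> {\<tau>, \<mu>}"
  shows "comm (zpow (wact (replicate n True) \<gamma>) (2 ^ Suc v)) s \<in> Dim (2 ^ Suc v * 2 ^ (n + 1) + 2)"
proof (induction v)
  case 0
  define x where "x = wact (replicate n True) \<gamma>"
  define b where "b = wact (replicate (n + 1) False) \<gamma>"
  let ?d = "2 ^ (n + 1) :: nat"
  have x: "x \<in> Dim ?d"
    using word_Dim[of "replicate n True"] wdeg_True[of n "[]"] by (simp add: x_def mult.commute)
  have b: "b \<in> Dim (?d + 1)"
    using word_Dim[of "replicate (n + 1) False"] wdeg_False[of "n + 1" "[]"] by (simp add: b_def)
  define r where "r = comm x s - b"
  have r: "r \<in> Dim (?d + 2)"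
    using arrow_True[OF s, of n] by (simp add: eqm_def r_def x_def b_def)
  have y: "comm x s = r + b" by (simp add: r_def)
  have "r \<in> Dim (?d + 1)" using subsetD[OF Dim_antimono r] by simp
  then have 1: "comm x s \<in> Dim (?d + 1)"
    unfolding y using b by (rule nsg_add[OF nsg_Dim])
  have "comm r x \<in> Dim (?d + 2 + ?d)" by (rule Dim_comm[OF r x]) auto
  then have "comm r x \<in> Dim (2 * ?d + 2)" by (simp add: mult_2 add.commute add.left_commute)
  then have "comm (comm x s) x \<in> Dim (2 * ?d + 2)"
    unfolding y comm_add_left using comm_False_True_Dim[of n] Dim_Gam[OF b]
    by (intro nsg_add[OF nsg_Dim] nsg_cjg[OF nsg_Dim]) (simp_all add: x_def b_def)
  from comm_square_Dim[OF 1 this] show ?case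
    using zpow_2_power[of x 0 1] by (simp add: x_def)
next
  case (Suc v)
  define x where "x = zpow (wact (replicate n True) \<gamma>) (2 ^ Suc v)"
  let ?d = "2 ^ Suc v * 2 ^ (n + 1) :: nat"
  have x: "x \<in> Dim ?d"
    using Dim_power[OF word_Dim, of "replicate n True" "Suc v" 1] wdeg_True[of n "[]"]
    by (simp add: x_def ac_simps)
  have y: "comm x s \<in> Dim (?d + 2)" using Suc by (simp add: x_def)
  have "comm (comm x s) x \<in> Dim (?d + 2 + ?d)" by (rule Dim_comm[OF y x]) auto
  then have "comm (x + x) s \<in> Dim (2 * ?d + 2)"
    using subsetD[OF Dim_antimono y, of "?d + 1"]
    by (intro comm_square_Dim) (simp_all add: mult_2 add.commute add.left_commute)
  moreover have "zpow (wact (replicate n True) \<gamma>) (2 ^ Suc (Suc v)) = x + x"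
    using zpow_2_power[of _ "Suc v" 1] by (simp add: x_def)
  ultimately show ?case by (simp add: mult.assoc)
qed

text \<open>For 1^n 0W' the commutator with a generator raises deg W by one before taking the 2^v-th
  power, so it lands in degree 2^v (deg W + 1), at least 2 above 2^v deg W because v >= 1.\<close>

lemma no_arrow:
  assumes s: "s \<in> {\<tau>, \<mu>}" and v: "1 \<le> v"
  shows "comm (zpow (wact W \<gamma>) (2 ^ v)) s \<in> Dim (2 ^ v * wdeg W + 2)"
proof (cases W rule: word_cases[of _ True])
  case (1 n)
  obtain u where "v = Suc u" using v by (cases v) auto
  then show ?thesis
    using no_arrow_True[OF s, of n u] wdeg_True[of n "[]"] 1 by (simp add: ac_simps)
next
  case (2 n W')
  let ?N = "2 ^ v * wdeg W + 2"
  let ?A = "replicate n False @ False # W'" and ?B = "replicate n False @ True # W'"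
  have W: "W = replicate n True @ False # W'" using 2 by simp
  have two: "2 \<le> (2 :: nat) ^ v" using v by (cases v) auto
  have "zpow (wact ?B \<gamma>) (2 ^ v * 1) \<in> Dim (2 ^ v * wdeg ?B)"
    by (rule Dim_power[OF word_Dim]) (use wdeg_ge_2[of ?B] in simp)
  moreover have "?N \<le> 2 ^ v * wdeg ?B"
    using two wdeg_step(1)[of n W', symmetric] by (simp add: W)
  ultimately have B: "zpow (wact ?B \<gamma>) (2 ^ v) \<in> Dim ?N"
    using Dim_antimono by auto
  have "zpow (wact ?A \<gamma>) (2 ^ v * 1) \<in> Dim (2 ^ v * wdeg ?A)"
    by (rule Dim_power[OF word_Dim]) (use wdeg_ge_2[of ?A] in simp)
  then have "zpow (wact ?A \<gamma>) (2 ^ v) + zpow (wact ?A \<gamma>) (2 ^ v) \<in> Dim (2 * (2 ^ v * wdeg ?A))"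
    using wdeg_ge_2[of ?A] by (intro Dim_double) auto
  moreover have "?N \<le> 2 * (2 ^ v * wdeg ?A)"
  proof -
    have "2 ^ v * (wdeg W + 1) \<le> 2 ^ v * (2 * wdeg ?A)"
      using wdeg_step(1,2)[of n W'] by (intro mult_left_mono) (auto simp: W)
    then show ?thesis using two by simp
  qed
  ultimately have A: "zpow (wact ?A \<gamma>) (2 ^ v) + zpow (wact ?A \<gamma>) (2 ^ v) \<in> Dim ?N"
    using Dim_antimono by auto
  let ?y = "zpow (wact W' \<gamma>) (2 ^ v)"
  have "wact (replicate n False) (comm (letter False ?y) s)
      = - (zpow (wact ?A \<gamma>) (2 ^ v) + zpow (wact ?A \<gamma>) (2 ^ v)) + zpow (wact ?B \<gamma>) (2 ^ v)"
    by (simp only: wact_comm_left[OF s] wact_zpow_split)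
  then have "wact (replicate n False) (comm (letter False ?y) s) \<in> Dim ?N"
    using A B by (simp only: nsg_add[OF nsg_Dim] nsg_minus[OF nsg_Dim])
  moreover have "zpow (wact W \<gamma>) (2 ^ v) = wact (replicate n True) (letter False ?y)"
    unfolding W wact_zpow_split by (simp add: wact_append)
  ultimately show ?thesis
    using conj_pm_nsg[OF nsg_Dim wact_True_comm[OF s]] by simp
qed

section \<open>Homogeneous elements of the Lie algebra\<close>

abbreviation BSV_letter :: "(int, nat \<Rightarrow> (bool list \<Rightarrow> bool list) set) module"
  where "BSV_letter \<equiv> lie_space BSV"

interpretation V: vectorspace "residue_ring 2" BSV_letter
  by (rule BSV.vectorspace_lie_space)

definition dcoset :: "nat \<Rightarrow> wperm \<Rightarrow> (bool list \<Rightarrow> bool list) set"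
  where "dcoset n x = act ` {d + x | d. d \<in> Dim (Suc n)}"

text \<open>Unlike in \<open>lie_class\<close>, the degree is prescribed; the class of a deeper
  element is then zero, which makes \<open>dclass n\<close> additive on
  \<open>Dim n\<close>.\<close>

definition dclass :: "nat \<Rightarrow> wperm \<Rightarrow> nat \<Rightarrow> (bool list \<Rightarrow> bool list) set"
  where "dclass n x = lie_incl BSV n (dcoset n x)"

lemma dcoset_coset: "dim_series BSV (Suc n) #>\<^bsub>BSV\<^esub> act x = dcoset n x"
  by (auto simp: r_coset_def dcoset_def act_Dim[symmetric])

lemma dcoset_cong: "eqm (Dim (Suc n)) x y \<Longrightarrow> dcoset n x = dcoset n y"
proof -
  have *: "dcoset n x \<subseteq> dcoset n y" if "eqm (Dim (Suc n)) x y" for x y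
  proof -
    have "\<exists>e. d + x = e + y \<and> e \<in> Dim (Suc n)" if "d \<in> Dim (Suc n)" for d
      using nsg_add[OF nsg_Dim that] \<open>eqm (Dim (Suc n)) x y\<close>
      by (intro exI[of _ "d + (x - y)"]) (simp add: eqm_def add.assoc)
    then show ?thesis by (fastforce simp: dcoset_def)
  qed
  assume "eqm (Dim (Suc n)) x y"
  then show ?thesis using * eqm_sym[OF nsg_Dim] by blast
qed

lemma dcoset_eq_iff: "dcoset n x = dcoset n y \<longleftrightarrow> eqm (Dim (Suc n)) x y"
proof
  assume "dcoset n x = dcoset n y"
  moreover have "act x \<in> dcoset n x"
    using nsg_zero[OF nsg_Dim] by (auto simp: dcoset_def intro!: imageI exI[of _ 0])
  ultimately obtain d where "x = d + y" "d \<in> Dim (Suc n)"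
    by (auto simp: dcoset_def act_inject)
  then show "eqm (Dim (Suc n)) x y" by (simp add: eqm_def)
qed (rule dcoset_cong)

abbreviation Dquot :: "nat \<Rightarrow> (bool list \<Rightarrow> bool list) set monoid"
  where "Dquot \<equiv> dim_quotient BSV"

lemma carrier_Q: "carrier (Dquot n) = dcoset n ` Dim n"
proof -
  have "carrier (Dquot n) = (\<lambda>g. dim_series BSV (Suc n) #>\<^bsub>BSV\<^esub> g) ` dim_series BSV n"
    by (auto simp: dim_quotient_def carrier_FactGroup r_coset_def)
  then show ?thesis
    unfolding act_Dim[of n, symmetric] image_image dcoset_coset .
qed

lemma one_Q: "\<one>\<^bsub>Dquot n\<^esub> = dcoset n 0"
  by (simp add: dim_quotient_def FactGroup_def dcoset_def act_Dim)

lemma mult_Q: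
  assumes "x \<in> Dim n" "y \<in> Dim n" shows "dcoset n x \<otimes>\<^bsub>Dquot n\<^esub> dcoset n y = dcoset n (x + y)"
proof -
  have "(dim_series BSV (Suc n) #>\<^bsub>BSV\<^esub> act x) <#>\<^bsub>BSV\<^esub> (dim_series BSV (Suc n) #>\<^bsub>BSV\<^esub> act y)
      = dim_series BSV (Suc n) #>\<^bsub>BSV\<^esub> (act x \<otimes>\<^bsub>BSV\<^esub> act y)"
    by (rule normal.rcos_sum[OF BSV.dim_series_normal])
      (use Dim_Gam assms in auto)
  then show ?thesis
    by (simp add: dcoset_coset dim_quotient_def FactGroup_def set_mult_def)
qed

lemma Q_group: "1 \<le> n \<Longrightarrow> comm_group (Dquot n)"
  by (rule BSV.dim_quotient_comm_group)

lemma Q_group': "n \<in> {1..} \<Longrightarrow> group (Dquot n)"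
  using comm_group.axioms(2)[OF Q_group] by simp

lemma BSV_L_simps:
  "carrier BSV_letter = {x \<in> \<Pi>\<^sub>E i\<in>{1..}. carrier (Dquot i). finite {i \<in> {1..}. x i \<noteq> \<one>\<^bsub>Dquot i\<^esub>}}"
  "x \<oplus>\<^bsub>BSV_letter\<^esub> y = (\<lambda>i\<in>{1..}. x i \<otimes>\<^bsub>Dquot i\<^esub> y i)"
  "\<zero>\<^bsub>BSV_letter\<^esub> = (\<lambda>i\<in>{1..}. \<one>\<^bsub>Dquot i\<^esub>)"
  using carrier_sum_group[of "{1..}" Dquot, OF Q_group'] by (simp_all add: lie_space_def Let_def)

lemma dclass_apply: "1 \<le> i \<Longrightarrow> dclass n x i = (if i = n then dcoset n x else dcoset i 0)"
  by (simp add: dclass_def lie_incl_def one_Q)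

lemma dclass_closed: "1 \<le> n \<Longrightarrow> x \<in> Dim n \<Longrightarrow> dclass n x \<in> carrier BSV_letter"
proof -
  assume *: "1 \<le> n" "x \<in> Dim n"
  have "{i \<in> {1..}. dclass n x i \<noteq> \<one>\<^bsub>Dquot i\<^esub>} \<subseteq> {n}"
    by (auto simp: dclass_def lie_incl_def)
  then have "finite {i \<in> {1..}. dclass n x i \<noteq> \<one>\<^bsub>Dquot i\<^esub>}" by (rule finite_subset) simp
  moreover have "dclass n x \<in> (\<Pi>\<^sub>E i\<in>{1..}. carrier (Dquot i))"
    using * nsg_zero[OF nsg_Dim] by (auto simp: dclass_def lie_incl_def PiE_iff one_Q carrier_Q)
  ultimately show ?thesis by (simp add: BSV_L_simps)
qed

lemma dclass_add:
  assumes "1 \<le> n" "x \<in> Dim n" "y \<in> Dim n" shows "dclass n (x + y) = dclass n x \<oplus>\<^bsub>BSV_letter\<^esub> dclass n y"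
  using assms mult_Q[of 0 _ 0] nsg_zero[OF nsg_Dim]
  by (auto simp: BSV_L_simps dclass_def lie_incl_def one_Q mult_Q intro!: restrict_ext)

lemma dclass_eq_iff: "1 \<le> n \<Longrightarrow> dclass n x = dclass n y \<longleftrightarrow> eqm (Dim (Suc n)) x y"
proof
  assume "1 \<le> n" "dclass n x = dclass n y"
  then have "dclass n x n = dclass n y n" by simp
  then show "eqm (Dim (Suc n)) x y" using \<open>1 \<le> n\<close> by (simp add: dclass_apply dcoset_eq_iff)
qed (simp add: dclass_def dcoset_cong)

lemma zero_BSV_L: "\<zero>\<^bsub>BSV_letter\<^esub> = dclass n 0"
  by (auto simp: BSV_L_simps dclass_def lie_incl_def one_Q restrict_def fun_eq_iff)

lemma dclass_zero_iff: "1 \<le> n \<Longrightarrow> dclass n x = \<zero>\<^bsub>BSV_letter\<^esub> \<longleftrightarrow> x \<in> Dim (Suc n)"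
  unfolding zero_BSV_L[of n] by (simp add: dclass_eq_iff eqm_zero)

lemma dim_degree_eq:
  assumes "x \<in> Dim n" "x \<notin> Dim (Suc n)" "1 \<le> n"
  shows "dim_degree BSV (act x) = n"
  unfolding dim_degree_def
proof (rule Greatest_equality)
  show "1 \<le> n \<and> act x \<in> dim_series BSV n" using assms by (simp add: Dim_def)
  fix k assume "1 \<le> k \<and> act x \<in> dim_series BSV k"
  then have "x \<in> Dim k" by (simp add: Dim_def)
  then show "k \<le> n" using assms Dim_antimono[of "Suc n" k] by (meson in_mono not_less_eq_eq)
qed

lemma lie_class_eq:
  assumes "x \<in> Dim n" "x \<notin> Dim (Suc n)" "1 \<le> n"
  shows "lie_class BSV (act x) = dclass n x"
  by (simp add: lie_class_def dim_degree_eq[OF assms] dcoset_coset dclass_def)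

lemma lie_supp_dclass:
  assumes "x \<notin> Dim (Suc n)" "1 \<le> n" shows "lie_supp BSV (dclass n x) = {n}"
  using assms by (auto simp: lie_supp_def dclass_def lie_incl_def one_Q dcoset_eq_iff eqm_zero)

lemma BSV_L_singleton: "f a \<in> carrier BSV_letter \<Longrightarrow> (\<Oplus>\<^bsub>BSV_letter\<^esub>b\<in>{a}. f b) = f a"
  by (simp add: V.add.finprod_insert)

text \<open>Both classes are nonzero, so each is supported in a single degree and the bilinear sum
  has one term; independence of representatives follows from \<open>Dim_comm\<close>.\<close>

lemma lie_bracket_dclass:
  assumes x: "x \<in> Dim i" "x \<notin> Dim (Suc i)" "1 \<le> i" and y: "y \<in> Dim j" "y \<notin> Dim (Suc j)" "1 \<le> j"
  shows "lie_bracket BSV (dclass i x) (dclass j y) = dclass (i + j) (comm x y)"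
proof -
  have xy: "comm x y \<in> Dim (i + j)" using Dim_comm x y by blast
  note [simp] = Dim_Gam[OF x(1)] Dim_Gam[OF y(1)]
  have "coset_bracket BSV i j (dcoset i x) (dcoset j y) = dcoset (i + j) (comm x y)"
  proof -
    have "dcoset (i + j) (comm (d + x) (e + y)) = dcoset (i + j) (comm x y)"
      if d: "d \<in> Dim (Suc i)" and e: "e \<in> Dim (Suc j)" for d e
    proof (rule dcoset_cong)
      have N: "nsg (Dim (Suc (i + j)))" by (rule nsg_Dim)
      note [simp] = Dim_Gam[OF d] Dim_Gam[OF e]
      have "e + y \<in> Dim j"
        using subsetD[OF Dim_antimono e, of j] y by (simp add: nsg_add[OF nsg_Dim])
      then have 1: "comm d (e + y) \<in> Dim (Suc (i + j))"
        using Dim_comm[OF d, of "e + y" j] y by simp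
      have 2: "comm x e \<in> Dim (Suc (i + j))"
        using Dim_comm[OF x(1) e x(3)] by simp
      have "comm (d + x) (e + y) = cjg x (comm d (e + y)) + (comm x y + cjg y (comm x e))"
        by (simp only: comm_add_left[of d x "e + y"] comm_add_right[of x e y])
      moreover have "eqm (Dim (Suc (i + j))) (comm x y + cjg y (comm x e)) (comm x y + 0)"
        using 2 by (intro eqm_add_left[OF N]) (simp_all add: eqm_zero nsg_cjg[OF N])
      ultimately show "eqm (Dim (Suc (i + j))) (comm (d + x) (e + y)) (comm x y)"
        using 1 by (simp add: eqm_left[OF N] nsg_cjg[OF N])
    qed
    then have *: "dim_series BSV (Suc (i + j)) #>\<^bsub>BSV\<^esub> commutator BSV g h = dcoset (i + j) (comm x y)"
      if "g \<in> dcoset i x" "h \<in> dcoset j y" for g h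
      using that Dim_Gam by (auto simp: dcoset_def[of i] dcoset_def[of j] dcoset_coset)
    have "act x \<in> dcoset i x" "act y \<in> dcoset j y"
      using nsg_zero[OF nsg_Dim] by (auto simp: dcoset_def intro!: imageI exI[of _ 0])
    then show ?thesis
      unfolding coset_bracket_def using * by fastforce
  qed
  then have "lie_incl BSV (i + j) (coset_bracket BSV i j (dclass i x i) (dclass j y j)) = dclass (i + j) (comm x y)"
    using x y by (simp add: dclass_apply) (simp add: dclass_def)
  moreover have "dclass (i + j) (comm x y) \<in> carrier BSV_letter" using xy x by (intro dclass_closed) auto
  ultimately show ?thesis
    by (simp add: lie_bracket_def lie_supp_dclass[OF x(2,3)] lie_supp_dclass[OF y(2,3)] BSV_L_singleton)
qed

lemma lie_frobenius_dclass:
  assumes x: "x \<in> Dim i" "x \<notin> Dim (Suc i)" "1 \<le> i"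
  shows "lie_frobenius BSV (dclass i x) = dclass (2 * i) (x + x)"
proof -
  have xx: "x + x \<in> Dim (2 * i)" using x by (intro Dim_double) auto
  note [simp] = Dim_Gam[OF x(1)]
  have "coset_square BSV i (dcoset i x) = dcoset (2 * i) (x + x)"
  proof -
    have "dcoset (2 * i) (d + x + (d + x)) = dcoset (2 * i) (x + x)" if d: "d \<in> Dim (Suc i)" for d
    proof (rule dcoset_cong)
      have N: "nsg (Dim (Suc (2 * i)))" by (rule nsg_Dim)
      have "d + d \<in> Dim (Suc (2 * i))" using x by (intro Dim_double[OF _ d]) auto
      moreover have "comm d (- x) \<in> Dim (Suc (2 * i))"
        using Dim_comm[OF d nsg_minus[OF nsg_Dim x(1)]] x by (simp add: mult_2)
      \<comment> \<open>In multiplicative notation, (dx)^2 = d^2 [d, x^-1] x^2, where the first two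
        factors lie in higher degree.\<close>
      moreover have "d + x + (d + x) = (d + d + comm d (- x)) + (x + x)"
        by (simp only: comm_word)
      ultimately show "eqm (Dim (Suc (2 * i))) (d + x + (d + x)) (x + x)"
        by (simp only: eqm_left[OF N] nsg_add[OF N] eqm_refl[OF N])
    qed
    then have *: "dim_series BSV (Suc (2 * i)) #>\<^bsub>BSV\<^esub> (g \<otimes>\<^bsub>BSV\<^esub> g) = dcoset (2 * i) (x + x)"
      if "g \<in> dcoset i x" for g
      using that by (auto simp: dcoset_def[of i] dcoset_coset)
    have "act x \<in> dcoset i x"
      using nsg_zero[OF nsg_Dim] by (auto simp: dcoset_def intro!: imageI exI[of _ 0])
    then show ?thesis
      unfolding coset_square_def using * by fastforce
  qed
  then have "lie_incl BSV (2 * i) (coset_square BSV i (dclass i x i)) = dclass (2 * i) (x + x)"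
    using x by (simp add: dclass_apply) (simp add: dclass_def)
  moreover have "dclass (2 * i) (x + x) \<in> carrier BSV_letter" using xx x by (intro dclass_closed) auto
  moreover have "{p \<in> lie_supp BSV (dclass i x) \<times> lie_supp BSV (dclass i x). fst p < snd p} = {}"
    by (auto simp: lie_supp_dclass[OF x(2,3)])
  ultimately show ?thesis
    unfolding lie_frobenius_def by (simp only:) (simp add: lie_supp_dclass[OF x(2,3)] BSV_L_singleton)
qed

section \<open>Linear independence\<close>

fun basis_elt :: "bsv_index \<Rightarrow> wperm" where
  "basis_elt (TauPow n) = zpow \<tau> (2 ^ n)"
| "basis_elt (MuPow n) = zpow \<mu> (2 ^ n)"
| "basis_elt (WordPow W n) = zpow (wact W \<gamma>) (2 ^ n)"

fun basis_deg :: "bsv_index \<Rightarrow> nat" where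
  "basis_deg (TauPow n) = 2 ^ n"
| "basis_deg (MuPow n) = 2 ^ n"
| "basis_deg (WordPow W n) = 2 ^ n * wdeg W"

lemma act_basis_elt: "act (basis_elt b) = bsv_elt b"
proof -
  have "act (zpow x (2 ^ n)) = act x [^]\<^bsub>BSV\<^esub> ((2::nat) ^ n)" for x n
    using npow_eq_zpow[of x "2 ^ n"] by (simp add: act_pow)
  then show ?thesis
    by (cases b) (simp_all add: act_wact act_C \<tau>.rep_eq \<mu>.rep_eq)
qed

lemma basis_deg_pos: "1 \<le> basis_deg b"
  using wdeg_ge_2 by (cases b) (auto simp: Suc_le_eq intro: order.strict_trans2[OF _ wdeg_ge_2])

lemma basis_elt_Dim: "basis_elt b \<in> Dim (basis_deg b)"
proof (cases b)
  case (WordPow W n)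
  then show ?thesis using Dim_power[OF word_Dim, of W n 1] wdeg_ge_2[of W] by simp
qed (use Dim_power[of \<tau> 1 _ 1] Dim_power[of \<mu> 1 _ 1] in \<open>auto simp: Dim_1\<close>)

text \<open>The product of the W(c) raised to the powers \<open>\<kappa> W\<close> over all W with
  |W| < m, in the order that makes it an iterated normal form.\<close>

fun nform :: "nat \<Rightarrow> (bool list \<Rightarrow> int) \<Rightarrow> wperm" where
  "nform 0 \<kappa> = 0"
| "nform (Suc m) \<kappa> = zpow \<gamma> (\<kappa> []) + (letter False (nform m (\<lambda>W. \<kappa> (False # W))) + letter True (nform m (\<lambda>W. \<kappa> (True # W))))"

lemma nform_Der: "nform m \<kappa> \<in> \<Gamma>'"
proof (induction m arbitrary: \<kappa>)
  case (Suc m)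
  have "letter b x \<in> \<Gamma>'" if "x \<in> \<Gamma>'" for b x
    using wact_Der[OF that, of "[b]"] by simp
  with Suc show ?case
    by (simp add: nsg_add[OF nsg_Der] nsg_zpow[OF nsg_Der])
qed (simp add: nsg_zero[OF nsg_Der])

text \<open>Uniqueness of the normal form identifies, level by level, the exponents
  \<open>\<kappa>\<close> with those constrained by \<open>Fil\<close>.\<close>

lemma nform_Fil:
  assumes "nform m \<kappa> \<in> Fil m s r" "length W < m"
  shows "\<kappa> W \<in> exps (real (wdeg W) - s) r"
  using assms
proof (induction m arbitrary: \<kappa> s r W)
  case (Suc m)
  obtain k a h where *: "nform (Suc m) \<kappa> = zpow \<gamma> k + pair a 0 + pair h h" "k \<in> exps (2 - s) r"
    "a \<in> Fil m ((1 + s) / 2) (r / 2)" "h \<in> Fil m (s / 2) (r / 2)"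
    using Fil_Suc_cases[OF Suc.prems(1)] by blast
  let ?a = "nform m (\<lambda>W. \<kappa> (False # W))" and ?h = "nform m (\<lambda>W. \<kappa> (True # W))"
  have "zpow \<gamma> (\<kappa> []) + pair (?a + ?h) ?h = zpow \<gamma> k + pair (a + h) h"
    using *(1) by (simp add: letter_def pair_add add.assoc)
  then have eq: "\<kappa> [] = k \<and> ?a + ?h = a + h \<and> ?h = h"
    using nform_Der subsetD[OF Fil_Der *(3)] subsetD[OF Fil_Der *(4)]
    by (intro normal_form_unique) (auto intro: nsg_add[OF nsg_Der])
  then have ah: "?a \<in> Fil m ((1 + s) / 2) (r / 2)" "?h \<in> Fil m (s / 2) (r / 2)"
    using * by auto
  show ?case
  proof (cases W)
    case Nil
    then show ?thesis using eq * by simp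
  next
    case (Cons b W')
    have d: "real (wdeg (False # W')) - s = 2 * (wdeg W' - (1 + s) / 2)"
        "real (wdeg (True # W')) - s = 2 * (wdeg W' - s / 2)"
      using wdeg_ge_2[of W'] by (simp_all add: of_nat_diff field_simps)
    have half: "exps (2 * w) r = exps w (r / 2)" for w
      using exps_half[of "2 * w" r] by simp
    have "length W' < m" using Suc.prems(2) Cons by simp
    from Suc.IH[OF ah(1) this] Suc.IH[OF ah(2) this] show ?thesis
      unfolding Cons by (cases b) (simp_all only: d half)
  qed
qed simp

lemma TU_unique:
  assumes "zpow \<tau> a + zpow \<mu> b + x = zpow \<tau> a' + zpow \<mu> b' + y" "x \<in> \<Gamma>'" "y \<in> \<Gamma>'"
  shows "a = a' \<and> b = b' \<and> x = y"
proof -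
  let ?v = "zpow \<tau> a + zpow \<mu> b" and ?v' = "zpow \<tau> a' + zpow \<mu> b'"
  have [simp]: "x \<in> \<Gamma>" "y \<in> \<Gamma>" using assms by auto
  have "- ?v' + (?v + x) - x = - ?v' + (?v' + y) - x"
    using assms(1) by (simp only: add.assoc)
  then have "- ?v' + ?v = y - x" by (simp only: group_word)
  moreover have "?v - ?v' = cjg (- ?v') (- ?v' + ?v)" by (simp only: comm_word)
  ultimately have v: "?v + - ?v' \<in> \<Gamma>'"
    using nsg_cjg[OF nsg_Der nsg_diff[OF nsg_Der assms(3,2)], of "- ?v'"] by simp
  have "eqm \<Gamma>' (?v + - ?v') (zpow \<tau> (a + - a') + zpow \<mu> (b + - b'))"
    by (rule eqm_trans[OF nsg_Der eqm_add_left[OF nsg_Der TU_minus] TU_add]) simp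
  from TU_Der[OF eqm_mem[OF nsg_Der eqm_sym[OF nsg_Der this] v]]
  have "a = a' \<and> b = b'" by simp
  then show ?thesis using assms(1) by simp
qed

lemma finite_words: "finite {W :: bool list. length W < m}"
  using finite_lists_length_le[of "UNIV :: bool set" m]
  by (rule finite_subset[rotated]) auto

lemma words_Suc:
  "{W. length W < Suc m} = {[]} \<union> (Cons False ` {W. length W < m} \<union> Cons True ` {W. length W < m})"
proof -
  have "W \<in> Cons False ` {W. length W < m} \<union> Cons True ` {W. length W < m}"
    if "length W < Suc m" "W \<noteq> []" for W
    using that by (cases W; cases "hd W") auto
  then show ?thesis by auto
qed

text \<open>All factors lie in \<open>Dim n\<close>, hence commute modulo
  \<open>Dim (Suc n)\<close>, and the order fixed by \<open>nform\<close> is immaterial. The prefix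
  \<open>V\<close> is carried for the induction.\<close>

lemma dclass_nform:
  assumes n: "1 \<le> n" and "\<And>W. length W < m \<Longrightarrow> zpow (wact (V @ W) \<gamma>) (\<kappa> W) \<in> Dim n"
  shows "wact V (nform m \<kappa>) \<in> Dim n \<and>
    dclass n (wact V (nform m \<kappa>)) = (\<Oplus>\<^bsub>BSV_letter\<^esub>W\<in>{W. length W < m}. dclass n (zpow (wact (V @ W) \<gamma>) (\<kappa> W)))"
  using assms(2)
proof (induction m arbitrary: V \<kappa>)
  case 0
  show ?case using zero_BSV_L[of n] by (simp add: nsg_zero[OF nsg_Dim])
next
  case (Suc m)
  let ?w = "\<lambda>W. dclass n (zpow (wact (V @ W) \<gamma>) (\<kappa> W))"
  have wc: "?w W \<in> carrier BSV_letter" if "length W < Suc m" for W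
    using dclass_closed[OF n] Suc.prems[OF that] .
  let ?x = "\<lambda>b. wact (V @ [b]) (nform m (\<lambda>W. \<kappa> (b # W)))"
  have IH: "?x b \<in> Dim n \<and> dclass n (?x b) = (\<Oplus>\<^bsub>BSV_letter\<^esub>W\<in>Cons b ` {W. length W < m}. ?w W)" for b
  proof -
    have "(\<Oplus>\<^bsub>BSV_letter\<^esub>W\<in>Cons b ` {W. length W < m}. ?w W) = (\<Oplus>\<^bsub>BSV_letter\<^esub>W\<in>{W. length W < m}. ?w (b # W))"
      using wc by (intro V.add.finprod_reindex) auto
    then show ?thesis
      using Suc.IH[of "V @ [b]" "\<lambda>W. \<kappa> (b # W)"] Suc.prems[of "b # W" for W] by simp
  qed
  have eq: "wact V (nform (Suc m) \<kappa>) = zpow (wact V \<gamma>) (\<kappa> []) + (?x False + ?x True)"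
    by (simp add: wact_add wact_zpow wact_append)
  have 0: "zpow (wact V \<gamma>) (\<kappa> []) \<in> Dim n" using Suc.prems[of "[]"] by simp
  have "dclass n (wact V (nform (Suc m) \<kappa>)) = ?w [] \<oplus>\<^bsub>BSV_letter\<^esub> (dclass n (?x False) \<oplus>\<^bsub>BSV_letter\<^esub> dclass n (?x True))"
    unfolding eq using IH 0 by (simp add: dclass_add[OF n] nsg_add[OF nsg_Dim])
  also have "\<dots> = (\<Oplus>\<^bsub>BSV_letter\<^esub>W\<in>{W. length W < Suc m}. ?w W)"
  proof -
    have "(\<Oplus>\<^bsub>BSV_letter\<^esub>W\<in>Cons False ` {W. length W < m} \<union> Cons True ` {W. length W < m}. ?w W)
        = dclass n (?x False) \<oplus>\<^bsub>BSV_letter\<^esub> dclass n (?x True)"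
      using wc finite_words IH by (subst V.add.finprod_Un_disjoint) auto
    moreover have "(\<Oplus>\<^bsub>BSV_letter\<^esub>W\<in>{[]}. ?w W) = ?w []"
      using wc[of "[]"] by (simp add: BSV_L_singleton)
    ultimately show ?thesis
      unfolding words_Suc using wc finite_words wc[of "[]"]
      by (subst V.add.finprod_Un_disjoint) auto
  qed
  finally show ?case
    unfolding eq using IH 0 by (simp add: nsg_add[OF nsg_Dim])
qed

lemma basis_deg_WordPow_length: "basis_deg (WordPow W v) = n \<Longrightarrow> length W < n"
proof -
  assume "basis_deg (WordPow W v) = n"
  then have "1 * wdeg W \<le> n" using mult_right_mono[of 1 "2 ^ v" "wdeg W"] by simp
  moreover have "length W < 2 ^ length W" by (rule less_exp)
  ultimately show "length W < n" using wdeg_ge[of W] by linarith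
qed

lemma basis_deg_inj: "basis_deg (WordPow W v) = basis_deg (WordPow W v') \<Longrightarrow> v = v'"
  using wdeg_ge_2[of W] by simp

text \<open>A power 2^u dividing 2^v has u <= v, so it guarantees at most the degree 2^v d.\<close>

lemma power_2_not_exps:
  assumes "(2 ^ v :: int) \<in> exps (real d) (real (Suc (2 ^ v * d)))" shows False
  using assms
proof (cases rule: exps_cases)
  case (2 u j)
  have "(2 :: int) ^ u dvd 2 ^ v" using 2(1) by simp
  then have "u \<le> v" by (simp add: dvd_power_iff)
  then have "(2 :: real) ^ u * real d \<le> 2 ^ v * real d" by (intro mult_right_mono) auto
  then show ?thesis using 2(2) by simp
qed simp

text \<open>A homogeneous relation over the two-element field is a vanishing subset sum. It says
  that one product of basis elements lies in the next term of the series; uniqueness of exponents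
  then forces each exponent to satisfy the condition of degree n + 1, which a power of two of exact
  degree n violates.\<close>

lemma basis_elt_independent:
  assumes S: "finite S" "S \<noteq> {}" and deg: "\<And>b. b \<in> S \<Longrightarrow> basis_deg b = n"
  shows "(\<Oplus>\<^bsub>BSV_letter\<^esub>b\<in>S. dclass n (basis_elt b)) \<noteq> \<zero>\<^bsub>BSV_letter\<^esub>"
proof
  assume sum0: "(\<Oplus>\<^bsub>BSV_letter\<^esub>b\<in>S. dclass n (basis_elt b)) = \<zero>\<^bsub>BSV_letter\<^esub>"
  have n: "1 \<le> n" using S deg basis_deg_pos by blast
  have basis_elt_n: "basis_elt b \<in> Dim n" if "b \<in> S" for b using basis_elt_Dim[of b] deg[OF that] by simp
  then have dclass_basis_elt: "dclass n (basis_elt b) \<in> carrier BSV_letter" if "b \<in> S" for b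
    using dclass_closed[OF n] that by simp
  \<comment> \<open>For \<tau>^(2^j) of degree \<open>n\<close> the exponent is \<open>n\<close>
    itself, and for W(c)^(2^v) it is n / deg W; so the exponents can be defined without naming
    \<open>j\<close> or \<open>v\<close>, with 0 for elements absent from \<open>S\<close>.\<close>
  define a where "a = (if \<exists>j. TauPow j \<in> S then int n else 0)"
  define b where "b = (if \<exists>j. MuPow j \<in> S then int n else 0)"
  define \<kappa> where "\<kappa> W = (if \<exists>v. WordPow W v \<in> S then int (n div wdeg W) else 0)" for W
  have a1: "a = 2 ^ j" if "TauPow j \<in> S" for j using deg[OF that] that by (auto simp: a_def)
  have b1: "b = 2 ^ j" if "MuPow j \<in> S" for j using deg[OF that] that by (auto simp: b_def)
  have \<kappa>1: "\<kappa> W = 2 ^ v" if "WordPow W v \<in> S" for W v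
    using deg[OF that] that wdeg_ge_2[of W] by (auto simp: \<kappa>_def)
  define St where "St = {b \<in> S. \<exists>j. b = TauPow j}"
  define Sm where "Sm = {b \<in> S. \<exists>j. b = MuPow j}"
  define Sw where "Sw = {b \<in> S. \<exists>W v. b = WordPow W v}"
  have fin: "finite St" "finite Sm" "finite Sw" using S by (auto simp: St_def Sm_def Sw_def)
  have St: "zpow \<tau> a \<in> Dim n \<and> (\<Oplus>\<^bsub>BSV_letter\<^esub>b\<in>St. dclass n (basis_elt b)) = dclass n (zpow \<tau> a)"
  proof (cases "\<exists>j. TauPow j \<in> S")
    case True
    then obtain j where j: "TauPow j \<in> S" by blast
    have "j' = j" if "TauPow j' \<in> S" for j'
    proof -
      have "(2 :: nat) ^ j' = 2 ^ j" using deg[OF that] deg[OF j] by simp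
      then show ?thesis by simp
    qed
    then have "St = {TauPow j}" unfolding St_def using j by blast
    then show ?thesis using a1[OF j] dclass_basis_elt[OF j] basis_elt_n[OF j] by (simp add: BSV_L_singleton)
  next
    case False
    then have "St = {}" by (auto simp: St_def)
    then show ?thesis using False zero_BSV_L[of n] by (simp add: a_def nsg_zero[OF nsg_Dim])
  qed
  have Sm: "zpow \<mu> b \<in> Dim n \<and> (\<Oplus>\<^bsub>BSV_letter\<^esub>b\<in>Sm. dclass n (basis_elt b)) = dclass n (zpow \<mu> b)"
  proof (cases "\<exists>j. MuPow j \<in> S")
    case True
    then obtain j where j: "MuPow j \<in> S" by blast
    have "j' = j" if "MuPow j' \<in> S" for j'
    proof -
      have "(2 :: nat) ^ j' = 2 ^ j" using deg[OF that] deg[OF j] by simp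
      then show ?thesis by simp
    qed
    then have "Sm = {MuPow j}" unfolding Sm_def using j by blast
    then show ?thesis using b1[OF j] dclass_basis_elt[OF j] basis_elt_n[OF j] by (simp add: BSV_L_singleton)
  next
    case False
    then have "Sm = {}" by (auto simp: Sm_def)
    then show ?thesis using False zero_BSV_L[of n] by (simp add: b_def nsg_zero[OF nsg_Dim])
  qed
  have \<kappa>_Dim: "zpow (wact W \<gamma>) (\<kappa> W) \<in> Dim n" for W
  proof (cases "\<exists>v. WordPow W v \<in> S")
    case True
    then obtain v where "WordPow W v \<in> S" by blast
    then show ?thesis using \<kappa>1 basis_elt_n by force
  next
    case False
    then show ?thesis by (simp add: \<kappa>_def nsg_zero[OF nsg_Dim])
  qed
  have nform: "nform n \<kappa> \<in> Dim n \<and> dclass n (nform n \<kappa>) = (\<Oplus>\<^bsub>BSV_letter\<^esub>W\<in>{W. length W < n}. dclass n (zpow (wact W \<gamma>) (\<kappa> W)))"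
    using dclass_nform[OF n, of n "[]" \<kappa>] \<kappa>_Dim by simp
  define word where "word b = (case b of WordPow W v \<Rightarrow> W | _ \<Rightarrow> [])" for b
  have inj: "inj_on word Sw"
  proof (rule inj_onI)
    fix b b' assume b: "b \<in> Sw" "b' \<in> Sw" "word b = word b'"
    then obtain W v v' where W: "b = WordPow W v" "b' = WordPow W v'"
      by (auto simp: Sw_def word_def)
    have "basis_deg b = n" "basis_deg b' = n" using b deg by (auto simp: Sw_def)
    then show "b = b'" using basis_deg_inj[of W v v'] W by simp
  qed
  have Sw: "(\<Oplus>\<^bsub>BSV_letter\<^esub>b\<in>Sw. dclass n (basis_elt b)) = dclass n (nform n \<kappa>)"
  proof -
    have "(\<Oplus>\<^bsub>BSV_letter\<^esub>W\<in>word ` Sw. dclass n (zpow (wact W \<gamma>) (\<kappa> W)))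
        = (\<Oplus>\<^bsub>BSV_letter\<^esub>b\<in>Sw. dclass n (zpow (wact (word b) \<gamma>) (\<kappa> (word b))))"
      using \<kappa>_Dim dclass_closed[OF n] by (intro V.add.finprod_reindex inj) auto
    also have "\<dots> = (\<Oplus>\<^bsub>BSV_letter\<^esub>b\<in>Sw. dclass n (basis_elt b))"
      using \<kappa>1 dclass_basis_elt by (intro V.add.finprod_cong') (auto simp: Sw_def word_def)
    finally have *: "(\<Oplus>\<^bsub>BSV_letter\<^esub>W\<in>word ` Sw. dclass n (zpow (wact W \<gamma>) (\<kappa> W))) = (\<Oplus>\<^bsub>BSV_letter\<^esub>b\<in>Sw. dclass n (basis_elt b))" .
    have "(\<Oplus>\<^bsub>BSV_letter\<^esub>W\<in>word ` Sw. dclass n (zpow (wact W \<gamma>) (\<kappa> W)))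
        = (\<Oplus>\<^bsub>BSV_letter\<^esub>W\<in>{W. length W < n}. dclass n (zpow (wact W \<gamma>) (\<kappa> W)))"
    proof (rule V.add.finprod_mono_neutral_cong_left)
      show "word ` Sw \<subseteq> {W. length W < n}"
        using basis_deg_WordPow_length[OF deg] by (auto simp: Sw_def word_def simp del: basis_deg.simps)
      show "dclass n (zpow (wact W \<gamma>) (\<kappa> W)) = \<zero>\<^bsub>BSV_letter\<^esub>" if "W \<in> {W. length W < n} - word ` Sw" for W
      proof -
        have "\<nexists>v. WordPow W v \<in> S" using that by (force simp: Sw_def word_def image_iff)
        then show ?thesis using zero_BSV_L[of n] by (simp add: \<kappa>_def)
      qed
    qed (use finite_words dclass_closed[OF n] \<kappa>_Dim in auto)
    then show ?thesis using * nform by simp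
  qed
  define x where "x = zpow \<tau> a + zpow \<mu> b + nform n \<kappa>"
  have "S = St \<union> (Sm \<union> Sw)"
  proof -
    have "b \<in> St \<union> (Sm \<union> Sw)" if "b \<in> S" for b
      using that by (cases b) (auto simp: St_def Sm_def Sw_def)
    then show ?thesis by (auto simp: St_def Sm_def Sw_def)
  qed
  moreover have "St \<inter> (Sm \<union> Sw) = {}" "Sm \<inter> Sw = {}"
    by (auto simp: St_def Sm_def Sw_def)
  moreover have "(\<lambda>b. dclass n (basis_elt b)) \<in> St \<rightarrow> carrier BSV_letter" "(\<lambda>b. dclass n (basis_elt b)) \<in> Sm \<rightarrow> carrier BSV_letter"
    "(\<lambda>b. dclass n (basis_elt b)) \<in> Sw \<rightarrow> carrier BSV_letter"
    using dclass_basis_elt by (auto simp: St_def Sm_def Sw_def)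
  ultimately have "(\<Oplus>\<^bsub>BSV_letter\<^esub>b\<in>S. dclass n (basis_elt b)) = dclass n (zpow \<tau> a) \<oplus>\<^bsub>BSV_letter\<^esub> (dclass n (zpow \<mu> b) \<oplus>\<^bsub>BSV_letter\<^esub> dclass n (nform n \<kappa>))"
    using fin St Sm Sw by (simp add: V.add.finprod_Un_disjoint)
  also have "\<dots> = dclass n x"
    using St Sm nform by (simp add: x_def dclass_add[OF n] nsg_add[OF nsg_Dim] add.assoc)
  finally have "dclass n x = \<zero>\<^bsub>BSV_letter\<^esub>"
    using sum0 by (rule trans[OF sym])
  then have "x \<in> Dim (Suc n)" by (simp only: dclass_zero_iff[OF n])
  \<comment> \<open>Depth \<open>n\<close> suffices, since n + 1 <= 2^n + 1.\<close>
  then have "x \<in> Ser n (Suc n)"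
    using Dim_eq_Ser[of "Suc n" n] less_exp[of n] by (simp add: Suc_le_eq)
  then obtain a' b' g where x: "x = zpow \<tau> a' + zpow \<mu> b' + g"
    "a' \<in> exps 1 (Suc n)" "b' \<in> exps 1 (Suc n)" "g \<in> Fil n 0 (Suc n)"
    by (rule Ser_cases)
  have "a = a' \<and> b = b' \<and> nform n \<kappa> = g"
    using x(1) subsetD[OF Fil_Der x(4)] nform_Der by (intro TU_unique) (simp_all add: x_def)
  then have k: "a \<in> exps 1 (Suc n)" "b \<in> exps 1 (Suc n)" "nform n \<kappa> \<in> Fil n 0 (Suc n)"
    using x by auto
  obtain i where i: "i \<in> S" using S by blast
  show False
  proof (cases i)
    case (TauPow j)
    then show False using k(1) a1[of j] i deg[OF i] power_2_not_exps[of j 1] by simp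
  next
    case (MuPow j)
    then show False using k(2) b1[of j] i deg[OF i] power_2_not_exps[of j 1] by simp
  next
    case (WordPow W v)
    then have "\<kappa> W \<in> exps (real (wdeg W) - 0) (real (Suc n))"
      using nform_Fil[OF k(3)] basis_deg_WordPow_length[of W v n] deg[OF i] by simp
    then show False
      using \<kappa>1[of W v] i deg[OF i] WordPow power_2_not_exps[of v "wdeg W"] by simp
  qed
qed

lemma basis_elt_not_Dim: "basis_elt b \<notin> Dim (Suc (basis_deg b))"
  using basis_elt_independent[of "{b}" "basis_deg b"] dclass_closed[OF basis_deg_pos basis_elt_Dim] dclass_zero_iff[OF basis_deg_pos]
  by (simp add: BSV_L_singleton)

lemma bsv_vec_eq: "bsv_vec b = dclass (basis_deg b) (basis_elt b)"
  unfolding bsv_vec_def act_basis_elt[symmetric]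
  by (rule lie_class_eq[OF basis_elt_Dim basis_elt_not_Dim basis_deg_pos])

lemma dim_degree_elt: "dim_degree BSV (bsv_elt b) = basis_deg b"
  unfolding act_basis_elt[symmetric] by (rule dim_degree_eq[OF basis_elt_Dim basis_elt_not_Dim basis_deg_pos])

lemma bsv_vec_closed: "bsv_vec b \<in> carrier BSV_letter"
  unfolding bsv_vec_eq by (rule dclass_closed[OF basis_deg_pos basis_elt_Dim])

text \<open>Two indices with the same vector would have the same degree and, in characteristic 2,
  vanishing sum, contradicting independence.\<close>

lemma bsv_vec_inj: "inj bsv_vec"
proof (rule injI, rule ccontr)
  fix b b' assume eq: "bsv_vec b = bsv_vec b'" and "b \<noteq> b'"
  define n where "n = basis_deg b"
  have n: "basis_deg b' = n"
    using arg_cong[OF eq, of "lie_supp BSV"]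
    by (simp add: bsv_vec_eq lie_supp_dclass[OF basis_elt_not_Dim basis_deg_pos] n_def)
  have n1: "1 \<le> n" using basis_deg_pos by (simp add: n_def)
  have bD: "basis_elt b \<in> Dim n" using basis_elt_Dim by (simp add: n_def)
  have "dclass n (basis_elt b') = dclass n (basis_elt b)" using eq n by (simp add: bsv_vec_eq n_def)
  then have "(\<Oplus>\<^bsub>BSV_letter\<^esub>i\<in>{b, b'}. dclass n (basis_elt i)) = dclass n (basis_elt b + basis_elt b)"
    using \<open>b \<noteq> b'\<close> dclass_closed[OF n1 bD] dclass_add[OF n1 bD bD] by (simp add: V.add.finprod_insert)
  also have "\<dots> = \<zero>\<^bsub>BSV_letter\<^esub>"
    using Dim_double[OF n1 bD, of "Suc n"] n1 by (simp add: dclass_zero_iff)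
  finally have "(\<Oplus>\<^bsub>BSV_letter\<^esub>i\<in>{b, b'}. dclass n (basis_elt i)) = \<zero>\<^bsub>BSV_letter\<^esub>" .
  moreover have "basis_deg i = n" if "i \<in> {b, b'}" for i using that n by (auto simp: n_def)
  ultimately show False
    using basis_elt_independent[of "{b, b'}" n] by blast
qed

lemma finsum_apply_one:
  assumes "finite S" "1 \<le> n" "\<And>b. b \<in> S \<Longrightarrow> f b \<in> carrier BSV_letter \<and> f b n = \<one>\<^bsub>Dquot n\<^esub>"
  shows "(\<Oplus>\<^bsub>BSV_letter\<^esub>b\<in>S. f b) n = \<one>\<^bsub>Dquot n\<^esub>"
  using assms(1,3)
proof (induction S)
  case empty
  then show ?case using assms(2) by (simp add: BSV_L_simps)
next
  case (insert b S)
  then have "(\<Oplus>\<^bsub>BSV_letter\<^esub>b\<in>insert b S. f b) = f b \<oplus>\<^bsub>BSV_letter\<^esub> (\<Oplus>\<^bsub>BSV_letter\<^esub>b\<in>S. f b)"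
    by (intro V.add.finprod_insert) auto
  then show ?case
    using insert assms(2) mult_Q[of 0 n 0] by (simp add: BSV_L_simps(2) one_Q nsg_zero[OF nsg_Dim])
qed

text \<open>The summands of one degree already form a vanishing sum, because the others are trivial
  in that component.\<close>

lemma finsum_bsv_vec_nonzero:
  assumes S: "finite S" "S \<noteq> {}" shows "(\<Oplus>\<^bsub>BSV_letter\<^esub>b\<in>S. bsv_vec b) \<noteq> \<zero>\<^bsub>BSV_letter\<^esub>"
proof
  assume sum0: "(\<Oplus>\<^bsub>BSV_letter\<^esub>b\<in>S. bsv_vec b) = \<zero>\<^bsub>BSV_letter\<^esub>"
  obtain b0 where "b0 \<in> S" using S by blast
  define n where "n = basis_deg b0"
  have n: "1 \<le> n" using basis_deg_pos by (simp add: n_def)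
  define S1 where "S1 = {b \<in> S. basis_deg b = n}"
  define S2 where "S2 = {b \<in> S. basis_deg b \<noteq> n}"
  let ?x = "\<Oplus>\<^bsub>BSV_letter\<^esub>b\<in>S1. bsv_vec b" and ?y = "\<Oplus>\<^bsub>BSV_letter\<^esub>b\<in>S2. bsv_vec b"
  have fin: "finite S1" "finite S2" using S by (auto simp: S1_def S2_def)
  have xy: "?x \<in> carrier BSV_letter" "?y \<in> carrier BSV_letter"
    using bsv_vec_closed by (auto intro: V.add.finprod_closed)
  have off: "bsv_vec b i = \<one>\<^bsub>Dquot i\<^esub>" if "1 \<le> i" "basis_deg b \<noteq> i" for b i
    using that by (simp add: bsv_vec_eq dclass_apply one_Q)
  have x1: "?x i = \<one>\<^bsub>Dquot i\<^esub>" if "1 \<le> i" "i \<noteq> n" for i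
    using that bsv_vec_closed off fin by (intro finsum_apply_one) (auto simp: S1_def)
  have y1: "?y n = \<one>\<^bsub>Dquot n\<^esub>"
    using n bsv_vec_closed off fin by (intro finsum_apply_one) (auto simp: S2_def)
  have "S = S1 \<union> S2" "S1 \<inter> S2 = {}" by (auto simp: S1_def S2_def)
  moreover from this(2) have "(\<Oplus>\<^bsub>BSV_letter\<^esub>b\<in>S1 \<union> S2. bsv_vec b) = ?x \<oplus>\<^bsub>BSV_letter\<^esub> ?y"
    using fin bsv_vec_closed by (intro V.add.finprod_Un_disjoint) auto
  ultimately have "(?x \<oplus>\<^bsub>BSV_letter\<^esub> ?y) n = \<zero>\<^bsub>BSV_letter\<^esub> n" using sum0 by (simp only:)
  then have "?x n \<otimes>\<^bsub>Dquot n\<^esub> \<one>\<^bsub>Dquot n\<^esub> = \<one>\<^bsub>Dquot n\<^esub>" using n by (simp add: BSV_L_simps(2,3) y1)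
  moreover have "?x n \<in> carrier (Dquot n)" using xy(1) n by (simp add: BSV_L_simps(1) PiE_iff)
  moreover have "group (Dquot n)" using Q_group' n by simp
  ultimately have "?x n = \<one>\<^bsub>Dquot n\<^esub>" by (simp add: group.is_monoid monoid.r_one)
  with x1 have "?x i = \<zero>\<^bsub>BSV_letter\<^esub> i" if "1 \<le> i" for i
    using that by (cases "i = n") (auto simp: BSV_L_simps(3))
  moreover have "?x \<in> extensional {1..}" "\<zero>\<^bsub>BSV_letter\<^esub> \<in> extensional {1..}"
    using xy(1) V.zero_closed by (auto simp: BSV_L_simps(1) PiE_iff)
  ultimately have "?x = \<zero>\<^bsub>BSV_letter\<^esub>"
    by (intro extensionalityI) auto
  moreover have "?x = (\<Oplus>\<^bsub>BSV_letter\<^esub>b\<in>S1. dclass n (basis_elt b))"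
    using dclass_closed[OF n] basis_elt_Dim by (intro V.add.finprod_cong') (auto simp: S1_def bsv_vec_eq)
  ultimately have "(\<Oplus>\<^bsub>BSV_letter\<^esub>b\<in>S1. dclass n (basis_elt b)) = \<zero>\<^bsub>BSV_letter\<^esub>" by (simp only:)
  moreover have "S1 \<noteq> {}" "\<And>b. b \<in> S1 \<Longrightarrow> basis_deg b = n"
    using \<open>b0 \<in> S\<close> by (auto simp: S1_def n_def)
  ultimately show False
    using basis_elt_independent[OF fin(1)] by blast
qed

lemma bsv_vec_lin_indpt: "V.lin_indpt (range bsv_vec)"
proof
  assume "V.lin_dep (range bsv_vec)"
  then obtain A a v where A: "finite A" "A \<subseteq> range bsv_vec" "a \<in> A \<rightarrow> carrier (residue_ring 2)"
    "V.lincomb a A = \<zero>\<^bsub>BSV_letter\<^esub>" "v \<in> A" "a v \<noteq> \<zero>\<^bsub>residue_ring 2\<^esub>"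
    unfolding V.lin_dep_def by blast
  define S where "S = {b. bsv_vec b \<in> A \<and> a (bsv_vec b) = 1}"
  have AV: "A \<subseteq> carrier BSV_letter" using A(2) bsv_vec_closed by auto
  have a01: "a w = 0 \<or> a w = 1" if "w \<in> A" for w
  proof -
    have "a w \<in> carrier (residue_ring 2)" using A(3) that by auto
    then show ?thesis by (auto simp: residue_ring_def)
  qed
  have "finite (bsv_vec -` A)" using A(1) bsv_vec_inj by (rule finite_vimageI)
  then have fin: "finite S" by (rule finite_subset[rotated]) (auto simp: S_def)
  have one: "1 \<odot>\<^bsub>BSV_letter\<^esub> w = w" "0 \<odot>\<^bsub>BSV_letter\<^esub> w = \<zero>\<^bsub>BSV_letter\<^esub>" if "w \<in> A" for w
    using V.smult_one[of w] V.smult_l_null[of w] AV that by (auto simp: residue_ring_def)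
  have "V.lincomb a A = (\<Oplus>\<^bsub>BSV_letter\<^esub>w\<in>bsv_vec ` S. w)"
    unfolding V.lincomb_def
  proof (rule V.add.finprod_mono_neutral_cong_right)
    show "a w \<odot>\<^bsub>BSV_letter\<^esub> w = \<zero>\<^bsub>BSV_letter\<^esub>" if "w \<in> A - bsv_vec ` S" for w
    proof -
      have "a w \<noteq> 1" using that A(2) by (auto simp: S_def)
      then show ?thesis using a01[of w] one[of w] that by auto
    qed
    show "(\<lambda>w. a w \<odot>\<^bsub>BSV_letter\<^esub> w) \<in> A \<rightarrow> carrier BSV_letter"
      using A(3) AV by (auto intro!: V.smult_closed)
  qed (use A(1) one in \<open>auto simp: S_def\<close>)
  also have "\<dots> = (\<Oplus>\<^bsub>BSV_letter\<^esub>b\<in>S. bsv_vec b)"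
    using bsv_vec_closed bsv_vec_inj by (intro V.add.finprod_reindex) (auto intro: inj_on_subset)
  finally have "(\<Oplus>\<^bsub>BSV_letter\<^esub>b\<in>S. bsv_vec b) = \<zero>\<^bsub>BSV_letter\<^esub>" using A(4) by (simp only:)
  moreover have "S \<noteq> {}"
  proof -
    obtain b where "v = bsv_vec b" using A(2,5) by auto
    moreover have "a v = 1" using a01[OF A(5)] A(6) by (auto simp: residue_ring_def)
    ultimately show ?thesis using A(5) by (auto simp: S_def)
  qed
  ultimately show False using finsum_bsv_vec_nonzero[OF fin] by blast
qed

section \<open>Generation\<close>

text \<open>The elements of \<open>Dim n\<close> whose class lies in the span form a subgroup
  \<open>H\<close>, and \<open>Fil_subset\<close> with this \<open>H\<close> reduces the claim to
  powers of single generators and words.\<close>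

lemma dclass_span:
  assumes n: "1 \<le> n" and x: "x \<in> Dim n" shows "dclass n x \<in> V.span (range bsv_vec)"
proof -
  let ?Sp = "V.span (range bsv_vec)"
  have range: "range bsv_vec \<subseteq> carrier BSV_letter" using bsv_vec_closed by auto
  have sub: "LinearCombinations.submodule (residue_ring 2) ?Sp BSV_letter"
    by (rule V.span_is_submodule[OF range])
  note sub_add = LinearCombinations.submodule.m_closed[OF sub]
    and sub_zero = LinearCombinations.submodule.zero_closed[OF sub]
  define H where "H = {x \<in> Dim n. dclass n x \<in> ?Sp}"
  have small: "x \<in> H" if "x \<in> Dim (Suc n)" for x
    using that Dim_antimono[of n "Suc n"] dclass_zero_iff[OF n, of x] sub_zero by (auto simp: H_def)
  have "- x \<in> H" if "x \<in> H" for x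
  proof -
    have "- x - x = - (x + x)" by (simp only: group_word)
    moreover have "x + x \<in> Dim (Suc n)" using that n by (intro Dim_double[of n]) (auto simp: H_def)
    ultimately have "dclass n (- x) = dclass n x"
      using dclass_eq_iff[OF n] nsg_minus[OF nsg_Dim] by (simp add: eqm_def del: minus_add_distrib)
    then show ?thesis using that nsg_minus[OF nsg_Dim] by (simp add: H_def)
  qed
  moreover have "x + y \<in> H" if "x \<in> H" "y \<in> H" for x y
    using that dclass_add[OF n] sub_add nsg_add[OF nsg_Dim] by (auto simp: H_def)
  ultimately have H: "sgrp H"
    using small[of 0] nsg_zero[OF nsg_Dim] by (auto simp: sgrp_def)
  have basis: "basis_elt b \<in> H" if "basis_deg b = n" for b
  proof -
    have "bsv_vec b \<in> ?Sp" by (rule subsetD[OF V.in_own_span[OF range]]) simp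
    moreover have "bsv_vec b = dclass n (basis_elt b)" using bsv_vec_eq[of b] that by simp
    ultimately show ?thesis using basis_elt_Dim[of b] that by (simp add: H_def)
  qed
  \<comment> \<open>If 2^v d = n, the power is a multiple of a basis element of degree
    \<open>n\<close>; if 2^v d > n, its class vanishes.\<close>
  have exps: "zpow y k \<in> H"
    if k: "k \<in> exps (real d) (real n)" and "y \<in> Dim d" "1 \<le> d"
      and "\<And>v. 2 ^ v * d = n \<Longrightarrow> zpow y (2 ^ v) \<in> H" for y k d
    using k
  proof (cases rule: exps_cases)
    case 1
    then show ?thesis using sgrp_zero[OF H] by simp
  next
    case (2 v j)
    have "n \<le> 2 ^ v * d"
      using 2(2) by (metis (mono_tags) of_nat_le_iff of_nat_mult of_nat_numeral of_nat_power)
    then consider "2 ^ v * d = n" | "Suc n \<le> 2 ^ v * d" by linarith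
    then show ?thesis
    proof cases
      case 1
      then show ?thesis
        using sgrp_zpow[OF H that(4)[OF 1], of j] by (simp add: zpow_zpow 2)
    next
      case 2
      then show ?thesis
        using Dim_power[OF that(2,3), of v j] Dim_antimono small \<open>k = 2 ^ v * j\<close> by blast
    qed
  qed
  have "x \<in> Ser n n"
    using x Dim_eq_Ser[OF n, of n] less_exp[of n] by simp
  then obtain a b g where x': "x = zpow \<tau> a + zpow \<mu> b + g" "a \<in> exps 1 n" "b \<in> exps 1 n" "g \<in> Fil n 0 n"
    by (rule Ser_cases)
  have "zpow \<tau> a \<in> H"
    by (rule exps[of _ 1]) (use x' basis[of "TauPow v" for v] in \<open>auto simp: Dim_1\<close>)
  moreover have "zpow \<mu> b \<in> H"
    by (rule exps[of _ 1]) (use x' basis[of "MuPow v" for v] in \<open>auto simp: Dim_1\<close>)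
  moreover have "Fil n 0 n \<subseteq> H"
  proof (rule Fil_subset[OF H])
    show "zpow (wact W \<gamma>) k \<in> H" if "k \<in> exps (real (wdeg W)) (real n)" for W k
      using basis[of "WordPow W v" for v] wdeg_ge_2[of W] by (intro exps[OF that word_Dim]) auto
    show "wact W g \<in> H" if "length W = n" "g \<in> \<Gamma>'" for W g
      using that less_exp[of n] by (intro small Dim_deep) auto
  qed
  ultimately have "x \<in> H"
    unfolding x'(1) using x'(4) by (intro sgrp_add[OF H]) auto
  then show ?thesis by (simp add: H_def)
qed

lemma bsv_vec_span: "V.span (range bsv_vec) = carrier BSV_letter"
proof
  have range: "range bsv_vec \<subseteq> carrier BSV_letter" using bsv_vec_closed by auto
  show "V.span (range bsv_vec) \<subseteq> carrier BSV_letter"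
    by (rule V.span_is_subset2[OF range])
  have sub: "LinearCombinations.submodule (residue_ring 2) (V.span (range bsv_vec)) BSV_letter"
    by (rule V.span_is_submodule[OF range])
  note sub_add = LinearCombinations.submodule.m_closed[OF sub]
    and sub_zero = LinearCombinations.submodule.zero_closed[OF sub]
  have "x \<in> V.span (range bsv_vec)"
    if "finite A" "A \<subseteq> {1..}" "x \<in> carrier BSV_letter" "\<And>i. i \<in> {1..} - A \<Longrightarrow> x i = \<one>\<^bsub>Dquot i\<^esub>" for A x
    using that
  proof (induction A arbitrary: x)
    case empty
    then have "x \<in> extensional {1..}" by (auto simp: BSV_L_simps(1) PiE_iff)
    then have "x = \<zero>\<^bsub>BSV_letter\<^esub>"
      unfolding BSV_L_simps(3) by (intro extensionalityI[of _ "{1..}"]) (use empty in auto)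
    then show ?case using sub_zero by simp
  next
    case (insert n A)
    have n: "1 \<le> n" using insert.prems by auto
    have xc: "x \<in> (\<Pi>\<^sub>E i\<in>{1..}. carrier (Dquot i))" "finite {i \<in> {1..}. x i \<noteq> \<one>\<^bsub>Dquot i\<^esub>}"
      using insert.prems(2) by (auto simp: BSV_L_simps(1))
    have "x n \<in> dcoset n ` Dim n"
      using PiE_mem[OF xc(1), of n] n carrier_Q[of n] by simp
    then obtain g where g: "g \<in> Dim n" "x n = dcoset n g" by blast
    \<comment> \<open>Induction on the support: removing the component of degree \<open>n\<close>
      subtracts one homogeneous class.\<close>
    define y where "y = x(n := \<one>\<^bsub>Dquot n\<^esub>)"
    have "{i \<in> {1..}. y i \<noteq> \<one>\<^bsub>Dquot i\<^esub>} \<subseteq> {i \<in> {1..}. x i \<noteq> \<one>\<^bsub>Dquot i\<^esub>}"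
      by (auto simp: y_def)
    then have "finite {i \<in> {1..}. y i \<noteq> \<one>\<^bsub>Dquot i\<^esub>}" using xc(2) by (rule finite_subset)
    moreover have "\<one>\<^bsub>Dquot n\<^esub> \<in> carrier (Dquot n)"
      using nsg_zero[OF nsg_Dim] by (auto simp: one_Q carrier_Q)
    ultimately have yc: "y \<in> carrier BSV_letter"
      using xc(1) n by (auto simp: BSV_L_simps(1) PiE_iff y_def extensional_def)
    have "y \<in> V.span (range bsv_vec)"
    proof (rule insert.IH[OF _ yc])
      show "y i = \<one>\<^bsub>Dquot i\<^esub>" if "i \<in> {1..} - A" for i
        using that insert.prems(3)[of i] by (auto simp: y_def)
    qed (use insert.prems in auto)
    moreover have "x = y \<oplus>\<^bsub>BSV_letter\<^esub> dclass n g"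
    proof (rule extensionalityI[of _ "{1..}"])
      fix i :: nat assume i: "i \<in> {1..}"
      have "x i \<in> dcoset i ` Dim i"
        using PiE_mem[OF xc(1) i] carrier_Q[of i] by simp
      then obtain h where h: "h \<in> Dim i" "x i = dcoset i h" by blast
      show "x i = (y \<oplus>\<^bsub>BSV_letter\<^esub> dclass n g) i"
        using i g h by (auto simp: BSV_L_simps(2) y_def dclass_apply one_Q mult_Q nsg_zero[OF nsg_Dim])
    qed (use xc(1) in \<open>auto simp: BSV_L_simps(2) PiE_iff\<close>)
    ultimately show ?case
      using sub_add dclass_span[OF n g(1)] by simp
  qed
  then show "carrier BSV_letter \<subseteq> V.span (range bsv_vec)"
  proof (intro subsetI)
    fix x assume *: "\<And>A x. finite A \<Longrightarrow> A \<subseteq> {1..} \<Longrightarrow> x \<in> carrier BSV_letter \<Longrightarrow>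
      (\<And>i. i \<in> {1..} - A \<Longrightarrow> x i = \<one>\<^bsub>Dquot i\<^esub>) \<Longrightarrow> x \<in> V.span (range bsv_vec)"
      and x: "x \<in> carrier BSV_letter"
    then show "x \<in> V.span (range bsv_vec)"
      by (intro *[of "{i \<in> {1..}. x i \<noteq> \<one>\<^bsub>Dquot i\<^esub>}"]) (auto simp: BSV_L_simps(1))
  qed
qed

lemma bsv_vec_basis: "V.basis (range bsv_vec)"
  using bsv_vec_lin_indpt bsv_vec_span bsv_vec_closed by (auto simp: V.basis_def)

section \<open>The Lie graph\<close>

text \<open>Stated on indices, so that the absence of an arrow can be analysed by the form of the
  index; \<open>lie_graph_eq\<close> carries the relation over to vectors.\<close>

inductive arrow :: "bsv_index \<Rightarrow> arrow_label \<Rightarrow> bsv_index \<Rightarrow> bool" where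
  "arrow (TauPow n) LMu (WordPow (replicate n False) 0)"
| "arrow (MuPow n) LTau (WordPow (replicate n False) 0)"
| "s \<noteq> LTwo \<Longrightarrow> arrow (WordPow (replicate n True) 0) s (WordPow (replicate (n + 1) False) 0)"
| "s \<noteq> LTwo \<Longrightarrow> arrow (WordPow (replicate n True @ False # W) 0) s
     (WordPow (replicate n False @ True # W) 0)"
| "arrow (TauPow n) LTwo (TauPow (n + 1))"
| "arrow (MuPow n) LTwo (MuPow (n + 1))"
| "arrow (WordPow W n) LTwo (WordPow W (n + 1))"

fun gen_of :: "arrow_label \<Rightarrow> wperm" where
  "gen_of LTau = \<tau>" | "gen_of LMu = \<mu>" | "gen_of LTwo = 0"

lemma arrow_target_bracket:
  assumes "s \<noteq> LTwo"
  shows "arrow_target s (bsv_vec b) = dclass (Suc (basis_deg b)) (comm (basis_elt b) (gen_of s))"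
proof -
  have TU: "\<tau> \<in> Dim 1" "\<tau> \<notin> Dim (Suc 1)" "\<mu> \<in> Dim 1" "\<mu> \<notin> Dim (Suc 1)"
    using basis_elt_not_Dim[of "TauPow 0"] basis_elt_not_Dim[of "MuPow 0"] by (simp_all add: Dim_1)
  have "lie_class BSV tau = dclass 1 \<tau>" "lie_class BSV mu = dclass 1 \<mu>"
    using lie_class_eq[OF TU(1,2)] lie_class_eq[OF TU(3,4)] by (simp_all add: \<tau>.rep_eq \<mu>.rep_eq)
  then show ?thesis
    using assms lie_bracket_dclass[OF basis_elt_Dim basis_elt_not_Dim basis_deg_pos TU(1,2)]
      lie_bracket_dclass[OF basis_elt_Dim basis_elt_not_Dim basis_deg_pos TU(3,4)]
    by (cases s) (simp_all add: bsv_vec_eq)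
qed

lemma arrow_target_two: "arrow_target LTwo (bsv_vec b) = dclass (2 * basis_deg b) (basis_elt b + basis_elt b)"
  using lie_frobenius_dclass[OF basis_elt_Dim basis_elt_not_Dim basis_deg_pos] by (simp add: bsv_vec_eq)

lemma arrow_target_eq:
  assumes "arrow b s b'" shows "arrow_target s (bsv_vec b) = bsv_vec b'"
proof -
  have two: "zpow x (2 ^ n) + zpow x (2 ^ n) = zpow x (2 * 2 ^ n)" for x :: wperm and n
    using zpow_2_power[of x n 1] by simp
  have gen_by: "gen_of s \<in> {\<tau>, \<mu>}" if "s \<noteq> LTwo" using that by (cases s) auto
  have step: ?thesis
    if "s \<noteq> LTwo" "basis_deg b' = Suc (basis_deg b)" "eqm (Dim (Suc (basis_deg b'))) (comm (basis_elt b) (gen_of s)) (basis_elt b')"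
    using that dclass_eq_iff[OF basis_deg_pos, of b' "comm (basis_elt b) (gen_of s)" "basis_elt b'"]
    by (simp add: arrow_target_bracket[OF that(1)] bsv_vec_eq[of b'])
  show ?thesis
    using assms
  proof cases
    case (1 n)
    show ?thesis
      by (rule step) (use 1 arrow_power(1)[of n] wdeg_False[of n "[]"] in simp_all)
  next
    case (2 n)
    show ?thesis
      by (rule step) (use 2 arrow_power(2)[of n] wdeg_False[of n "[]"] in simp_all)
  next
    case (3 n)
    have d: "wdeg (replicate (n + 1) False) = 2 ^ (n + 1) + 1" "wdeg (replicate n True) = 2 ^ (n + 1)"
      using wdeg_False[of "n + 1" "[]"] wdeg_True[of n "[]"] by simp_all
    show ?thesis
      by (rule step[OF 3(3)])
        (use 3 arrow_True[OF gen_by[OF 3(3)], of n] d in \<open>simp_all del: replicate.simps\<close>)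
  next
    case (4 n W)
    show ?thesis
      by (rule step[OF 4(3)]) (use 4 arrow_False[OF gen_by[OF 4(3)], of n W] wdeg_step(1)[of n W] in simp_all)
  qed (simp_all only: arrow_target_two, simp_all add: bsv_vec_eq two mult.assoc)
qed

lemma no_arrow_target:
  assumes "s \<noteq> LTwo" "\<And>b'. \<not> arrow b s b'"
  shows "arrow_target s (bsv_vec b) = \<zero>\<^bsub>BSV_letter\<^esub>"
proof -
  have gen_by: "gen_of s \<in> {\<tau>, \<mu>}" using assms(1) by (cases s) auto
  have "comm (basis_elt b) (gen_of s) \<in> Dim (Suc (Suc (basis_deg b)))"
  proof (cases b)
    case (TauPow n)
    then have "s = LTau" using assms arrow.intros(1)[of n] by (cases s) auto
    then show ?thesis
      using TauPow comm_zpow_zpow[of \<tau> "2 ^ n" 1] by (simp add: nsg_zero[OF nsg_Dim])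
  next
    case (MuPow n)
    then have "s = LMu" using assms arrow.intros(2)[of n] by (cases s) auto
    then show ?thesis
      using MuPow comm_zpow_zpow[of \<mu> "2 ^ n" 1] by (simp add: nsg_zero[OF nsg_Dim])
  next
    case (WordPow W v)
    \<comment> \<open>Every word is 1^n or 1^n 0W', so each unsquared W(c) has both arrows.\<close>
    have "v \<noteq> 0"
    proof
      assume "v = 0"
      then show False
        using assms WordPow arrow.intros(3,4)
        by (cases W rule: word_cases[of _ True]) fastforce+
    qed
    then show ?thesis
      using no_arrow[OF gen_by, of v W] WordPow by simp
  qed
  then show ?thesis
    using arrow_target_bracket[OF assms(1)] by (simp add: dclass_zero_iff)
qed

lemma arrow_ex_LTwo: "\<exists>b'. arrow b LTwo b'"
  by (cases b) (auto intro: arrow.intros)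

text \<open>Arrows labelled 2 always exist; a missing arrow with another label has target zero,
  which is not a basis vector, so no further arrow can arise.\<close>

lemma lie_graph_eq: "lie_graph (range bsv_vec) = {(bsv_vec b, s, bsv_vec b') | b s b'. arrow b s b'}"
proof -
  have z: "\<zero>\<^bsub>BSV_letter\<^esub> \<notin> range bsv_vec"
    using basis_elt_not_Dim by (auto simp: bsv_vec_eq dclass_zero_iff[OF basis_deg_pos] dest!: sym[of "\<zero>\<^bsub>BSV_letter\<^esub>"])
  have "\<exists>b'. arrow b s b'" if "arrow_target s (bsv_vec b) \<in> range bsv_vec" for b s
  proof (rule ccontr)
    assume "\<nexists>b'. arrow b s b'"
    then show False
      using no_arrow_target[of s b] arrow_ex_LTwo[of b] that z by metis
  qed
  then have "(v, s, u) \<in> {(bsv_vec b, s, bsv_vec b') | b s b'. arrow b s b'}"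
    if "(v, s, u) \<in> lie_graph (range bsv_vec)" for v s u
    using that arrow_target_eq unfolding lie_graph_def by blast
  moreover have "(bsv_vec b, s, bsv_vec b') \<in> lie_graph (range bsv_vec)" if "arrow b s b'" for b s b'
    using arrow_target_eq[OF that] unfolding lie_graph_def by auto
  ultimately show ?thesis by auto
qed

lemma label_iff: "s \<in> {LTau, LMu} \<longleftrightarrow> s \<noteq> LTwo"
  by (cases s) auto

theorem theorem2p1:
  shows
    "inj bsv_vec \<and> vectorspace.basis (residue_ring 2) (lie_space BSV) (range bsv_vec) \<and>
     (\<forall>n. dim_degree BSV (bsv_elt (TauPow n)) = 2 ^ n) \<and>
     (\<forall>n. dim_degree BSV (bsv_elt (MuPow n)) = 2 ^ n) \<and>
     (\<forall>W n. dim_degree BSV (bsv_elt (WordPow W n)) =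
        2 ^ n * ((\<Sum>i<length W. of_bool (W ! i) * 2 ^ i) + 2 ^ length W + 1)) \<and>
     lie_graph (range bsv_vec) =
       {(bsv_vec (TauPow n), LMu, bsv_vec (WordPow (replicate n False) 0)) | n. True} \<union>
       {(bsv_vec (MuPow n), LTau, bsv_vec (WordPow (replicate n False) 0)) | n. True} \<union>
       {(bsv_vec (WordPow (replicate n True) 0), s,
         bsv_vec (WordPow (replicate (n + 1) False) 0)) | n s. s \<in> {LTau, LMu}} \<union>
       {(bsv_vec (WordPow (replicate n True @ [False] @ W) 0), s,
         bsv_vec (WordPow (replicate n False @ [True] @ W) 0)) | n W s. s \<in> {LTau, LMu}} \<union>
       {(bsv_vec (TauPow n), LTwo, bsv_vec (TauPow (n + 1))) | n. True} \<union>
       {(bsv_vec (MuPow n), LTwo, bsv_vec (MuPow (n + 1))) | n. True} \<union>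
       {(bsv_vec (WordPow W n), LTwo, bsv_vec (WordPow W (n + 1))) | W n. True} \<and>
     (\<forall>v \<in> range bsv_vec. \<forall>s \<in> {LTau, LMu}.
        (\<nexists>u. (v, s, u) \<in> lie_graph (range bsv_vec)) \<longrightarrow>
        arrow_target s v = \<zero>\<^bsub>lie_space BSV\<^esub>)"
proof (intro conjI bsv_vec_inj bsv_vec_basis)
  show "\<forall>v \<in> range bsv_vec. \<forall>s \<in> {LTau, LMu}.
        (\<nexists>u. (v, s, u) \<in> lie_graph (range bsv_vec)) \<longrightarrow>
        arrow_target s v = \<zero>\<^bsub>lie_space BSV\<^esub>"
    unfolding lie_graph_eq ball_simps label_iff using no_arrow_target by blast
qed (simp_all only: dim_degree_elt basis_deg.simps wdeg_eq simp_thms,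
     unfold lie_graph_eq label_iff arrow.simps, auto simp del: replicate.simps, blast+)

end
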